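(* Let $\sigma_0>0$, $\alpha_0\in\mathbb{R}$, and consider bounded domains $\Omega_t\subset\mathbb{R}^2$ with boundary $\partial\Omega_t=\{\gamma_t(x):=(1+h(t,x))x:\ x\in\mathbb{S}^1\}$, $h(t,\cdot):\mathbb{S}^1\to(-1,+\infty)$, with $\|h(t,\cdot)\|_{W^{1,\infty}}$ small. The free boundary problem $$\operatorname{div}u=0\ \text{ in }\Omega_t,\qquad \operatorname{curl}u=\alpha_0\ \text{ in }\Omega_t,\qquad \partial_tu+u\cdot\nabla u+\nabla p=0\ \text{ in }\Omega_t,$$ $$p=\sigma_0H_{\Omega_t}\ \text{ on }\partial\Omega_t,\qquad V_t=\langle u,\nu_t\rangle\ \text{ on }\partial\Omega_t,$$ is equivalent to the system on $\mathbb{S}^1$ $$\partial_th=\frac{J}{1+h}\,G(h)\psi+\frac{\alpha_0}{2}\mathcal{M}h,$$ $$\partial_t\psi=\frac12\Big(G(h)\psi+\frac{\langle\nabla_{\mathbb{S}^1}\psi,\nabla_{\mathbb{S}^1}h\rangle}{J(1+h)}\Big)^2-\frac{|\nabla_{\mathbb{S}^1}\psi|^2}{2(1+h)^2}-\sigma_0H(h)+\frac{\alpha_0}{2}\mathcal{M}\psi+\frac{\alpha_0^2}{8}(1+h)^2+\alpha_0K(h)\psi+\sigma_0-\frac{\alpha_0^2}{8},$$ in the following sense. If $(\Omega_t,u,p)$ solves the free boundary problem, then $u=\nabla\Phi-\frac{\alpha_0}{2}\mathcal{J}x$ for some function $\Phi(t,\cdot)$ harmonic in $\Omega_t$, which can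 be chosen (by adding a function of $t$ only) so that $(h,\psi)$, with $\psi(t,\cdot):=\Phi(t,\cdot)\circ\gamma_t$, solves the system. Conversely, if $(h,\psi)$ solves the system, $\Omega_t$ is the domain with boundary $\gamma_t(\mathbb{S}^1)$ and $\Phi(t,\cdot)$ is the harmonic function in $\Omega_t$ with $\Phi(t,\cdot)\circ\gamma_t=\psi(t,\cdot)$, then $u:=\nabla\Phi-\frac{\alpha_0}{2}\mathcal{J}x$, together with a suitable pressure $p$, solves the free boundary problem.
   Context: All functions are assumed smooth enough for the solutions to be classical. $\mathbb{S}^1=\{x\in\mathbb{R}^2:|x|=1\}$, $\langle\cdot,\cdot\rangle$ is the Euclidean product, $\mathcal{J}=\begin{pmatrix}0&-1\\1&0\end{pmatrix}$, and the convention for the curl is $\operatorname{curl}X=\partial_{x_2}X_1-\partial_{x_1}X_2$. $\nu_t$ is the outward unit normal of $\partial\Omega_t$; $H_{\Omega_t}$ is the curvature of $\partial\Omega_t$ (tangential divergence of $\nu_t$, so that it equals $1$ for the unit disk), and $H(h):=H_{\Omega_t}\circ\gamma_t$. $V_t$ is the normal boundary velocity, $V_t\circ\gamma_t=\langle\partial_t\gamma_t,\nu_t\circ\gamma_t\rangle$. $\nabla_{\mathbb{S}^1}f$ is the tangential gradient of $f:\mathbb{S}^1\to\mathbb{R}$ (the gradient at points of $\mathbb{S}^1$ of the $0$-homogeneous extension of $f$), $J=J(h):=\sqrt{(1+h)^2+|\nabla_{\mathbb{S}^1}h|^2}$, and $\mathcal{M}f(x):=\langle\nabla_{\mathbb{S}^1}f(x),\mathcal{J}x\rangle$.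 Given $h,\psi$, let $\Phi$ be the harmonic function in the domain $\Omega_h$ bounded by $\gamma_h(\mathbb{S}^1)$, $\gamma_h(x)=(1+h(x))x$, with $\Phi\circ\gamma_h=\psi$. The Dirichlet–Neumann operator is $G(h)\psi:=\langle\nabla\Phi\circ\gamma_h,\nu_h\circ\gamma_h\rangle$, with $\nu_h$ the outward unit normal of $\Omega_h$. The harmonic conjugate $\Psi$ is a function with $\nabla\Psi=\mathcal{J}\nabla\Phi$ in $\Omega_h$, and $K(h)\psi:=\Psi\circ\gamma_h$. $\Psi$ is determined up to an additive constant at each time; a normalization is fixed once and for all, with $K(0)0=0$. *)

theory Defs
  imports "HOL-Analysis.Analysis"
begin

abbreviation circ :: "(real^2) set"
  where "circ \<equiv> sphere 0 1"

definition Jmat :: "real^2^2"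
  where "Jmat = vector [vector [0, -1], vector [1, 0]]"

text \<open>Meant for open \<open>S\<close>: the derivatives are two-sided.\<close>

primrec Ck :: "nat \<Rightarrow> 'a::euclidean_space set \<Rightarrow> ('a \<Rightarrow> 'b::real_normed_vector) \<Rightarrow> bool" where
  "Ck 0 S f \<longleftrightarrow> continuous_on S f"
| "Ck (Suc k) S f \<longleftrightarrow>
     (\<exists>f'. (\<forall>x\<in>S. (f has_derivative f' x) (at x)) \<and> (\<forall>v. Ck k S (\<lambda>x. f' x v)))"

text \<open>A function is \<open>C\<^sup>1\<close> on a set that is not open (here: a space-time domain together with
  its lateral boundary) if it is the restriction of a \<open>C\<^sup>1\<close> function on an open neighbourhood.\<close>

definition C1_upto :: "'a::euclidean_space set \<Rightarrow> ('a \<Rightarrow> 'b::real_normed_vector) \<Rightarrow> bool"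
  where "C1_upto D f \<longleftrightarrow> (\<exists>W g. open W \<and> D \<subseteq> W \<and> Ck 1 W g \<and> (\<forall>z\<in>D. f z = g z))"

definition pd :: "2 \<Rightarrow> (real^2 \<Rightarrow> 'b::real_normed_vector) \<Rightarrow> real^2 \<Rightarrow> 'b"
  where "pd i f x = frechet_derivative f (at x) (axis i 1)"

text \<open>With \<open>S\<close> the closure of a domain, \<open>grad_on S f\<close> is the gradient up to the boundary:
  the ordinary one in the interior, the one-sided one at boundary points.\<close>

definition grad_on :: "(real^2) set \<Rightarrow> (real^2 \<Rightarrow> real) \<Rightarrow> real^2 \<Rightarrow> real^2"
  where "grad_on S f x = (\<chi> i. frechet_derivative f (at x within S) (axis i 1))"

abbreviation grad :: "(real^2 \<Rightarrow> real) \<Rightarrow> real^2 \<Rightarrow> real^2"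
  where "grad \<equiv> grad_on UNIV"

definition divergence :: "(real^2 \<Rightarrow> real^2) \<Rightarrow> real^2 \<Rightarrow> real"
  where "divergence X x = (\<Sum>i\<in>UNIV. pd i (\<lambda>y. X y $ i) x)"

definition curl :: "(real^2 \<Rightarrow> real^2) \<Rightarrow> real^2 \<Rightarrow> real"
  where "curl X x = pd 2 (\<lambda>y. X y $ 1) x - pd 1 (\<lambda>y. X y $ 2) x"

definition laplacian :: "(real^2 \<Rightarrow> real) \<Rightarrow> real^2 \<Rightarrow> real"
  where "laplacian f x = (\<Sum>i\<in>UNIV. pd i (pd i f) x)"

definition harmonic_on :: "(real^2) set \<Rightarrow> (real^2 \<Rightarrow> real) \<Rightarrow> bool"
  where "harmonic_on S f \<longleftrightarrow> Ck 2 S f \<and> (\<forall>x\<in>S. laplacian f x = 0)"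

text \<open>Functions on the circle are represented by functions on the plane of which only the
  values on \<open>circ\<close> matter; regularity and the tangential gradient are those of the
  0-homogeneous extension.\<close>

definition hom_ext :: "(real^2 \<Rightarrow> real) \<Rightarrow> real^2 \<Rightarrow> real"
  where "hom_ext f y = f (y /\<^sub>R norm y)"

definition Ck_circ :: "nat \<Rightarrow> (real^2 \<Rightarrow> real) \<Rightarrow> bool"
  where "Ck_circ k f \<longleftrightarrow> Ck k (- {0}) (hom_ext f)"

definition Ck_time_circ :: "nat \<Rightarrow> real set \<Rightarrow> (real \<Rightarrow> real^2 \<Rightarrow> real) \<Rightarrow> bool"
  where "Ck_time_circ k I f \<longleftrightarrow> Ck k (I \<times> (- {0})) (\<lambda>(t, y). hom_ext (f t) y)"

definition tgrad :: "(real^2 \<Rightarrow> real) \<Rightarrow> real^2 \<Rightarrow> real^2"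
  where "tgrad f x = grad (hom_ext f) x"

definition Jac :: "(real^2 \<Rightarrow> real) \<Rightarrow> real^2 \<Rightarrow> real"
  where "Jac h x = sqrt ((1 + h x)\<^sup>2 + (norm (tgrad h x))\<^sup>2)"

definition Mop :: "(real^2 \<Rightarrow> real) \<Rightarrow> real^2 \<Rightarrow> real"
  where "Mop f x = tgrad f x \<bullet> (Jmat *v x)"

text \<open>The \<open>W\<^sup>1\<^sup>,\<^sup>\<infinity>\<close> norm, for functions of class \<open>C\<^sup>1\<close> (so that essential suprema are suprema).\<close>

definition W1inf_norm :: "(real^2 \<Rightarrow> real) \<Rightarrow> real"
  where "W1inf_norm f = (SUP x\<in>circ. \<bar>f x\<bar>) + (SUP x\<in>circ. norm (tgrad f x))"

definition bdry_param :: "(real^2 \<Rightarrow> real) \<Rightarrow> real^2 \<Rightarrow> real^2"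
  where "bdry_param h x = (1 + h x) *\<^sub>R x"

definition bounded_domain_with_boundary :: "(real^2) set \<Rightarrow> (real^2) set \<Rightarrow> bool"
  where "bounded_domain_with_boundary \<Omega> \<Gamma> \<longleftrightarrow>
    \<Omega> \<noteq> {} \<and> open \<Omega> \<and> connected \<Omega> \<and> bounded \<Omega> \<and> frontier \<Omega> = \<Gamma>"

definition enclosed :: "(real^2 \<Rightarrow> real) \<Rightarrow> (real^2) set"
  where "enclosed h = inside (bdry_param h ` circ)"

text \<open>The outward unit normal at a boundary point \<open>y\<close> of a domain with \<open>C\<^sup>1\<close> boundary: the unit
  vector orthogonal to the boundary to first order at \<open>y\<close> and pointing out of the domain.\<close>

definition outer_normal :: "(real^2) set \<Rightarrow> real^2 \<Rightarrow> real^2"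
  where "outer_normal \<Omega> y = (THE n. norm n = 1 \<and>
    ((\<lambda>z. ((z - y) \<bullet> n) / norm (z - y)) \<longlongrightarrow> 0) (at y within frontier \<Omega>) \<and>
    (\<forall>\<^sub>F s in at_right 0. y - s *\<^sub>R n \<in> \<Omega> \<and> y + s *\<^sub>R n \<notin> closure \<Omega>))"

text \<open>Tangential divergence of the normal: the boundary is a curve, so this is
  \<open>\<langle>D\<^sub>\<tau> \<nu>, \<tau>\<rangle>\<close> with \<open>\<tau>\<close> the unit tangent. A derivative within the boundary is
  determined only in the tangent direction, the only one in which it is evaluated.\<close>

definition bdry_curvature :: "(real^2) set \<Rightarrow> real^2 \<Rightarrow> real"
  where "bdry_curvature \<Omega> y = (let \<tau> = Jmat *v outer_normal \<Omega> y in
    frechet_derivative (outer_normal \<Omega>) (at y within frontier \<Omega>) \<tau> \<bullet> \<tau>)"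

definition Hop :: "(real^2 \<Rightarrow> real) \<Rightarrow> real^2 \<Rightarrow> real"
  where "Hop h x = bdry_curvature (enclosed h) (bdry_param h x)"

text \<open>The argument \<open>x\<close> is a point of the circle, so this is \<open>V\<^sub>t \<circ> \<gamma>\<^sub>t\<close>.\<close>

definition normal_velocity ::
    "(real \<Rightarrow> real^2 \<Rightarrow> real) \<Rightarrow> (real \<Rightarrow> (real^2) set) \<Rightarrow> real \<Rightarrow> real^2 \<Rightarrow> real"
  where "normal_velocity h \<Omega> t x =
    vector_derivative (\<lambda>s. bdry_param (h s) x) (at t) \<bullet> outer_normal (\<Omega> t) (bdry_param (h t) x)"

definition is_harmonic_ext ::
    "(real^2) set \<Rightarrow> (real^2 \<Rightarrow> real) \<Rightarrow> (real^2 \<Rightarrow> real) \<Rightarrow> (real^2 \<Rightarrow> real) \<Rightarrow> bool"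
  where "is_harmonic_ext \<Omega> h \<psi> \<Phi> \<longleftrightarrow>
    harmonic_on \<Omega> \<Phi> \<and> continuous_on (closure \<Omega>) \<Phi> \<and> (\<forall>x\<in>circ. \<Phi> (bdry_param h x) = \<psi> x)"

text \<open>Unique on \<open>closure (enclosed h)\<close> by the maximum principle; its values elsewhere are
  never used.\<close>

definition harmonic_ext :: "(real^2 \<Rightarrow> real) \<Rightarrow> (real^2 \<Rightarrow> real) \<Rightarrow> real^2 \<Rightarrow> real"
  where "harmonic_ext h \<psi> = (SOME \<Phi>. is_harmonic_ext (enclosed h) h \<psi> \<Phi>)"

definition DN :: "(real^2 \<Rightarrow> real) \<Rightarrow> (real^2 \<Rightarrow> real) \<Rightarrow> real^2 \<Rightarrow> real"
  where "DN h \<psi> x =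
    grad_on (closure (enclosed h)) (harmonic_ext h \<psi>) (bdry_param h x)
      \<bullet> outer_normal (enclosed h) (bdry_param h x)"

text \<open>A normalization of the harmonic conjugate \<open>\<Psi>\<close> is described by the value
  \<open>\<Psi>(0) = \<kappa> h \<psi>\<close>; the origin lies in \<open>enclosed h\<close>, so every way of choosing the additive
  constant is of this form.\<close>

definition harmonic_conj ::
    "((real^2 \<Rightarrow> real) \<Rightarrow> (real^2 \<Rightarrow> real) \<Rightarrow> real) \<Rightarrow>
     (real^2 \<Rightarrow> real) \<Rightarrow> (real^2 \<Rightarrow> real) \<Rightarrow> real^2 \<Rightarrow> real"
  where "harmonic_conj \<kappa> h \<psi> = (SOME \<Psi>.
    continuous_on (closure (enclosed h)) \<Psi> \<and>
    (\<forall>y\<in>enclosed h.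
       (\<Psi> has_derivative (\<lambda>v. (Jmat *v grad (harmonic_ext h \<psi>) y) \<bullet> v)) (at y)) \<and>
    \<Psi> 0 = \<kappa> h \<psi>)"

definition Kop ::
    "((real^2 \<Rightarrow> real) \<Rightarrow> (real^2 \<Rightarrow> real) \<Rightarrow> real) \<Rightarrow>
     (real^2 \<Rightarrow> real) \<Rightarrow> (real^2 \<Rightarrow> real) \<Rightarrow> real^2 \<Rightarrow> real"
  where "Kop \<kappa> h \<psi> x = harmonic_conj \<kappa> h \<psi> (bdry_param h x)"

text \<open>The first condition is \<open>K(0)0 = 0\<close>. The second holds because the conjugate is a choice of a
  primitive of \<open>J\<nabla>\<Phi>\<close>, which is unchanged when a constant is added to \<open>\<Phi>\<close>. The third says that
  the normalization does not destroy continuity in time.\<close>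

definition normalization :: "((real^2 \<Rightarrow> real) \<Rightarrow> (real^2 \<Rightarrow> real) \<Rightarrow> real) \<Rightarrow> bool"
  where "normalization \<kappa> \<longleftrightarrow>
    \<kappa> (\<lambda>_. 0) (\<lambda>_. 0) = 0 \<and>
    (\<forall>h \<psi> c. Ck_circ 2 h \<and> (\<forall>x\<in>circ. -1 < h x) \<and> Ck_circ 1 \<psi> \<longrightarrow>
       \<kappa> h (\<lambda>x. \<psi> x + c) = \<kappa> h \<psi>) \<and>
    (\<forall>I h \<psi>. open I \<and> is_interval I \<and>
       Ck_time_circ 2 I h \<and> (\<forall>t\<in>I. \<forall>x\<in>circ. -1 < h t x) \<and> Ck_time_circ 1 I \<psi> \<longrightarrow>
       continuous_on I (\<lambda>t. \<kappa> (h t) (\<psi> t)))"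

definition closed_spacetime :: "real set \<Rightarrow> (real \<Rightarrow> (real^2) set) \<Rightarrow> (real \<times> (real^2)) set"
  where "closed_spacetime I \<Omega> = Sigma I (\<lambda>t. closure (\<Omega> t))"

definition drop_geometry ::
    "real set \<Rightarrow> (real \<Rightarrow> real^2 \<Rightarrow> real) \<Rightarrow> (real \<Rightarrow> (real^2) set) \<Rightarrow> bool"
  where "drop_geometry I h \<Omega> \<longleftrightarrow>
    Ck_time_circ 2 I h \<and> (\<forall>t\<in>I. \<forall>x\<in>circ. -1 < h t x) \<and>
    (\<forall>t\<in>I. bounded_domain_with_boundary (\<Omega> t) (bdry_param (h t) ` circ))"

definition free_boundary_solution ::
    "real \<Rightarrow> real \<Rightarrow> real set \<Rightarrow> (real \<Rightarrow> real^2 \<Rightarrow> real) \<Rightarrow> (real \<Rightarrow> (real^2) set) \<Rightarrow>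
     (real \<Rightarrow> real^2 \<Rightarrow> real^2) \<Rightarrow> (real \<Rightarrow> real^2 \<Rightarrow> real) \<Rightarrow> bool"
  where "free_boundary_solution \<sigma>\<^sub>0 \<alpha>\<^sub>0 I h \<Omega> u p \<longleftrightarrow>
    C1_upto (closed_spacetime I \<Omega>) (\<lambda>(t, x). u t x) \<and>
    continuous_on (closed_spacetime I \<Omega>) (\<lambda>(t, x). p t x) \<and>
    (\<forall>t\<in>I.
      (\<forall>x\<in>\<Omega> t.
         p t differentiable (at x) \<and>
         divergence (u t) x = 0 \<and>
         curl (u t) x = \<alpha>\<^sub>0 \<and>
         vector_derivative (\<lambda>s. u s x) (at t) + (\<Sum>j\<in>UNIV. (u t x $ j) *\<^sub>R pd j (u t) x)
           + grad (p t) x = 0) \<and>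
      (\<forall>y\<in>frontier (\<Omega> t). p t y = \<sigma>\<^sub>0 * bdry_curvature (\<Omega> t) y) \<and>
      (\<forall>x\<in>circ. normal_velocity h \<Omega> t x =
         u t (bdry_param (h t) x) \<bullet> outer_normal (\<Omega> t) (bdry_param (h t) x)))"

definition circle_system_solution ::
    "((real^2 \<Rightarrow> real) \<Rightarrow> (real^2 \<Rightarrow> real) \<Rightarrow> real) \<Rightarrow> real \<Rightarrow> real \<Rightarrow> real set \<Rightarrow>
     (real \<Rightarrow> real^2 \<Rightarrow> real) \<Rightarrow> (real \<Rightarrow> real^2 \<Rightarrow> real) \<Rightarrow> bool"
  where "circle_system_solution \<kappa> \<sigma>\<^sub>0 \<alpha>\<^sub>0 I h \<psi> \<longleftrightarrow>
    Ck_time_circ 2 I h \<and> Ck_time_circ 1 I \<psi> \<and>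
    (\<forall>t\<in>I. \<forall>x\<in>circ.
      deriv (\<lambda>s. h s x) t =
        Jac (h t) x / (1 + h t x) * DN (h t) (\<psi> t) x + \<alpha>\<^sub>0 / 2 * Mop (h t) x \<and>
      deriv (\<lambda>s. \<psi> s x) t =
        1 / 2 * (DN (h t) (\<psi> t) x
                 + (tgrad (\<psi> t) x \<bullet> tgrad (h t) x) / (Jac (h t) x * (1 + h t x)))\<^sup>2
        - (norm (tgrad (\<psi> t) x))\<^sup>2 / (2 * (1 + h t x)\<^sup>2)
        - \<sigma>\<^sub>0 * Hop (h t) x
        + \<alpha>\<^sub>0 / 2 * Mop (\<psi> t) x
        + \<alpha>\<^sub>0\<^sup>2 / 8 * (1 + h t x)\<^sup>2
        + \<alpha>\<^sub>0 * Kop \<kappa> (h t) (\<psi> t) x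
        + \<sigma>\<^sub>0 - \<alpha>\<^sub>0\<^sup>2 / 8)"

text \<open>Regularity of the potential needed for \<open>\<nabla>\<Phi>\<close> to be an admissible (\<open>C\<^sup>1\<close>) velocity and for
  \<open>\<partial>\<^sub>t\<Phi>\<close> to make sense up to the boundary.\<close>

definition regular_potential ::
    "real set \<Rightarrow> (real \<Rightarrow> (real^2) set) \<Rightarrow> (real \<Rightarrow> real^2 \<Rightarrow> real) \<Rightarrow> bool"
  where "regular_potential I \<Omega> \<Phi> \<longleftrightarrow>
    C1_upto (closed_spacetime I \<Omega>) (\<lambda>(t, x). \<Phi> t x) \<and>
    C1_upto (closed_spacetime I \<Omega>) (\<lambda>(t, x). grad_on (closure (\<Omega> t)) (\<Phi> t) x)"

definition rotating_velocity ::
    "real \<Rightarrow> (real \<Rightarrow> (real^2) set) \<Rightarrow> (real \<Rightarrow> real^2 \<Rightarrow> real) \<Rightarrow> real \<Rightarrow> real^2 \<Rightarrow> real^2"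
  where "rotating_velocity \<alpha>\<^sub>0 \<Omega> \<Phi> t x =
    grad_on (closure (\<Omega> t)) (\<Phi> t) x - (\<alpha>\<^sub>0 / 2) *\<^sub>R (Jmat *v x)"

definition velocity_potential ::
    "real \<Rightarrow> real set \<Rightarrow> (real \<Rightarrow> (real^2) set) \<Rightarrow> (real \<Rightarrow> real^2 \<Rightarrow> real^2) \<Rightarrow>
     (real \<Rightarrow> real^2 \<Rightarrow> real) \<Rightarrow> bool"
  where "velocity_potential \<alpha>\<^sub>0 I \<Omega> u \<Phi> \<longleftrightarrow>
    regular_potential I \<Omega> \<Phi> \<and>
    (\<forall>t\<in>I. harmonic_on (\<Omega> t) (\<Phi> t) \<and>
       (\<forall>x\<in>closure (\<Omega> t). u t x = rotating_velocity \<alpha>\<^sub>0 \<Omega> \<Phi> t x))"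

definition bdry_trace ::
    "(real \<Rightarrow> real^2 \<Rightarrow> real) \<Rightarrow> (real \<Rightarrow> real^2 \<Rightarrow> real) \<Rightarrow> real \<Rightarrow> real^2 \<Rightarrow> real"
  where "bdry_trace h \<Phi> t x = \<Phi> t (bdry_param (h t) x)"

end

theory Submission
  imports Defs
begin

text \<open>
  The field \<open>u + (\<alpha>\<^sub>0/2) J x\<close> is divergence free and curl free, so on the star-shaped domain it has
  the radial primitive \<open>\<Phi>(t,x) = \<integral>\<^sub>0\<^sup>1 \<langle>(u + (\<alpha>\<^sub>0/2) J y)|\<^bsub>y=sx\<^esub>, x\<rangle> ds\<close> as a potential. In terms of
  \<open>\<Phi>\<close> and its conjugate \<open>\<Psi>\<close>, the momentum equation says that
  \<open>\<partial>\<^sub>t\<Phi> + |\<nabla>\<Phi>|\<^sup>2/2 - (\<alpha>\<^sub>0/2)\<langle>\<nabla>\<Phi>, J x\<rangle> - (\<alpha>\<^sub>0\<^sup>2/8)|x|\<^sup>2 - \<alpha>\<^sub>0\<Psi> + p\<close> has vanishing gradient, and a function of time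
  added to \<open>\<Phi>\<close> turns the constant into \<open>\<sigma>\<^sub>0 - \<alpha>\<^sub>0\<^sup>2/8\<close>. Evaluated on the boundary, where \<open>p = \<sigma>\<^sub>0 H\<close>, this
  becomes the equation for \<open>\<partial>\<^sub>t\<psi>\<close> once \<open>\<nabla>\<Phi>\<close> is expressed in the frame \<open>x, J x\<close> through \<open>G(h)\<psi>\<close> and
  \<open>\<nabla>\<psi>\<close>; the kinematic condition becomes the equation for \<open>\<partial>\<^sub>th\<close>. Both translations are equivalences at
  each boundary point, and for the converse Bernoulli's law is used as the definition of \<open>p\<close>.
\<close>

subsection \<open>Calculus\<close>

text \<open>The constant \<open>\<sigma>\<^sub>0 - \<alpha>\<^sub>0\<^sup>2 / 8\<close> makes the
  unit disk in rigid rotation, \<open>h = 0\<close> and \<open>\<psi> = 0\<close>, stationary: its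
  curvature is 1 and \<open>K(0)0 = 0\<close>. Two obstacles shape the proof. The potential is only
  C^1 with a C^1 gradient, jointly in time and space, so exchanging time derivative and gradient is
  no instance of the usual symmetry of second derivatives: the spatial derivative of the time
  derivative has to be obtained from the other mixed derivative. Moreover the boundary moves, and
  derivatives there are those of C^1 extensions to an open space-time set, about which nothing is
  known off the closed space-time domain; identities are therefore proved inside and carried to the
  boundary by continuity. Normal, harmonic extension and conjugate are given by choice operators and
  must be identified with explicit objects before anything can be computed. The curvature is never
  computed; it passes through both problems unchanged.\<close>

lemma Ck_1_iff:
  "Ck 1 S f \<longleftrightarrow> (\<exists>f'. (\<forall>x\<in>S. (f has_derivative f' x) (at x)) \<and> (\<forall>v. continuous_on S (\<lambda>x. f' x v)))"
  unfolding One_nat_def by simp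

lemma Ck_1I:
  assumes "\<And>x. x \<in> S \<Longrightarrow> (f has_derivative f' x) (at x)" "\<And>v. continuous_on S (\<lambda>x. f' x v)"
  shows "Ck 1 S f"
  using assms unfolding Ck_1_iff by blast

lemma Ck_1D:
  assumes "Ck 1 S f"
  shows "\<And>x. x \<in> S \<Longrightarrow> (f has_derivative frechet_derivative f (at x)) (at x)"
    and "\<And>v. continuous_on S (\<lambda>x. frechet_derivative f (at x) v)"
proof -
  obtain f' where f': "\<And>x. x \<in> S \<Longrightarrow> (f has_derivative f' x) (at x)"
      "\<And>v. continuous_on S (\<lambda>x. f' x v)"
    using assms unfolding Ck_1_iff by blast
  have eq: "f' x = frechet_derivative f (at x)" if "x \<in> S" for x
    using f'(1)[OF that] frechet_derivative_at by blast
  show "(f has_derivative frechet_derivative f (at x)) (at x)" if "x \<in> S" for x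
    using f'(1)[OF that] eq[OF that] by simp
  show "continuous_on S (\<lambda>x. frechet_derivative f (at x) v)" for v
    using f'(2)[of v] eq by (simp cong: continuous_on_cong)
qed

lemma Ck_1_cong:
  assumes "open S" "Ck 1 S f" "\<And>x. x \<in> S \<Longrightarrow> f x = g x"
  shows "Ck 1 S g"
  by (rule Ck_1I[OF has_derivative_transform_within_open[OF Ck_1D(1)[OF assms(2)] assms(1)] Ck_1D(2)[OF assms(2)]])
    (use assms(3) in auto)

lemma Ck_1_imp_continuous_on:
  assumes "Ck 1 S f" shows "continuous_on S f"
  using Ck_1D(1)[OF assms] has_derivative_continuous continuous_at_imp_continuous_on by blast

lemma Ck_mono_set: "Ck k S f \<Longrightarrow> T \<subseteq> S \<Longrightarrow> Ck k T f"
proof (induction k arbitrary: f)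
  case 0
  then show ?case by (auto intro: continuous_on_subset)
next
  case (Suc k)
  then show ?case by (auto) blast
qed

lemma Ck_Suc_imp_Ck: "Ck (Suc k) S f \<Longrightarrow> Ck k S f"
proof (induction k arbitrary: f)
  case 0
  then show ?case using Ck_1_imp_continuous_on by simp
next
  case (Suc k)
  from Suc.prems obtain f' where "\<forall>x\<in>S. (f has_derivative f' x) (at x)" "\<forall>v. Ck (Suc k) S (\<lambda>x. f' x v)"
    using Ck.simps(2) by blast
  then show ?case using Suc.IH unfolding Ck.simps(2)[of k S f] by blast
qed

lemma Ck_Pair_slice:
  assumes "Ck k (I \<times> U) f" "t \<in> I"
  shows "Ck k U (\<lambda>y. f (t, y))"
  using assms(1)
proof (induction k arbitrary: f)
  case 0
  then show ?case using assms(2) by (auto intro!: continuous_on_compose2[of "I \<times> U" f] continuous_intros)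
next
  case (Suc k)
  then obtain f' where f': "\<And>x. x \<in> I \<times> U \<Longrightarrow> (f has_derivative f' x) (at x)"
      "\<And>v. Ck k (I \<times> U) (\<lambda>x. f' x v)"
    by auto
  have "((\<lambda>y. f (t, y)) has_derivative (\<lambda>v. f' (t, y) (0, v))) (at y)" if "y \<in> U" for y
    by (rule has_derivative_compose[of "\<lambda>y. (t, y)" _ y UNIV f, simplified])
      (use f'(1)[of "(t, y)"] that assms(2) in \<open>auto intro!: derivative_eq_intros\<close>)
  moreover have "Ck k U (\<lambda>y. f' (t, y) (0, v))" for v
    using Suc.IH[OF f'(2)[of "(0, v)"]] .
  ultimately show ?case
    unfolding Ck.simps(2) by (intro exI[of _ "\<lambda>y v. f' (t, y) (0, v)"]) blast
qed

text \<open>\<open>Ck\<close> only provides continuity of the derivative in each fixed direction.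
  Expanding the direction in the basis gives continuity when base point and direction vary together,
  as the chain rule requires.\<close>

lemma continuous_on_derivative_apply:
  fixes f :: "'a::euclidean_space \<Rightarrow> 'b::real_normed_vector"
  assumes f: "Ck 1 S f" and p: "continuous_on T p" "p ` T \<subseteq> S" and w: "continuous_on T w"
  shows "continuous_on T (\<lambda>x. frechet_derivative f (at (p x)) (w x))"
proof -
  have eq: "frechet_derivative f (at (p x)) (w x) = (\<Sum>b\<in>Basis. (w x \<bullet> b) *\<^sub>R frechet_derivative f (at (p x)) b)"
    if "x \<in> T" for x
  proof -
    have "linear (frechet_derivative f (at (p x)))"
      using Ck_1D(1)[OF f] p(2) that has_derivative_linear by blast
    then show ?thesis
      by (subst euclidean_representation[symmetric, of "w x"])
        (simp add: linear_sum linear_cmul del: euclidean_representation)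
  qed
  have "continuous_on T (\<lambda>x. frechet_derivative f (at (p x)) b)" for b
    using continuous_on_compose2[OF Ck_1D(2)[OF f] p] .
  then have "continuous_on T (\<lambda>x. \<Sum>b\<in>Basis. (w x \<bullet> b) *\<^sub>R frechet_derivative f (at (p x)) b)"
    by (intro continuous_intros w)
  then show ?thesis using eq by (simp cong: continuous_on_cong)
qed

section \<open>Operations that preserve C^1 regularity\<close>

lemma Ck_1_compose:
  fixes f :: "'a::euclidean_space \<Rightarrow> 'b::euclidean_space" and g :: "'b \<Rightarrow> 'c::real_normed_vector"
  assumes f: "Ck 1 S f" and g: "Ck 1 T g" and fS: "f ` S \<subseteq> T"
  shows "Ck 1 S (\<lambda>x. g (f x))"
proof (rule Ck_1I)
  show "((\<lambda>x. g (f x)) has_derivative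
      (\<lambda>v. frechet_derivative g (at (f x)) (frechet_derivative f (at x) v))) (at x)" if "x \<in> S" for x
    using has_derivative_compose[OF Ck_1D(1)[OF f that], of g] Ck_1D(1)[OF g, of "f x"] fS that by auto
  show "continuous_on S (\<lambda>x. frechet_derivative g (at (f x)) (frechet_derivative f (at x) v))" for v
    by (rule continuous_on_derivative_apply[OF g Ck_1_imp_continuous_on[OF f] fS Ck_1D(2)[OF f]])
qed

lemma Ck_1_Pair:
  assumes "Ck 1 S f" "Ck 1 S g" shows "Ck 1 S (\<lambda>x. (f x, g x))"
  by (rule Ck_1I[where f' = "\<lambda>x v. (frechet_derivative f (at x) v, frechet_derivative g (at x) v)"])
    (auto intro!: has_derivative_Pair continuous_on_Pair Ck_1D[OF assms(1)] Ck_1D[OF assms(2)])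

lemma Ck_1_add:
  assumes "Ck 1 S f" "Ck 1 S g" shows "Ck 1 S (\<lambda>x. f x + g x)"
  by (rule Ck_1I[where f' = "\<lambda>x v. frechet_derivative f (at x) v + frechet_derivative g (at x) v"])
    (auto intro!: has_derivative_add continuous_on_add Ck_1D[OF assms(1)] Ck_1D[OF assms(2)])

lemma Ck_1_scaleR:
  assumes "Ck 1 S f" "Ck 1 S g" shows "Ck 1 S (\<lambda>x. f x *\<^sub>R g x)"
  by (rule Ck_1I[where f' = "\<lambda>x v. f x *\<^sub>R frechet_derivative g (at x) v + frechet_derivative f (at x) v *\<^sub>R g x"])
    (auto intro!: has_derivative_scaleR continuous_intros Ck_1D[OF assms(1)] Ck_1D[OF assms(2)]
      Ck_1_imp_continuous_on[OF assms(1)] Ck_1_imp_continuous_on[OF assms(2)])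

lemma Ck_1_bounded_linear:
  assumes "bounded_linear f" shows "Ck 1 S f"
  by (rule Ck_1I[where f' = "\<lambda>x. f"]) (auto intro: bounded_linear.has_derivative[OF assms, OF has_derivative_ident, simplified])

lemma Ck_1_const: "Ck 1 S (\<lambda>x. c)"
  by (rule Ck_1I[where f' = "\<lambda>x v. 0"]) auto

lemma Ck_1_unit_vector:
  "Ck 1 (- {0}) (\<lambda>x :: 'a::euclidean_space. x /\<^sub>R norm x)"
proof (rule Ck_1I)
  show "((\<lambda>x. x /\<^sub>R norm x) has_derivative
      (\<lambda>v. v /\<^sub>R norm x - ((v \<bullet> sgn x) / (norm x)\<^sup>2) *\<^sub>R x)) (at x)" if "x \<in> - {0}" for x :: 'a
    using that by (auto intro!: derivative_eq_intros has_derivative_norm simp: divide_simps power2_eq_square)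
  show "continuous_on (- {0}) (\<lambda>x. v /\<^sub>R norm x - ((v \<bullet> sgn x) / (norm x)\<^sup>2) *\<^sub>R x)" for v :: 'a
    by (auto intro!: continuous_intros)
qed

text \<open>The second difference of \<open>f\<close> in the directions \<open>P v\<close> and \<open>w\<close> equals, by the mean value
  theorem, a value of the mixed derivative, of which only one order is assumed to exist.\<close>

lemma mixed_derivative:
  fixes f :: "'a::euclidean_space \<Rightarrow> real" and G :: "'a \<Rightarrow> 'b::euclidean_space"
    and P :: "'b \<Rightarrow> 'a"
  assumes "open S" and f: "\<And>z. z \<in> S \<Longrightarrow> (f has_derivative f' z) (at z)"
    and G: "\<And>z. z \<in> S \<Longrightarrow> (G has_derivative G' z) (at z)"
    and cont: "continuous_on S (\<lambda>z. G' z w)"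
    and P: "bounded_linear P"
    and fG: "\<And>z v. z \<in> S \<Longrightarrow> f' z (P v) = G z \<bullet> v"
    and z: "z \<in> S"
  shows "((\<lambda>v. f' (z + P v) w) has_derivative (\<lambda>v. G' z w \<bullet> v)) (at 0)"
  unfolding has_derivative_at_alt
proof (intro conjI allI impI)
  show "bounded_linear (\<lambda>v. G' z w \<bullet> v)"
    by (rule bounded_linear_inner_right)
  fix e :: real assume "e > 0"
  interpret P: bounded_linear P by fact
  have lin: "linear (f' y)" "linear (G' y)" if "y \<in> S" for y
    using f[OF that] G[OF that] has_derivative_linear by blast+
  have "isCont (\<lambda>z. G' z w) z"
    using cont z \<open>open S\<close> continuous_on_eq_continuous_at by blast
  then obtain d0 where "d0 > 0" and d0: "\<And>y. dist y z < d0 \<Longrightarrow> norm (G' y w - G' z w) < e"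
    unfolding continuous_at_eps_delta dist_norm using \<open>e > 0\<close> by metis
  obtain d1 where "d1 > 0" and d1: "ball z d1 \<subseteq> S"
    using \<open>open S\<close> z open_contains_ball by blast
  define d where "d = min d0 d1"
  have "d > 0" using \<open>d0 > 0\<close> \<open>d1 > 0\<close> by (simp add: d_def)
  obtain B where "B > 0" and B: "\<And>v. norm (P v) \<le> norm v * B"
    using P.pos_bounded by blast
  have main: "norm (f' (z + P v) w - f' z w - G' z w \<bullet> v) \<le> e * norm v" if v: "norm v < d / 2 / B" for v
  proof -
    \<comment> \<open>With \<open>norm v < d / 2 / B\<close> and \<open>r < r0\<close>, both sides
      of the parallelogram spanned by \<open>P v\<close> and \<open>r *\<^sub>R w\<close> are
      shorter than \<open>d / 2\<close>, so it stays in \<open>ball z d\<close>.\<close>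
    define r0 where "r0 = d / 2 / (norm w + 1)"
    have "r0 > 0" using \<open>d > 0\<close> by (simp add: r0_def add_nonneg_pos)
    have near: "z + s *\<^sub>R P v + r *\<^sub>R w \<in> ball z d" if "0 \<le> s" "s \<le> 1" "0 \<le> r" "r < r0" for s r
    proof -
      have "norm (s *\<^sub>R P v) \<le> norm (P v)"
        using that by (simp add: mult_left_le_one_le)
      also have "\<dots> \<le> norm v * B" by (rule B)
      also have "\<dots> < d / 2" using v \<open>B > 0\<close> by (simp add: field_simps)
      finally have 1: "norm (s *\<^sub>R P v) < d / 2" .
      have "norm (r *\<^sub>R w) = r * norm w" using that by simp
      also have "\<dots> \<le> r * (norm w + 1)" using that by (simp add: mult_left_mono)
      also have "\<dots> < r0 * (norm w + 1)"
        using that by (intro mult_strict_right_mono) (auto simp: add_nonneg_pos)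
      also have "\<dots> = d / 2"
        using norm_ge_zero[of w] by (simp add: r0_def add_nonneg_eq_0_iff field_simps)
      finally have 2: "norm (r *\<^sub>R w) < d / 2" .
      have "dist z (z + s *\<^sub>R P v + r *\<^sub>R w) = norm (s *\<^sub>R P v + r *\<^sub>R w)"
        by (metis add.assoc add_diff_cancel_left' dist_commute dist_norm)
      also have "\<dots> < d" using 1 2 norm_triangle_ineq[of "s *\<^sub>R P v" "r *\<^sub>R w"] by linarith
      finally show ?thesis by simp
    qed
    then have inS: "z + s *\<^sub>R P v + r *\<^sub>R w \<in> S" if "0 \<le> s" "s \<le> 1" "0 \<le> r" "r < r0" for s r
      using that d1 by (force simp: d_def)
    have quot: "norm ((f (z + P v + r *\<^sub>R w) - f (z + P v)) / r - (f (z + r *\<^sub>R w) - f z) / r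
          - G' z w \<bullet> v) \<le> e * norm v" if r: "0 < r" "r < r0" for r
    proof -
      \<comment> \<open>\<open>F 1 - F 0\<close> is the second difference. Differentiating in
        \<open>s\<close> meets only the first derivative along \<open>P v\<close>, which
        \<open>fG\<close> expresses through \<open>G\<close>; the second mean value step, in
        \<open>q\<close>, differentiates \<open>G\<close>. No second derivative of \<open>f\<close>
        is presupposed.\<close>
      define F where "F = (\<lambda>s. f (z + s *\<^sub>R P v + r *\<^sub>R w) - f (z + s *\<^sub>R P v))"
      have F: "(F has_real_derivative (G (z + s *\<^sub>R P v + r *\<^sub>R w) - G (z + s *\<^sub>R P v)) \<bullet> v) (at s)"
        if s: "0 \<le> s" "s \<le> 1" for s
      proof -
        have *: "((\<lambda>s. f (z + s *\<^sub>R P v + q *\<^sub>R w)) has_real_derivative G (z + s *\<^sub>R P v + q *\<^sub>R w) \<bullet> v) (at s)"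
          if q: "0 \<le> q" "q < r0" for q
        proof -
          note zS = inS[OF s q]
          have "((\<lambda>s. z + s *\<^sub>R P v + q *\<^sub>R w) has_derivative (\<lambda>c. c *\<^sub>R P v)) (at s)"
            by (auto intro!: derivative_eq_intros)
          from has_derivative_compose[OF this f[OF zS]]
          show ?thesis
            unfolding has_field_derivative_def
            by (simp add: linear_cmul[OF lin(1)[OF zS]] fG[OF zS] mult.commute[of "G _ \<bullet> v"] mult_commute_abs)
        qed
        show ?thesis
          unfolding F_def inner_diff_left
          using DERIV_diff[OF *[of r] *[of 0]] r by simp
      qed
      obtain s where s: "0 < s" "s < 1"
          "F 1 - F 0 = (1 - 0) * ((G (z + s *\<^sub>R P v + r *\<^sub>R w) - G (z + s *\<^sub>R P v)) \<bullet> v)"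
        using MVT2[of 0 1 F, OF _ F] by auto
      have Gd: "((\<lambda>q. G (z + s *\<^sub>R P v + q *\<^sub>R w) \<bullet> v) has_real_derivative
            G' (z + s *\<^sub>R P v + q *\<^sub>R w) w \<bullet> v) (at q)" if q: "0 \<le> q" "q \<le> r" for q
      proof -
        have zS: "z + s *\<^sub>R P v + q *\<^sub>R w \<in> S" using inS s q r by simp
        have "((\<lambda>q. z + s *\<^sub>R P v + q *\<^sub>R w) has_derivative (\<lambda>c. c *\<^sub>R w)) (at q)"
          by (auto intro!: derivative_eq_intros)
        from has_derivative_inner_left[OF has_derivative_compose[OF this G[OF zS]], of v]
        show ?thesis
          unfolding has_field_derivative_def
          by (simp add: linear_cmul[OF lin(2)[OF zS]] mult_commute_abs)
      qed
      obtain q where q: "0 < q" "q < r"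
          "G (z + s *\<^sub>R P v + r *\<^sub>R w) \<bullet> v - G (z + s *\<^sub>R P v + 0 *\<^sub>R w) \<bullet> v
            = (r - 0) * (G' (z + s *\<^sub>R P v + q *\<^sub>R w) w \<bullet> v)"
        using MVT2[of 0 r "\<lambda>q. G (z + s *\<^sub>R P v + q *\<^sub>R w) \<bullet> v", OF r(1) Gd] by auto
      have "F 1 - F 0 = r * (G' (z + s *\<^sub>R P v + q *\<^sub>R w) w \<bullet> v)"
        using s(3) q(3) by (simp add: inner_diff_left)
      then have "(f (z + P v + r *\<^sub>R w) - f (z + P v)) / r - (f (z + r *\<^sub>R w) - f z) / r
          = G' (z + s *\<^sub>R P v + q *\<^sub>R w) w \<bullet> v"
        using r by (simp add: F_def diff_divide_distrib[symmetric] divide_eq_eq algebra_simps)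
      moreover have "norm (G' (z + s *\<^sub>R P v + q *\<^sub>R w) w - G' z w) \<le> e"
        using near[of s q] s(1,2) q(1,2) r by (intro less_imp_le d0) (simp add: d_def dist_commute)
      then have "norm (G' (z + s *\<^sub>R P v + q *\<^sub>R w) w - G' z w) * norm v \<le> e * norm v"
        by (simp add: mult_right_mono)
      then have "norm ((G' (z + s *\<^sub>R P v + q *\<^sub>R w) w - G' z w) \<bullet> v) \<le> e * norm v"
        by (metis Cauchy_Schwarz_ineq2 order_trans real_norm_def)
      ultimately show ?thesis
        by (simp add: inner_diff_left)
    qed
    have lim: "((\<lambda>r. (f (y + r *\<^sub>R w) - f y) / r) \<longlongrightarrow> f' y w) (at_right 0)" if "y \<in> S" for y
    proof -
      have "((\<lambda>r. y + r *\<^sub>R w) has_derivative (\<lambda>c. c *\<^sub>R w)) (at 0)"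
        by (auto intro!: derivative_eq_intros)
      from has_derivative_compose[OF this, of f "f' y"] f[OF that]
      have "((\<lambda>r. f (y + r *\<^sub>R w)) has_real_derivative f' y w) (at 0)"
        unfolding has_field_derivative_def
        by (simp add: linear_cmul[OF lin(1)[OF that]] mult_commute_abs)
      then show ?thesis
        unfolding DERIV_def by (auto intro: filterlim_mono at_le)
    qed
    \<comment> \<open>The bound does not depend on \<open>r\<close>; letting \<open>r\<close> tend
      to 0 replaces the quotients by derivatives of \<open>f\<close> along \<open>w\<close> at the
      points \<open>z + P v\<close> and \<open>z\<close>.\<close>
    have "((\<lambda>r. norm ((f (z + P v + r *\<^sub>R w) - f (z + P v)) / r - (f (z + r *\<^sub>R w) - f z) / r - G' z w \<bullet> v))
         \<longlongrightarrow> norm (f' (z + P v) w - f' z w - G' z w \<bullet> v)) (at_right 0)"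
      using inS[of 1 0] \<open>r0 > 0\<close> z by (intro tendsto_intros lim) auto
    moreover have "\<forall>\<^sub>F r in at_right 0.
        norm ((f (z + P v + r *\<^sub>R w) - f (z + P v)) / r - (f (z + r *\<^sub>R w) - f z) / r - G' z w \<bullet> v) \<le> e * norm v"
      using quot \<open>r0 > 0\<close> by (auto simp: eventually_at_right intro!: exI[of _ r0])
    ultimately show ?thesis
      by (intro tendsto_upperbound) auto
  qed
  show "\<exists>d>0. \<forall>y. norm (y - 0) < d \<longrightarrow>
      norm (f' (z + P y) w - f' (z + P 0) w - G' z w \<bullet> (y - 0)) \<le> e * norm (y - 0)"
    using main \<open>d > 0\<close> \<open>B > 0\<close> by (intro exI[of _ "d / 2 / B"]) (auto simp: P.zero)
qed

text \<open>The derivative at 0 of \<open>v \<mapsto> G (z + v) \<bullet> w\<close> is computed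
  twice, directly and by \<open>mixed_derivative\<close> with \<open>P\<close> the identity;
  uniqueness of derivatives equates the results.\<close>

lemma gradient_derivative_symmetric:
  fixes f :: "'a::euclidean_space \<Rightarrow> real" and G :: "'a \<Rightarrow> 'a"
  assumes "open S" and f: "\<And>z. z \<in> S \<Longrightarrow> (f has_derivative (\<lambda>v. G z \<bullet> v)) (at z)"
    and G: "Ck 1 S G" and z: "z \<in> S"
  shows "frechet_derivative G (at z) v \<bullet> w = frechet_derivative G (at z) w \<bullet> v"
proof -
  have "((\<lambda>v. G (z + v) \<bullet> w) has_derivative (\<lambda>v. frechet_derivative G (at z) w \<bullet> v)) (at 0)"
    by (rule mixed_derivative[where f = f and f' = "\<lambda>z v. G z \<bullet> v" and P = "\<lambda>x. x" and S = S])
      (use assms Ck_1D[OF G] in \<open>auto intro: bounded_linear_ident\<close>)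
  moreover have "((\<lambda>v. G (z + v)) has_derivative frechet_derivative G (at z)) (at 0)"
  proof -
    have "((\<lambda>v. z + v) has_derivative (\<lambda>v. v)) (at 0)"
      by (auto intro!: derivative_eq_intros)
    from has_derivative_compose[OF this, of G] Ck_1D(1)[OF G z] show ?thesis by simp
  qed
  then have "((\<lambda>v. G (z + v) \<bullet> w) has_derivative (\<lambda>v. frechet_derivative G (at z) v \<bullet> w)) (at 0)"
    by (rule has_derivative_inner_left)
  ultimately show ?thesis
    using has_derivative_unique by metis
qed

text \<open>Differentiation under the integral sign. The first claim serves the gradient of a radial
  primitive at a fixed time, the second its joint C^1 regularity in time and space.\<close>

lemma param_integral_Ck_1:
  fixes K :: "'a::euclidean_space \<Rightarrow> real \<Rightarrow> real"
  assumes "open W"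
    and K: "\<And>z s. z \<in> W \<Longrightarrow> s \<in> {0..1} \<Longrightarrow> ((\<lambda>z. K z s) has_derivative K' z s) (at z)"
    and K0: "\<And>z. z \<in> W \<Longrightarrow> continuous_on {0..1} (K z)"
    and K': "\<And>v. continuous_on (W \<times> {0..1}) (\<lambda>(z, s). K' z s v)"
  shows "\<And>z. z \<in> W \<Longrightarrow> ((\<lambda>z. integral {0..1} (K z)) has_derivative (\<lambda>v. integral {0..1} (\<lambda>s. K' z s v))) (at z)"
    and "Ck 1 W (\<lambda>z. integral {0..1} (K z))"
proof -
  show *: "((\<lambda>z. integral {0..1} (K z)) has_derivative (\<lambda>v. integral {0..1} (\<lambda>s. K' z s v))) (at z)"
    if "z \<in> W" for z
  proof -
    obtain d where "d > 0" and d: "ball z d \<subseteq> W"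
      using \<open>open W\<close> \<open>z \<in> W\<close> open_contains_ball by blast
    \<comment> \<open>\<open>leibniz_rule\<close> expects the derivative as a bounded linear
      function object, continuous in operator norm; in finite dimension, continuity in each
      direction suffices.\<close>
    define k where "k = (\<lambda>y s. Blinfun (K' y s))"
    have k: "blinfun_apply (k y s) = K' y s" if "y \<in> W" "s \<in> {0..1}" for y s
      unfolding k_def using K[OF that] has_derivative_bounded_linear bounded_linear_Blinfun_apply by blast
    have cont: "continuous_on (ball z d \<times> cbox 0 1) (\<lambda>(y, s). k y s)"
      unfolding case_prod_beta
    proof (rule continuous_on_blinfun_componentwise)
      fix i :: 'a
      have "continuous_on (ball z d \<times> cbox 0 1) (\<lambda>x. K' (fst x) (snd x) i)"
        using continuous_on_subset[OF K'[of i], of "ball z d \<times> cbox 0 1"] d by (auto simp: case_prod_beta)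
      then show "continuous_on (ball z d \<times> cbox 0 1) (\<lambda>x. blinfun_apply (k (fst x) (snd x)) i)"
        by (rule continuous_on_eq) (use d k in \<open>auto simp: subset_eq\<close>)
    qed
    have der: "((\<lambda>y. integral (cbox 0 1) (K y)) has_derivative integral (cbox 0 1) (k z)) (at z within ball z d)"
    proof (rule leibniz_rule[OF _ _ cont])
      show "((\<lambda>y. K y s) has_derivative blinfun_apply (k y s)) (at y within ball z d)"
        if "y \<in> ball z d" "s \<in> cbox 0 1" for y s
        using K[of y s] k[of y s] that d by (auto simp: subset_eq intro!: has_derivative_at_withinI)
      show "K y integrable_on cbox 0 1" if "y \<in> ball z d" for y
        using K0[of y] that d integrable_continuous_real by (auto simp: subset_eq)
    qed (use \<open>d > 0\<close> in auto)
    have "blinfun_apply (integral (cbox 0 1) (k z)) v = integral {0..1} (\<lambda>s. K' z s v)" for v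
    proof -
      have "continuous_on {0..1} (k z)"
        using continuous_on_compose2[OF cont, of "{0..1}" "\<lambda>s. (z, s)"] \<open>d > 0\<close>
        by (force intro!: continuous_on_Pair continuous_on_const continuous_on_id)
      then have "k z integrable_on cbox 0 1" by (simp add: integrable_continuous_real)
      then have "blinfun_apply (integral (cbox 0 1) (k z)) v = integral (cbox 0 1) (\<lambda>s. blinfun_apply (k z s) v)"
        by (rule blinfun_apply_integral)
      also have "\<dots> = integral {0..1} (\<lambda>s. K' z s v)"
        using k[OF that] by (auto intro!: integral_cong)
      finally show ?thesis .
    qed
    then have "blinfun_apply (integral (cbox 0 1) (k z)) = (\<lambda>v. integral {0..1} (\<lambda>s. K' z s v))"
      by (rule ext)
    with der show ?thesis
      using \<open>d > 0\<close> by (simp add: at_within_open[of z "ball z d"])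
  qed
  show "Ck 1 W (\<lambda>z. integral {0..1} (K z))"
  proof (rule Ck_1I[OF *])
    show "continuous_on W (\<lambda>z. integral {0..1} (\<lambda>s. K' z s v))" for v
      using integral_continuous_on_param[of W 0 1 "\<lambda>z s. K' z s v"] K'[of v] by simp
  qed
qed

lemma antiderivative_open_interval:
  fixes b :: "real \<Rightarrow> real"
  assumes "open I" "is_interval I" "continuous_on I b"
  obtains c where "\<And>t. t \<in> I \<Longrightarrow> (c has_real_derivative b t) (at t)"
proof (cases "I = {}")
  case True
  then show ?thesis using that by blast
next
  case False
  then obtain t0 where "t0 \<in> I" by blast
  have "((\<lambda>u. LBINT y=t0..u. b y) has_real_derivative b t) (at t)" if "t \<in> I" for t
  proof -
    obtain d where "d > 0" and d: "cball t d \<subseteq> I"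
      using \<open>open I\<close> \<open>t \<in> I\<close> open_contains_cball by blast
    obtain d' where "d' > 0" and d': "cball t0 d' \<subseteq> I"
      using \<open>open I\<close> \<open>t0 \<in> I\<close> open_contains_cball by blast
    \<comment> \<open>The hull of closed intervals around \<open>t\<close> and around the base point
      lies in \<open>I\<close> and has \<open>t\<close> in its interior, so that the derivative
      within it is two-sided. The oriented integral also covers times before
      \<open>t0\<close>.\<close>
    let ?l = "min (t - d) (t0 - d')" and ?r = "max (t + d) (t0 + d')"
    have lr: "?l \<in> I" "?r \<in> I"
      using d d' \<open>d > 0\<close> \<open>d' > 0\<close> by (auto simp: min_def max_def subset_eq dist_real_def)
    then have sub: "{?l..?r} \<subseteq> I"
      using \<open>is_interval I\<close> unfolding is_interval_1 by (meson atLeastAtMost_iff subsetI)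
    have "((\<lambda>u. LBINT y=t0..u. b y) has_vector_derivative b t) (at t within {?l..?r})"
      using \<open>d > 0\<close> \<open>d' > 0\<close> continuous_on_subset[OF assms(3) sub]
      by (intro interval_integral_FTC2) auto
    then show ?thesis
      unfolding has_real_derivative_iff_has_vector_derivative
      using at_within_Icc_at[of ?l t ?r] \<open>d > 0\<close> by (simp add: min_less_iff_disj less_max_iff_disj)
  qed
  then show ?thesis using that by blast
qed

subsection \<open>The plane\<close>

lemma Jmat_nth [simp]: "(Jmat *v x) $ 1 = - x $ 2" "(Jmat *v x) $ 2 = x $ 1"
  by (simp_all add: Jmat_def matrix_vector_mult_def sum_2)

lemma inner_real2: "(x :: real^2) \<bullet> y = x $ 1 * y $ 1 + x $ 2 * y $ 2"
  by (simp add: inner_vec_def sum_2)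

lemma inner_Jmat_self [simp]: "x \<bullet> (Jmat *v x) = 0" "(Jmat *v x) \<bullet> x = 0"
  by (simp_all add: inner_real2)

lemma inner_Jmat_Jmat [simp]: "(Jmat *v x) \<bullet> (Jmat *v y) = x \<bullet> y"
  by (simp add: inner_real2)

lemma inner_Jmat_left: "(Jmat *v x) \<bullet> y = - (x \<bullet> (Jmat *v y))"
  by (simp add: inner_real2)

lemma bounded_linear_Jmat: "bounded_linear (\<lambda>x. Jmat *v x)"
  by (rule matrix_vector_mul_bounded_linear)

lemma orthonormal_frame_inner:
  assumes "norm (x :: real^2) = 1"
  shows "v \<bullet> w = (v \<bullet> x) * (w \<bullet> x) + (v \<bullet> (Jmat *v x)) * (w \<bullet> (Jmat *v x))"
proof -
  have "x $ 1 * x $ 1 + x $ 2 * x $ 2 = 1"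
    using assms by (simp add: norm_eq_sqrt_inner inner_real2)
  then show ?thesis unfolding inner_real2 Jmat_nth by algebra
qed

lemma orthonormal_frame_expansion:
  assumes "norm (x :: real^2) = 1"
  shows "v = (v \<bullet> x) *\<^sub>R x + (v \<bullet> (Jmat *v x)) *\<^sub>R (Jmat *v x)"
  by (rule vector_eq_rdot[THEN iffD1]) (use orthonormal_frame_inner[OF assms, of v] in
    \<open>simp add: inner_add_left inner_add_right inner_commute mult.commute\<close>)

lemma norm_sq_orthonormal_frame:
  assumes "norm (x :: real^2) = 1"
  shows "(norm v)\<^sup>2 = (v \<bullet> x)\<^sup>2 + (v \<bullet> (Jmat *v x))\<^sup>2"
  using orthonormal_frame_inner[OF assms, of v v] unfolding power2_norm_eq_inner by (simp add: power2_eq_square)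

lemma linear_eq_inner_axis:
  assumes "linear (L :: real^2 \<Rightarrow> real)"
  shows "L v = (\<chi> i. L (axis i 1)) \<bullet> v"
proof -
  have "v = v $ 1 *\<^sub>R axis 1 1 + v $ 2 *\<^sub>R axis 2 1"
    by (simp add: vec_eq_iff forall_2 axis_def)
  then have "L v = L (v $ 1 *\<^sub>R axis 1 1 + v $ 2 *\<^sub>R axis 2 1)" by simp
  then show ?thesis
    using assms by (simp add: linear_add linear_cmul inner_real2 mult.commute)
qed

text \<open>Identifies the convective sum of the Euler equation with the spatial derivative of the
  velocity applied to the velocity.\<close>

lemma linear_axis_sum:
  assumes "linear (L :: real^2 \<Rightarrow> 'b::real_vector)"
  shows "(\<Sum>j\<in>UNIV. (v $ j) *\<^sub>R L (axis j 1)) = L v"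
proof -
  have "v = v $ 1 *\<^sub>R axis 1 1 + v $ 2 *\<^sub>R axis 2 1"
    by (simp add: vec_eq_iff forall_2 axis_def)
  then have "L v = L (v $ 1 *\<^sub>R axis 1 1 + v $ 2 *\<^sub>R axis 2 1)" by simp
  then show ?thesis using assms by (simp add: linear_add linear_cmul sum_2)
qed

text \<open>In the plane the antisymmetric part of a linear map is a single number, the difference
  of the off-diagonal entries. For a Jacobian this is the curl up to sign, so a curl free field has
  a symmetric Jacobian.\<close>

lemma linear_symmetric_real2:
  assumes L: "linear (L :: real^2 \<Rightarrow> real^2)" and off: "L (axis 1 1) $ 2 = L (axis 2 1) $ 1"
  shows "L v \<bullet> w = L w \<bullet> v"
proof -
  have *: "L v = v $ 1 *\<^sub>R L (axis 1 1) + v $ 2 *\<^sub>R L (axis 2 1)" for v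
    using linear_axis_sum[OF L, of v] by (simp add: sum_2)
  show ?thesis
    unfolding inner_real2 *[of v] *[of w] using off by (simp add: algebra_simps)
qed

lemma has_derivative_along:
  assumes "(g has_derivative g') (at t)" "g t = y" "(f has_derivative f') (at y)"
  shows "((\<lambda>s. f (g s)) has_derivative (\<lambda>s. f' (g' s))) (at t)"
  using has_derivative_compose[OF assms(1), of f f'] assms(2,3) by simp

lemma grad_on_has_derivative:
  assumes "f differentiable (at x within S)"
  shows "(f has_derivative (\<lambda>v. grad_on S f x \<bullet> v)) (at x within S)"
proof -
  have *: "(f has_derivative frechet_derivative f (at x within S)) (at x within S)"
    using assms frechet_derivative_works by blast
  then have "frechet_derivative f (at x within S) = (\<lambda>v. grad_on S f x \<bullet> v)"
    unfolding grad_on_def using linear_eq_inner_axis has_derivative_linear by blast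
  with * show ?thesis by simp
qed

lemma has_derivative_add_const_iff:
  "((\<lambda>x. f x + c) has_derivative D) F \<longleftrightarrow> (f has_derivative D) F"
proof
  assume "((\<lambda>x. f x + c) has_derivative D) F"
  from has_derivative_diff[OF this has_derivative_const[of c]] show "(f has_derivative D) F" by simp
next
  assume "(f has_derivative D) F"
  from has_derivative_add[OF this has_derivative_const[of c]] show "((\<lambda>x. f x + c) has_derivative D) F" by simp
qed

lemma frechet_derivative_add_const:
  "frechet_derivative (\<lambda>x. f x + c) F = frechet_derivative f F"
  by (simp add: frechet_derivative_def has_derivative_add_const_iff)

lemma grad_eqI:
  assumes "(f has_derivative (\<lambda>v. g \<bullet> v)) (at x)"
  shows "grad f x = g"
proof -
  have "frechet_derivative f (at x) = (\<lambda>v. g \<bullet> v)"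
    using frechet_derivative_at[OF assms] by simp
  then show ?thesis by (simp add: grad_on_def inner_axis vec_eq_iff)
qed

lemma frechet_derivative_within_cong:
  assumes "x \<in> S" "\<And>y. y \<in> S \<Longrightarrow> f y = g y"
  shows "frechet_derivative f (at x within S) = frechet_derivative g (at x within S)"
proof -
  have "(f has_derivative D) (at x within S) \<longleftrightarrow> (g has_derivative D) (at x within S)" for D
    using assms has_derivative_transform by metis
  then show ?thesis unfolding frechet_derivative_def by simp
qed

subsection \<open>Radial graphs over the circle\<close>

lemma hom_ext_scaleR: "s > 0 \<Longrightarrow> hom_ext f (s *\<^sub>R y) = hom_ext f y"
  by (simp add: hom_ext_def mult.assoc mult.left_commute[of "inverse s"])

lemma hom_ext_circ: "x \<in> circ \<Longrightarrow> hom_ext f x = f x"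
  by (simp add: hom_ext_def)

text \<open>Every point of the punctured plane goes to the boundary point on its ray. Composing a
  function with this map gives the 0-homogeneous extension of its boundary trace, so derivatives of
  traces reduce to the chain rule.\<close>

definition radial_proj :: "(real^2 \<Rightarrow> real) \<Rightarrow> real^2 \<Rightarrow> real^2"
  where "radial_proj h z = (1 + hom_ext h z) *\<^sub>R (z /\<^sub>R norm z)"

lemma radial_proj_eq: "radial_proj h z = bdry_param h (z /\<^sub>R norm z)"
  by (simp add: radial_proj_def bdry_param_def hom_ext_def)

lemma tgrad_has_derivative:
  assumes "Ck_circ 1 f" "y \<noteq> 0"
  shows "(hom_ext f has_derivative (\<lambda>v. tgrad f y \<bullet> v)) (at y)"
  unfolding tgrad_def
  using assms Ck_1D(1)[of "- {0}" "hom_ext f" y] differentiableI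
  by (intro grad_on_has_derivative) (auto simp: Ck_circ_def)

text \<open>Euler's relation for a function homogeneous of degree 0.\<close>

lemma tgrad_radial:
  assumes "Ck_circ 1 f" "y \<noteq> 0"
  shows "tgrad f y \<bullet> y = 0"
proof -
  have "((\<lambda>s. s *\<^sub>R y) has_derivative (\<lambda>s. s *\<^sub>R y)) (at 1)"
    by (auto intro!: derivative_eq_intros)
  from has_derivative_along[OF this scaleR_one tgrad_has_derivative[OF assms]]
  have "((\<lambda>s. hom_ext f (s *\<^sub>R y)) has_derivative (\<lambda>s. s * (tgrad f y \<bullet> y))) (at 1)" by simp
  moreover have "((\<lambda>s. hom_ext f (s *\<^sub>R y)) has_derivative (\<lambda>s. 0)) (at 1)"
  proof (rule has_derivative_transform_within_open[OF has_derivative_const[of "hom_ext f y"]])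
    show "open {0::real<..}" by simp
  qed (auto simp: hom_ext_scaleR)
  ultimately have "(\<lambda>s. s * (tgrad f y \<bullet> y)) = (\<lambda>s. 0)"
    by (rule has_derivative_unique)
  from fun_cong[OF this, of 1] show ?thesis by simp
qed

text \<open>One time slice. Only the frontier of \<open>\<Omega>\<close> is prescribed; that
  \<open>\<Omega>\<close> is the region below the radial graph is a consequence, obtained in
  \<open>domain_eq\<close>.\<close>

locale radial_domain =
  fixes h :: "real^2 \<Rightarrow> real" and \<Omega> :: "(real^2) set"
  assumes h_C1: "Ck_circ 1 h"
    and h_gt: "\<And>x. x \<in> circ \<Longrightarrow> -1 < h x"
    and domain: "bounded_domain_with_boundary \<Omega> (bdry_param h ` circ)"
begin

lemma open_domain: "open \<Omega>" and connected_domain: "connected \<Omega>" and bounded_domain: "bounded \<Omega>"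
  and frontier_domain: "frontier \<Omega> = bdry_param h ` circ" and domain_ne: "\<Omega> \<noteq> {}"
  using domain by (auto simp: bounded_domain_with_boundary_def)

section \<open>Shape of a domain bounded by a radial graph\<close>

lemma frontier_eq: "frontier \<Omega> = {y. y \<noteq> 0 \<and> norm y = 1 + hom_ext h y}"
proof (intro equalityI subsetI)
  fix y assume "y \<in> frontier \<Omega>"
  then obtain x where x: "x \<in> circ" "y = (1 + h x) *\<^sub>R x"
    unfolding frontier_domain by (auto simp: bdry_param_def)
  then have "1 + h x > 0" using h_gt[of x] by simp
  then show "y \<in> {y. y \<noteq> 0 \<and> norm y = 1 + hom_ext h y}"
    using x hom_ext_scaleR[of "1 + h x" h x] hom_ext_circ[of x h] by auto
next
  fix y assume y: "y \<in> {y. y \<noteq> 0 \<and> norm y = 1 + hom_ext h y}"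
  then have *: "1 + h (y /\<^sub>R norm y) = norm y" by (simp add: hom_ext_def)
  have "y \<noteq> 0" using y by simp
  then have "y = norm y *\<^sub>R (y /\<^sub>R norm y)" by simp
  then have "y = bdry_param h (y /\<^sub>R norm y)"
    unfolding bdry_param_def * .
  moreover have "y /\<^sub>R norm y \<in> circ" using \<open>y \<noteq> 0\<close> by simp
  ultimately show "y \<in> frontier \<Omega>" unfolding frontier_domain by blast
qed

lemma ray_disjoint_frontier:
  assumes "y \<noteq> 0" "norm y > 1 + hom_ext h y"
  shows "(\<lambda>s. s *\<^sub>R y) ` {1..} \<inter> frontier \<Omega> = {}"
proof -
  have "s *\<^sub>R y \<notin> frontier \<Omega>" if "s \<ge> 1" for s
  proof -
    have "norm y \<le> s * norm y" using that by (simp add: mult_le_cancel_right1)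
    then have "s * norm y > 1 + hom_ext h y" using assms by linarith
    then show ?thesis using that by (simp add: hom_ext_scaleR frontier_eq)
  qed
  then show ?thesis by auto
qed

lemma segment_disjoint_frontier:
  assumes "y = 0 \<or> norm y < 1 + hom_ext h y"
  shows "closed_segment 0 y \<inter> frontier \<Omega> = {}"
proof -
  have False if "0 \<le> s" "s \<le> 1" "s *\<^sub>R y \<in> frontier \<Omega>" for s
  proof -
    have s: "s > 0" "y \<noteq> 0" using that by (auto simp: frontier_eq less_le)
    have "s * norm y \<le> norm y" using that by (simp add: mult_left_le_one_le)
    moreover have "s * norm y = 1 + hom_ext h y" using that(3) s by (simp add: frontier_eq hom_ext_scaleR)
    moreover have "norm y < 1 + hom_ext h y" using assms s by simp
    ultimately show False by linarith
  qed
  then show ?thesis by (auto simp: in_segment)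
qed

lemma unbounded_ray:
  assumes "(y :: real^2) \<noteq> 0" shows "\<not> bounded ((\<lambda>s. s *\<^sub>R y) ` {1..})"
proof
  assume "bounded ((\<lambda>s. s *\<^sub>R y) ` {1..})"
  then obtain b where b: "\<And>s. s \<ge> 1 \<Longrightarrow> norm (s *\<^sub>R y) \<le> b"
    unfolding bounded_iff by auto
  define s where "s = max 1 ((b + 1) / norm y)"
  have "norm (s *\<^sub>R y) \<ge> b + 1"
    using assms by (simp add: s_def pos_divide_le_eq[symmetric])
  with b[of s] show False by (simp add: s_def)
qed

lemma connected_ray: "connected ((\<lambda>s. s *\<^sub>R y) ` {1..})" for y :: "real^2"
  by (intro connected_continuous_image continuous_intros) simp

text \<open>A connected set that avoids the frontier lies inside \<open>\<Omega>\<close> or outside.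
  The outward ray from a point above the graph is unbounded, hence not contained in
  \<open>\<Omega>\<close>; the segments to the origin tie all points below the graph
  together.\<close>

lemma domain_eq: "\<Omega> = {y. y = 0 \<or> norm y < 1 + hom_ext h y}"
proof -
  have *: "y = 0 \<or> norm y < 1 + hom_ext h y" if "y \<in> \<Omega>" for y
  proof (rule ccontr)
    assume n: "\<not> (y = 0 \<or> norm y < 1 + hom_ext h y)"
    have "y \<notin> frontier \<Omega>" using that open_domain frontier_disjoint_eq by auto
    then have y: "y \<noteq> 0" "norm y > 1 + hom_ext h y"
      using n by (auto simp: frontier_eq)
    have "y \<in> (\<lambda>s. s *\<^sub>R y) ` {1..}" by (force intro: image_eqI[of _ _ 1])
    then have "(\<lambda>s. s *\<^sub>R y) ` {1..} \<subseteq> \<Omega>"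
      using connected_Int_frontier[OF connected_ray[of y], of \<Omega>] ray_disjoint_frontier[OF y] that by blast
    then show False
      using unbounded_ray[OF y(1)] bounded_domain bounded_subset by blast
  qed
  have seg: "closed_segment 0 y \<subseteq> \<Omega>" if "y = 0 \<or> norm y < 1 + hom_ext h y" "0 \<in> \<Omega> \<or> y \<in> \<Omega>" for y
  proof -
    have "closed_segment 0 y \<inter> \<Omega> \<noteq> {}" using that(2) by auto
    then show ?thesis
      using connected_Int_frontier[of "closed_segment 0 y" \<Omega>] segment_disjoint_frontier[OF that(1)]
        connected_segment by blast
  qed
  \<comment> \<open>One point of \<open>\<Omega>\<close> puts the origin into it, and the segments
    then bring in every point below the graph.\<close>
  obtain y0 where "y0 \<in> \<Omega>" using domain_ne by blast
  then have "0 \<in> \<Omega>" using seg[of y0] *[of y0] by auto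
  then show ?thesis using * seg by force
qed

lemma zero_in_domain: "0 \<in> \<Omega>"
  by (subst domain_eq) simp

lemma closure_eq: "closure \<Omega> = {y. y = 0 \<or> norm y \<le> 1 + hom_ext h y}"
  unfolding closure_Un_frontier frontier_eq by (subst domain_eq) auto

text \<open>The operators \<open>DN\<close>, \<open>Kop\<close> and \<open>Hop\<close> refer to
  \<open>enclosed h\<close>, the free boundary problem to \<open>\<Omega>\<close>. Rays and
  connectedness, now applied to components of the complement of the curve, identify the two.\<close>

lemma enclosed_eq: "enclosed h = \<Omega>"
proof (intro equalityI subsetI)
  fix y assume y: "y \<in> enclosed h"
  show "y \<in> \<Omega>"
  proof (rule ccontr)
    assume "y \<notin> \<Omega>"
    moreover have nf: "y \<notin> frontier \<Omega>" and b: "bounded (connected_component_set (- frontier \<Omega>) y)"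
      using y by (auto simp: enclosed_def inside_def frontier_domain)
    ultimately have y: "y \<noteq> 0" "norm y > 1 + hom_ext h y"
      using domain_eq frontier_eq by auto
    have "(\<lambda>s. s *\<^sub>R y) ` {1..} \<subseteq> connected_component_set (- frontier \<Omega>) y"
    proof (rule connected_component_maximal)
      show "y \<in> (\<lambda>s. s *\<^sub>R y) ` {1..}" by (rule image_eqI[of _ _ 1]) auto
      show "(\<lambda>s. s *\<^sub>R y) ` {1..} \<subseteq> - frontier \<Omega>"
        using ray_disjoint_frontier[OF y] by blast
    qed (rule connected_ray)
    then show False using unbounded_ray[OF y(1)] b bounded_subset by blast
  qed
next
  fix y assume y: "y \<in> \<Omega>"
  let ?C = "connected_component_set (- frontier \<Omega>) y"
  have nf: "y \<notin> frontier \<Omega>" using y open_domain frontier_disjoint_eq by auto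
  then have "y \<in> ?C" by (simp add: connected_component_refl)
  moreover have "?C \<inter> frontier \<Omega> = {}"
    using connected_component_subset[of "- frontier \<Omega>" y] by blast
  ultimately have "?C \<subseteq> \<Omega>"
    using connected_Int_frontier[of ?C \<Omega>] y by (metis Diff_eq_empty_iff IntI connected_connected_component empty_iff)
  then have "bounded ?C" by (rule bounded_subset[OF bounded_domain])
  then show "y \<in> enclosed h"
    using nf unfolding enclosed_def inside_def frontier_domain[symmetric] by simp
qed

text \<open>Star-shapedness in a strict form that includes boundary points: a radial segment meets
  the boundary at most at its end.\<close>

lemma scaleR_in_domain:
  assumes "y \<in> closure \<Omega>" "0 \<le> s" "s < 1" shows "s *\<^sub>R y \<in> \<Omega>"
proof (cases "s = 0 \<or> y = 0")
  case True then show ?thesis using zero_in_domain by auto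
next
  case False
  then have "s * norm y < norm y" using assms by (simp add: mult_less_cancel_right1)
  moreover have "norm y \<le> 1 + hom_ext h y" using assms(1) False by (simp add: closure_eq)
  ultimately have "s * norm y < 1 + hom_ext h y" by linarith
  then show ?thesis using assms False by (subst domain_eq) (simp add: hom_ext_scaleR)
qed

lemma scaleR_in_closure:
  assumes "y \<in> closure \<Omega>" "0 \<le> s" "s \<le> 1" shows "s *\<^sub>R y \<in> closure \<Omega>"
  using scaleR_in_domain[OF assms(1,2)] assms closure_subset[of \<Omega>] by (cases "s = 1") auto

lemma bdry_param_in_frontier: "x \<in> circ \<Longrightarrow> bdry_param h x \<in> frontier \<Omega>"
  by (simp add: frontier_domain)

lemma bdry_param_in_closure: "x \<in> circ \<Longrightarrow> bdry_param h x \<in> closure \<Omega>"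
  using bdry_param_in_frontier frontier_def by blast

lemma radial_proj_in_frontier: "z \<noteq> 0 \<Longrightarrow> radial_proj h z \<in> frontier \<Omega>"
  unfolding radial_proj_eq by (rule bdry_param_in_frontier) simp

section \<open>Defining function of the domain and outer normal\<close>

lemma Jac_sq: "x \<in> circ \<Longrightarrow> (Jac h x)\<^sup>2 = (1 + h x)\<^sup>2 + (norm (tgrad h x))\<^sup>2"
  by (simp add: Jac_def)

lemma Jac_pos: "x \<in> circ \<Longrightarrow> Jac h x > 0"
  using h_gt[of x] unfolding Jac_def by (auto intro!: real_sqrt_gt_zero add_pos_nonneg)

lemma tgrad_inner_radial: "x \<in> circ \<Longrightarrow> tgrad h x \<bullet> x = 0"
  by (rule tgrad_radial[OF h_C1]) auto

lemma radial_proj_has_derivative: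
  assumes "x \<in> circ"
  shows "(radial_proj h has_derivative
    (\<lambda>v. (tgrad h x \<bullet> v) *\<^sub>R x + (1 + h x) *\<^sub>R (v - (x \<bullet> v) *\<^sub>R x))) (at x)"
proof -
  have x: "norm x = 1" "x \<noteq> 0" using assms by auto
  have "((\<lambda>z. z /\<^sub>R norm z) has_derivative (\<lambda>v. v - (x \<bullet> v) *\<^sub>R x)) (at x)"
    using x by (auto intro!: derivative_eq_intros has_derivative_norm
        simp: inner_commute sgn_div_norm)
  from has_derivative_scaleR[OF has_derivative_add[OF has_derivative_const tgrad_has_derivative[OF h_C1 x(2)], of 1] this]
  show ?thesis
    unfolding radial_proj_def[abs_def] using x assms by (simp add: hom_ext_circ add.commute)
qed

text \<open>Away from the origin, \<open>norm z - 1 - hom_ext h z\<close> is negative inside the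
  domain, zero on the boundary and positive outside. Its gradient at a boundary point is the outer
  normal times \<open>Jac h x / (1 + h x)\<close>.\<close>

lemma level_function_has_derivative:
  assumes "x \<in> circ"
  shows "((\<lambda>z. norm z - 1 - hom_ext h z) has_derivative
    (\<lambda>v. (x - tgrad h x /\<^sub>R (1 + h x)) \<bullet> v)) (at (bdry_param h x))"
proof -
  define A where "A = 1 + h x"
  have A: "A > 0" using h_gt[OF assms] by (simp add: A_def)
  have x: "norm x = 1" "x \<noteq> 0" using assms by auto
  have "((\<lambda>z. inverse A *\<^sub>R z) has_derivative (\<lambda>v. inverse A *\<^sub>R v)) (at (A *\<^sub>R x))"
    by (auto intro!: derivative_eq_intros)
  from has_derivative_along[OF this _ tgrad_has_derivative[OF h_C1 x(2)]] A
  have "((\<lambda>z. hom_ext h (inverse A *\<^sub>R z)) has_derivative (\<lambda>v. tgrad h x \<bullet> (inverse A *\<^sub>R v))) (at (A *\<^sub>R x))"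
    by simp
  then have H: "(hom_ext h has_derivative (\<lambda>v. tgrad h x \<bullet> (inverse A *\<^sub>R v))) (at (A *\<^sub>R x))"
    using A by (simp add: hom_ext_scaleR)
  have "(norm has_derivative (\<lambda>v. v \<bullet> sgn (A *\<^sub>R x))) (at (A *\<^sub>R x))"
    using A x by (intro has_derivative_norm) simp
  moreover have "sgn (A *\<^sub>R x) = x" using A x by (simp add: sgn_div_norm)
  ultimately have "(norm has_derivative (\<lambda>v. v \<bullet> x)) (at (A *\<^sub>R x))" by simp
  from has_derivative_diff[OF has_derivative_diff[OF this has_derivative_const] H]
  show ?thesis
    by (simp add: bdry_param_def A_def inner_diff_left inner_diff_right inner_commute)
qed

lemma level_function_bdry_param: "x \<in> circ \<Longrightarrow> norm (bdry_param h x) - 1 - hom_ext h (bdry_param h x) = 0"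
  using bdry_param_in_frontier[of x] by (simp add: frontier_eq)

text \<open>A nonzero directional derivative of the defining function decides on which side of the
  boundary a short step along \<open>v\<close> ends.\<close>

lemma level_function_right_sign:
  assumes x: "x \<in> circ" and v: "v \<bullet> (x - tgrad h x /\<^sub>R (1 + h x)) \<noteq> 0"
  shows "\<forall>\<^sub>F s in at_right 0. bdry_param h x + s *\<^sub>R v \<noteq> 0 \<and>
    sgn (norm (bdry_param h x + s *\<^sub>R v) - 1 - hom_ext h (bdry_param h x + s *\<^sub>R v))
      = sgn (v \<bullet> (x - tgrad h x /\<^sub>R (1 + h x)))"
proof -
  define y where "y = bdry_param h x"
  define \<rho> where "\<rho> = (\<lambda>z. norm z - 1 - hom_ext h z)"
  define l where "l = v \<bullet> (x - tgrad h x /\<^sub>R (1 + h x))"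
  have y0: "y \<noteq> 0" using bdry_param_in_frontier[OF x] by (simp add: frontier_eq y_def)
  have "((\<lambda>s. y + s *\<^sub>R v) has_derivative (\<lambda>s. s *\<^sub>R v)) (at 0)"
    by (auto intro!: derivative_eq_intros)
  from has_derivative_along[OF this _ level_function_has_derivative[OF x]]
  have "((\<lambda>s. \<rho> (y + s *\<^sub>R v)) has_derivative (\<lambda>s. s * l)) (at 0)"
    by (simp add: \<rho>_def y_def l_def inner_commute)
  then have der: "((\<lambda>s. \<rho> (y + s *\<^sub>R v)) has_real_derivative l) (at 0)"
    unfolding has_field_derivative_def by (simp add: mult_commute_abs)
  have \<rho>0: "\<rho> y = 0" using level_function_bdry_param[OF x] by (simp add: \<rho>_def y_def)
  have "\<exists>d>0. \<forall>s. 0 < s \<and> s < d \<longrightarrow> sgn (\<rho> (y + s *\<^sub>R v)) = sgn l"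
  proof (cases "l > 0")
    case True
    from DERIV_pos_inc_right[OF der this] \<rho>0 show ?thesis using True by (auto simp: sgn_1_pos)
  next
    case False
    then have "l < 0" using v by (simp add: l_def)
    from DERIV_neg_dec_right[OF der this] \<rho>0 show ?thesis using \<open>l < 0\<close> by (auto simp: sgn_1_neg)
  qed
  then have 1: "\<forall>\<^sub>F s in at_right 0. sgn (\<rho> (y + s *\<^sub>R v)) = sgn l"
    by (auto simp: eventually_at_right_field)
  have "((\<lambda>s. y + s *\<^sub>R v) \<longlongrightarrow> y + 0 *\<^sub>R v) (at_right 0)"
    by (intro tendsto_intros)
  then have "\<forall>\<^sub>F s in at_right 0. y + s *\<^sub>R v \<noteq> 0"
    using y0 by (intro tendsto_imp_eventually_ne) auto
  with 1 show ?thesis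
    by eventually_elim (simp add: \<rho>_def y_def l_def)
qed

lemma inward_direction:
  assumes "x \<in> circ" "v \<bullet> (x - tgrad h x /\<^sub>R (1 + h x)) < 0"
  shows "\<forall>\<^sub>F s in at_right 0. bdry_param h x + s *\<^sub>R v \<in> \<Omega>"
  using level_function_right_sign[OF assms(1), of v] assms(2)
  by (auto simp: domain_eq sgn_1_neg elim!: eventually_mono)

lemma outward_direction:
  assumes "x \<in> circ" "v \<bullet> (x - tgrad h x /\<^sub>R (1 + h x)) > 0"
  shows "\<forall>\<^sub>F s in at_right 0. bdry_param h x + s *\<^sub>R v \<notin> closure \<Omega>"
  using level_function_right_sign[OF assms(1), of v] assms(2)
  by (auto simp: closure_eq sgn_1_pos elim!: eventually_mono)

text \<open>The normal is the normalized gradient of the defining function. Because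
  \<open>outer_normal\<close> is a definite description, uniqueness has to be proved too: a
  competitor is orthogonal to the tangent of a boundary curve, hence \<open>n\<close> or
  \<open>- n\<close>, and the last clause fixes the sign.\<close>

lemma outer_normal_eq:
  assumes x: "x \<in> circ"
  shows "outer_normal \<Omega> (bdry_param h x) = ((1 + h x) *\<^sub>R x - tgrad h x) /\<^sub>R Jac h x"
proof -
  define y where "y = bdry_param h x"
  define A where "A = 1 + h x"
  define N where "N = x - tgrad h x /\<^sub>R A"
  define n where "n = (A *\<^sub>R x - tgrad h x) /\<^sub>R Jac h x"
  define T where "T = (tgrad h x \<bullet> (Jmat *v x)) *\<^sub>R x + A *\<^sub>R (Jmat *v x)"
  have A: "A > 0" using h_gt[OF x] by (simp add: A_def)
  have x1: "norm x = 1" using x by simp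
  then have xx: "x \<bullet> x = 1" by (simp add: norm_eq_1)
  note Jp = Jac_pos[OF x]
  have tx: "tgrad h x \<bullet> x = 0" "x \<bullet> tgrad h x = 0"
    using tgrad_inner_radial[OF x] by (simp_all add: inner_commute)
  have "(norm (A *\<^sub>R x - tgrad h x))\<^sup>2 = (Jac h x)\<^sup>2"
    unfolding Jac_sq[OF x] power2_norm_eq_inner
    by (simp add: inner_diff_left inner_diff_right tx xx A_def power2_eq_square)
  then have "norm (A *\<^sub>R x - tgrad h x) = Jac h x"
    using Jp by (simp add: power2_eq_iff_nonneg)
  then have n1: "norm n = 1" using Jp by (simp add: n_def)
  have Nn: "N = (Jac h x / A) *\<^sub>R n" using A Jp by (simp add: N_def n_def scaleR_diff_right inverse_eq_divide)
  then have nN: "n \<bullet> N > 0" using A Jp n1 by (simp add: norm_eq_1)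
  have lev: "((\<lambda>z. norm z - 1 - hom_ext h z) has_derivative (\<lambda>v. N \<bullet> v)) (at y)"
    using level_function_has_derivative[OF x] by (simp add: N_def y_def A_def)
  have tangent: "((\<lambda>z. ((z - y) \<bullet> n) / norm (z - y)) \<longlongrightarrow> 0) (at y within frontier \<Omega>)"
  proof -
    have yf: "norm y - 1 - hom_ext h y = 0"
      using level_function_bdry_param[OF x] by (simp add: y_def)
    have "((\<lambda>z. (norm z - 1 - hom_ext h z - (norm y - 1 - hom_ext h y) - N \<bullet> (z - y)) /\<^sub>R norm (z - y)) \<longlongrightarrow> 0)
        (at y within frontier \<Omega>)"
      using has_derivative_at_withinI[OF lev, of "frontier \<Omega>"] unfolding has_derivative_at_within
      by simp
    \<comment> \<open>The defining function vanishes on the frontier, which leaves only the linear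
      term of its expansion.\<close>
    then have "((\<lambda>z. - (N \<bullet> (z - y)) /\<^sub>R norm (z - y)) \<longlongrightarrow> 0) (at y within frontier \<Omega>)"
    proof (rule Lim_transform_eventually)
      show "\<forall>\<^sub>F z in at y within frontier \<Omega>.
          (norm z - 1 - hom_ext h z - (norm y - 1 - hom_ext h y) - N \<bullet> (z - y)) /\<^sub>R norm (z - y)
            = - (N \<bullet> (z - y)) /\<^sub>R norm (z - y)"
        unfolding yf eventually_at_filter by (rule always_eventually) (simp add: frontier_eq)
    qed
    from tendsto_mult_right[OF this, of "- (A / Jac h x)"]
    have "((\<lambda>z. - (N \<bullet> (z - y)) /\<^sub>R norm (z - y) * - (A / Jac h x)) \<longlongrightarrow> 0) (at y within frontier \<Omega>)"
      by simp
    moreover have "- (N \<bullet> (z - y)) /\<^sub>R norm (z - y) * - (A / Jac h x) = ((z - y) \<bullet> n) / norm (z - y)" for z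
      unfolding Nn using A Jp by (simp add: inner_commute divide_simps)
    ultimately show ?thesis by (simp only:)
  qed
  have out: "\<forall>\<^sub>F s in at_right 0. y - s *\<^sub>R n \<in> \<Omega> \<and> y + s *\<^sub>R n \<notin> closure \<Omega>"
  proof -
    have "(- n) \<bullet> (x - tgrad h x /\<^sub>R (1 + h x)) < 0" "n \<bullet> (x - tgrad h x /\<^sub>R (1 + h x)) > 0"
      using nN by (simp_all add: N_def A_def)
    from inward_direction[OF x this(1)] outward_direction[OF x this(2)] show ?thesis
      by eventually_elim (simp add: y_def)
  qed
  show ?thesis
    unfolding outer_normal_def y_def[symmetric] A_def[symmetric] n_def[symmetric]
  proof (rule the_equality)
    show "norm n = 1 \<and> ((\<lambda>z. ((z - y) \<bullet> n) / norm (z - y)) \<longlongrightarrow> 0) (at y within frontier \<Omega>) \<and>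
      (\<forall>\<^sub>F s in at_right 0. y - s *\<^sub>R n \<in> \<Omega> \<and> y + s *\<^sub>R n \<notin> closure \<Omega>)"
      using n1 tangent out by blast
  next
    fix m
    assume m: "norm m = 1 \<and> ((\<lambda>z. ((z - y) \<bullet> m) / norm (z - y)) \<longlongrightarrow> 0) (at y within frontier \<Omega>) \<and>
      (\<forall>\<^sub>F s in at_right 0. y - s *\<^sub>R m \<in> \<Omega> \<and> y + s *\<^sub>R m \<notin> closure \<Omega>)"
    \<comment> \<open>The tangent line of the circle, projected radially to the boundary: a curve
      through \<open>y\<close> with velocity \<open>T\<close>, along which orthogonality to first
      order becomes \<open>T \<bullet> m = 0\<close>.\<close>
    define c where "c = (\<lambda>s. radial_proj h (x + s *\<^sub>R (Jmat *v x)))"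
    have c0: "c 0 = y" using x by (simp add: c_def y_def radial_proj_eq)
    have "((\<lambda>s. x + s *\<^sub>R (Jmat *v x)) has_derivative (\<lambda>s. s *\<^sub>R (Jmat *v x))) (at 0)"
      by (auto intro!: derivative_eq_intros)
    from has_derivative_along[OF this _ radial_proj_has_derivative[OF x]]
    have cder: "(c has_derivative (\<lambda>s. s *\<^sub>R T)) (at 0)"
      by (simp add: c_def T_def A_def algebra_simps)
    have "((\<lambda>s. norm (c s - y - s *\<^sub>R T) / norm s) \<longlongrightarrow> 0) (at 0)"
      using cder unfolding has_derivative_at by (simp add: c0)
    then have "((\<lambda>s. norm ((c s - y) /\<^sub>R s - T)) \<longlongrightarrow> 0) (at 0)"
    proof (rule Lim_transform_eventually)
      have "norm (c s - y - s *\<^sub>R T) / norm s = norm ((c s - y) /\<^sub>R s - T)" if "s \<noteq> 0" for s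
      proof -
        have "(c s - y) /\<^sub>R s - T = (c s - y - s *\<^sub>R T) /\<^sub>R s"
          using that by (simp add: scaleR_diff_right)
        then show ?thesis by (simp add: divide_inverse mult.commute)
      qed
      then show "\<forall>\<^sub>F s in at 0. norm (c s - y - s *\<^sub>R T) / norm s = norm ((c s - y) /\<^sub>R s - T)"
        unfolding eventually_at_filter by (intro always_eventually) blast
    qed
    then have "((\<lambda>s. (c s - y) /\<^sub>R s) \<longlongrightarrow> T) (at 0)"
      using Lim_null tendsto_norm_zero_iff by blast
    then have cT: "((\<lambda>s. (c s - y) /\<^sub>R s) \<longlongrightarrow> T) (at_right 0)"
      by (rule tendsto_within_subset) simp
    have "T \<bullet> (Jmat *v x) = A"
      using xx by (simp add: T_def inner_add_left)
    then have T0: "T \<noteq> 0" using A by auto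
    have TN: "T \<bullet> n = 0"
    proof -
      have "T \<bullet> x = tgrad h x \<bullet> (Jmat *v x)" "T \<bullet> tgrad h x = A * (tgrad h x \<bullet> (Jmat *v x))"
        by (simp_all add: T_def inner_add_left inner_add_right tx xx inner_commute)
      then show ?thesis by (simp add: n_def inner_diff_right)
    qed
    have cne: "\<forall>\<^sub>F s in at_right 0. c s \<noteq> y"
      using tendsto_imp_eventually_ne[OF cT T0] by eventually_elim auto
    have "(c \<longlongrightarrow> y) (at 0)"
      using has_derivative_continuous[OF cder] by (simp add: continuous_at c0)
    then have cy: "(c \<longlongrightarrow> y) (at_right 0)"
      by (rule tendsto_within_subset) simp
    have "x + s *\<^sub>R (Jmat *v x) \<noteq> 0" for s
    proof
      assume "x + s *\<^sub>R (Jmat *v x) = 0"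
      then have "(x + s *\<^sub>R (Jmat *v x)) \<bullet> x = 0" by simp
      then show False using xx by (simp add: inner_add_left)
    qed
    then have cfr: "c s \<in> frontier \<Omega>" for s
      unfolding c_def by (rule radial_proj_in_frontier)
    have cf: "filterlim c (at y within frontier \<Omega>) (at_right 0)"
      unfolding filterlim_at using cy cne cfr by simp
    have "((\<lambda>s. ((c s - y) \<bullet> m) / norm (c s - y)) \<longlongrightarrow> 0) (at_right 0)"
      using filterlim_compose[OF _ cf] m by blast
    moreover have "((\<lambda>s. (((c s - y) /\<^sub>R s) \<bullet> m) / norm ((c s - y) /\<^sub>R s)) \<longlongrightarrow> (T \<bullet> m) / norm T) (at_right 0)"
      using T0 by (intro tendsto_intros cT) simp
    then have "((\<lambda>s. ((c s - y) \<bullet> m) / norm (c s - y)) \<longlongrightarrow> (T \<bullet> m) / norm T) (at_right 0)"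
    proof (rule Lim_transform_eventually)
      show "\<forall>\<^sub>F s in at_right 0. (((c s - y) /\<^sub>R s) \<bullet> m) / norm ((c s - y) /\<^sub>R s) = ((c s - y) \<bullet> m) / norm (c s - y)"
        by (auto simp: eventually_at_right_field intro!: exI[of _ 1])
    qed
    ultimately have "T \<bullet> m / norm T = 0"
      using tendsto_unique trivial_limit_at_right_real by blast
    then have Tm: "T \<bullet> m = 0" using T0 by simp
    have "m = (m \<bullet> n) *\<^sub>R n"
    proof -
      have "(m \<bullet> (Jmat *v n)) = 0"
      proof -
        have TJ: "T = (T \<bullet> (Jmat *v n)) *\<^sub>R (Jmat *v n)"
          using orthonormal_frame_expansion[OF n1, of T] TN by simp
        then have "T \<bullet> m = (T \<bullet> (Jmat *v n)) * (m \<bullet> (Jmat *v n))"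
          using orthonormal_frame_inner[OF n1, of T m] TN by simp
        moreover have "T \<bullet> (Jmat *v n) \<noteq> 0"
          using TJ T0 by (metis scaleR_zero_left)
        ultimately show ?thesis using Tm by simp
      qed
      then show ?thesis using orthonormal_frame_expansion[OF n1, of m] by simp
    qed
    moreover have "\<bar>m \<bullet> n\<bar> = 1"
      using m n1 by (metis calculation mult.right_neutral norm_scaleR)
    then have "m \<bullet> n = 1 \<or> m \<bullet> n = -1" by linarith
    ultimately have "m = n \<or> m = - n" by (metis scaleR_minus1_left scaleR_one)
    moreover have "m \<noteq> - n"
    proof
      assume "m = - n"
      with m have "\<forall>\<^sub>F s in at_right 0. y + s *\<^sub>R n \<in> \<Omega>"
        by (auto elim!: eventually_mono)
      with out have "\<forall>\<^sub>F s in at_right (0::real). False"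
        by eventually_elim (use closure_subset in blast)
      then show False by simp
    qed
    ultimately show "m = n" by blast
  qed
qed

text \<open>\<open>grad_on\<close> at a boundary point is meaningful only if the derivative within
  the closure is unique. Inward directions determine it on an open half plane, and these directions
  span the plane.\<close>

lemma has_derivative_within_closure_unique:
  fixes f :: "real^2 \<Rightarrow> 'b::real_normed_vector"
  assumes y: "y \<in> closure \<Omega>" and L: "(f has_derivative L) (at y within closure \<Omega>)"
    and L': "(f has_derivative L') (at y within closure \<Omega>)"
  shows "L = L'"
proof (cases "y \<in> \<Omega>")
  case True
  have "at y within closure \<Omega> = at y"
    using at_within_open_subset[OF True open_domain closure_subset] .
  then show ?thesis using L L' has_derivative_unique by metis
next
  case False
  then have "y \<in> frontier \<Omega>" using y closure_Un_frontier by blast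
  then obtain x where x: "x \<in> circ" "y = bdry_param h x" unfolding frontier_domain by blast
  define N where "N = x - tgrad h x /\<^sub>R (1 + h x)"
  have "N \<bullet> x = 1" using x tgrad_inner_radial[OF x(1)] by (simp add: N_def inner_diff_left norm_eq_1)
  then have N0: "N \<bullet> N > 0" by auto
  have eq: "L v = L' v" if v: "v \<bullet> N < 0" for v
  proof -
    have ev: "\<forall>\<^sub>F s in at_right 0. y + s *\<^sub>R v \<in> closure \<Omega>"
      using inward_direction[OF x(1), of v] v x(2) subsetD[OF closure_subset, of _ \<Omega>]
      by (auto simp: N_def elim!: eventually_mono)
    then obtain d where d: "d > 0" "\<And>s. 0 < s \<Longrightarrow> s < d \<Longrightarrow> y + s *\<^sub>R v \<in> closure \<Omega>"
      by (auto simp: eventually_at_right_field)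
    have der: "((\<lambda>s. f (y + s *\<^sub>R v)) has_derivative (\<lambda>s. M (s *\<^sub>R v))) (at 0 within {0..<d})"
      if "(f has_derivative M) (at y within closure \<Omega>)" for M
    proof (rule has_derivative_in_compose[of "\<lambda>s. y + s *\<^sub>R v" "\<lambda>s. s *\<^sub>R v" 0 "{0..<d}" f M, simplified])
      show "((\<lambda>s. y + s *\<^sub>R v) has_derivative (\<lambda>s. s *\<^sub>R v)) (at 0 within {0..<d})"
        by (auto intro!: derivative_eq_intros)
      show "(f has_derivative M) (at y within (\<lambda>s. y + s *\<^sub>R v) ` {0..<d})"
        using that by (rule has_derivative_subset) (use d y in \<open>auto simp: le_less\<close>)
    qed
    have lin: "linear L" "linear L'" using L L' has_derivative_linear by blast+
    have vd: "((\<lambda>s. f (y + s *\<^sub>R v)) has_vector_derivative L v) (at 0 within {0..<d})"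
      "((\<lambda>s. f (y + s *\<^sub>R v)) has_vector_derivative L' v) (at 0 within {0..<d})"
      using der[OF L] der[OF L'] unfolding has_vector_derivative_def
      by (simp_all add: linear_cmul[OF lin(1)] linear_cmul[OF lin(2)])
    have "at 0 within {0..<d} \<noteq> bot"
      using \<open>d > 0\<close> by (simp add: trivial_limit_within islimpt_Ico)
    then show ?thesis using vector_derivative_unique_within vd by blast
  qed
  show ?thesis
  proof
    fix v
    \<comment> \<open>\<open>c\<close> is so large that \<open>v - c *\<^sub>R N\<close> and
      \<open>- (c *\<^sub>R N)\<close> both point inwards; their difference is
      \<open>v\<close>.\<close>
    define c where "c = (\<bar>v \<bullet> N\<bar> + 1) / (N \<bullet> N)"
    have cN: "c * (N \<bullet> N) = \<bar>v \<bullet> N\<bar> + 1" using N0 by (simp add: c_def)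
    have "L (v - c *\<^sub>R N) = L' (v - c *\<^sub>R N)"
      by (rule eq) (simp add: inner_diff_left cN)
    moreover have "L (- (c *\<^sub>R N)) = L' (- (c *\<^sub>R N))"
      by (rule eq) (simp add: cN)
    moreover have "linear L" "linear L'" using L L' has_derivative_linear by blast+
    ultimately show "L v = L' v"
      by (simp add: linear_diff linear_neg)
  qed
qed

lemma grad_on_closure_eqI:
  assumes "y \<in> closure \<Omega>" "(f has_derivative (\<lambda>v. g \<bullet> v)) (at y within closure \<Omega>)"
  shows "grad_on (closure \<Omega>) f y = g"
proof -
  have "(f has_derivative frechet_derivative f (at y within closure \<Omega>)) (at y within closure \<Omega>)"
    using assms(2) differentiableI frechet_derivative_works by blast
  then have "frechet_derivative f (at y within closure \<Omega>) = (\<lambda>v. g \<bullet> v)"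
    using has_derivative_within_closure_unique assms by blast
  then show ?thesis by (simp add: grad_on_def inner_axis vec_eq_iff)
qed

lemma at_within_closure_domain: "y \<in> \<Omega> \<Longrightarrow> at y within closure \<Omega> = at y"
  by (rule at_within_open_subset[OF _ open_domain closure_subset])

end

subsection \<open>Harmonic functions\<close>

lemma pd_eqI: "(f has_derivative f') (at x) \<Longrightarrow> pd i f x = f' (axis i 1)"
  unfolding pd_def using frechet_derivative_at by metis

lemma harmonic_on_second_derivatives:
  assumes "open S" "harmonic_on S f" "x \<in> S"
  shows "f differentiable (at x)" "pd i f differentiable (at x)"
proof -
  have "Ck (Suc (Suc 0)) S f" using assms(2) by (simp add: harmonic_on_def numeral_2_eq_2)
  then obtain f' where f': "\<And>y. y \<in> S \<Longrightarrow> (f has_derivative f' y) (at y)"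
      "\<And>v. Ck (Suc 0) S (\<lambda>y. f' y v)"
    unfolding Ck.simps(2)[of "Suc 0"] by blast
  show "f differentiable (at x)" using f'(1)[OF assms(3)] differentiableI by blast
  have "((\<lambda>y. f' y (axis i 1)) has_derivative
      frechet_derivative (\<lambda>y. f' y (axis i 1)) (at x)) (at x)"
    by (rule Ck_1D(1)[OF f'(2)[folded One_nat_def] assms(3)])
  then have "(pd i f has_derivative frechet_derivative (\<lambda>y. f' y (axis i 1)) (at x)) (at x)"
    by (rule has_derivative_transform_within_open[OF _ \<open>open S\<close> assms(3)]) (simp add: pd_eqI[OF f'(1)])
  then show "pd i f differentiable (at x)" by (rule differentiableI)
qed

lemma has_real_derivative_pd_line:
  assumes "f differentiable (at (z + s *\<^sub>R axis i 1))"
  shows "((\<lambda>s. f (z + s *\<^sub>R axis i 1)) has_real_derivative pd i f (z + s *\<^sub>R axis i 1)) (at s)"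
proof -
  have f: "(f has_derivative frechet_derivative f (at (z + s *\<^sub>R axis i 1))) (at (z + s *\<^sub>R axis i 1))"
    using assms frechet_derivative_works by blast
  have "((\<lambda>s. z + s *\<^sub>R axis i 1) has_derivative (\<lambda>c. c *\<^sub>R (axis i 1 :: real^2))) (at s)"
    by (auto intro!: derivative_eq_intros)
  from has_derivative_along[OF this refl f]
  show ?thesis
    unfolding has_field_derivative_def pd_def
    by (simp add: linear_cmul[OF has_derivative_linear[OF f]] mult_commute_abs)
qed

text \<open>A positive \<open>D\<close> would make \<open>\<phi>'\<close> positive just to the right
  of the critical point 0, and \<open>\<phi>\<close> would rise above its maximum.\<close>

lemma second_derivative_at_local_max:
  fixes \<phi> :: "real \<Rightarrow> real"
  assumes "d > 0" and \<phi>: "\<And>s. \<bar>s\<bar> < d \<Longrightarrow> (\<phi> has_real_derivative \<phi>' s) (at s)"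
    and \<phi>': "(\<phi>' has_real_derivative D) (at 0)"
    and max: "\<And>s. \<bar>s\<bar> < d \<Longrightarrow> \<phi> s \<le> \<phi> 0"
  shows "D \<le> 0"
proof (rule ccontr)
  assume "\<not> D \<le> 0"
  have zero: "\<phi>' 0 = 0"
    using DERIV_local_max[OF \<phi>[of 0] \<open>d > 0\<close>] max \<open>d > 0\<close> by simp
  obtain e where "e > 0" and e: "\<And>s. 0 < s \<Longrightarrow> s < e \<Longrightarrow> \<phi>' s > 0"
    using DERIV_pos_inc_right[OF \<phi>'] \<open>\<not> D \<le> 0\<close> zero by auto
  define s where "s = min d e / 2"
  have s: "0 < s" "s < d" "s < e" using \<open>d > 0\<close> \<open>e > 0\<close> by (auto simp: s_def min_def)
  obtain r where r: "0 < r" "r < s" "\<phi> s - \<phi> 0 = (s - 0) * \<phi>' r"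
    using MVT2[of 0 s \<phi> \<phi>'] \<phi> s by auto
  have "\<phi> s - \<phi> 0 > 0" using r e[of r] s by simp
  then show False using max[of s] s by simp
qed

text \<open>Adding a small multiple of \<open>|x|\<^sup>2\<close> makes the Laplacian of the difference strictly positive,
  which excludes an interior maximum.\<close>

lemma harmonic_comparison:
  fixes f g :: "real^2 \<Rightarrow> real"
  assumes \<Omega>: "open \<Omega>" "bounded \<Omega>" and f: "harmonic_on \<Omega> f" and g: "harmonic_on \<Omega> g"
    and cont: "continuous_on (closure \<Omega>) f" "continuous_on (closure \<Omega>) g"
    and bd: "\<And>y. y \<in> frontier \<Omega> \<Longrightarrow> f y \<le> g y" and x: "x \<in> closure \<Omega>"
  shows "f x \<le> g x"
proof (rule ccontr)
  assume "\<not> f x \<le> g x"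
  define M where "M = f x - g x"
  have "M > 0" using \<open>\<not> f x \<le> g x\<close> by (simp add: M_def)
  have comp: "compact (closure \<Omega>)" using \<Omega> by (simp add: compact_closure)
  then obtain R where R: "R > 0" "\<And>y. y \<in> closure \<Omega> \<Longrightarrow> norm y \<le> R"
    using bounded_pos compact_imp_bounded by metis
  \<comment> \<open>On the frontier the added term is then at most \<open>M / 2\<close>, while the
    maximum of \<open>\<phi>\<close> is at least \<open>M\<close>; so the maximum is attained
    inside.\<close>
  define \<epsilon> where "\<epsilon> = M / (2 * R\<^sup>2)"
  have "\<epsilon> > 0" using \<open>M > 0\<close> R by (simp add: \<epsilon>_def)
  have \<epsilon>R: "\<epsilon> * R\<^sup>2 < M" using \<open>M > 0\<close> R by (simp add: \<epsilon>_def)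
  define \<phi> where "\<phi> = (\<lambda>y. f y - g y + \<epsilon> * (y \<bullet> y))"
  have "continuous_on (closure \<Omega>) \<phi>"
    unfolding \<phi>_def by (intro continuous_intros cont)
  moreover have "closure \<Omega> \<noteq> {}" using x by auto
  ultimately obtain z where z: "z \<in> closure \<Omega>" "\<And>y. y \<in> closure \<Omega> \<Longrightarrow> \<phi> y \<le> \<phi> z"
    using continuous_attains_sup[OF comp, of \<phi>] by metis
  have "M \<le> \<phi> x" using \<open>\<epsilon> > 0\<close> by (simp add: M_def \<phi>_def)
  also have "\<dots> \<le> \<phi> z" by (rule z(2)[OF x])
  finally have "\<phi> z \<ge> M" .
  have "z \<in> \<Omega>"
  proof (rule ccontr)
    assume "z \<notin> \<Omega>"
    then have "f z \<le> g z" using bd z(1) closure_Un_frontier[of \<Omega>] by blast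
    moreover have "z \<bullet> z \<le> R\<^sup>2" using R z by (simp add: power_mono flip: power2_norm_eq_inner)
    then have "\<epsilon> * (z \<bullet> z) \<le> \<epsilon> * R\<^sup>2" using \<open>\<epsilon> > 0\<close> by simp
    ultimately show False using \<open>\<phi> z \<ge> M\<close> \<epsilon>R by (simp add: \<phi>_def)
  qed
  obtain d where d: "d > 0" "ball z d \<subseteq> \<Omega>"
    using \<Omega>(1) \<open>z \<in> \<Omega>\<close> open_contains_ball by blast
  have line: "z + s *\<^sub>R axis i 1 \<in> \<Omega>" if "\<bar>s\<bar> < d" for s i
    using that d by (auto simp: subset_eq dist_norm norm_axis_1)
  \<comment> \<open>Along each axis the second derivative of \<open>\<phi>\<close> at the maximum is
    nonpositive, and the quadratic term contributes \<open>2 * \<epsilon>\<close> to it.\<close>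
  have "pd i (pd i f) z - pd i (pd i g) z + 2 * \<epsilon> \<le> 0" for i
  proof (rule second_derivative_at_local_max[OF d(1)])
    let ?l = "\<lambda>s. z + s *\<^sub>R axis i (1::real)"
    have q: "?l s \<bullet> ?l s = z \<bullet> z + 2 * (z $ i) * s + s\<^sup>2" for s
      by (simp add: inner_add_left inner_add_right inner_axis inner_axis' power2_eq_square algebra_simps)
    show "((\<lambda>s. \<phi> (?l s)) has_real_derivative
        pd i f (?l s) - pd i g (?l s) + \<epsilon> * (2 * z $ i + 2 * s)) (at s)" if "\<bar>s\<bar> < d" for s
      unfolding \<phi>_def q
      using harmonic_on_second_derivatives(1)[OF \<Omega>(1) f line[OF that]]
        harmonic_on_second_derivatives(1)[OF \<Omega>(1) g line[OF that]]
      by (auto intro!: derivative_eq_intros has_real_derivative_pd_line)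
    have "((\<lambda>s. pd i f (?l s)) has_real_derivative pd i (pd i f) (?l 0)) (at 0)"
      "((\<lambda>s. pd i g (?l s)) has_real_derivative pd i (pd i g) (?l 0)) (at 0)"
      using harmonic_on_second_derivatives(2)[OF \<Omega>(1) f \<open>z \<in> \<Omega>\<close>, of i]
        harmonic_on_second_derivatives(2)[OF \<Omega>(1) g \<open>z \<in> \<Omega>\<close>, of i]
      by (intro has_real_derivative_pd_line; simp)+
    then show "((\<lambda>s. pd i f (?l s) - pd i g (?l s) + \<epsilon> * (2 * z $ i + 2 * s)) has_real_derivative
        pd i (pd i f) z - pd i (pd i g) z + 2 * \<epsilon>) (at 0)"
      by (auto intro!: derivative_eq_intros)
    show "\<phi> (?l s) \<le> \<phi> (?l 0)" if "\<bar>s\<bar> < d" for s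
      using z(2) line[OF that] closure_subset by auto
  qed
  from this[of 1] this[of 2] have "laplacian f z - laplacian g z + 4 * \<epsilon> \<le> 0"
    by (simp add: laplacian_def sum_2)
  then show False
    using f g \<open>z \<in> \<Omega>\<close> \<open>\<epsilon> > 0\<close> by (simp add: harmonic_on_def)
qed

lemma laplacian_eq_gradient:
  assumes "open S" "x \<in> S" and f: "\<And>y. y \<in> S \<Longrightarrow> (f has_derivative (\<lambda>v. G y \<bullet> v)) (at y)"
    and G: "(G has_derivative G') (at x)"
  shows "laplacian f x = (\<Sum>i\<in>UNIV. G' (axis i 1) $ i)"
proof -
  have "pd i (pd i f) x = G' (axis i 1) $ i" for i
  proof -
    have "((\<lambda>y. G y $ i) has_derivative (\<lambda>v. G' v $ i)) (at x)"
      by (rule bounded_linear.has_derivative[OF bounded_linear_vec_nth G])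
    then have "(pd i f has_derivative (\<lambda>v. G' v $ i)) (at x)"
      by (rule has_derivative_transform_within_open[OF _ assms(1,2)]) (simp add: pd_eqI[OF f] inner_axis)
    then show ?thesis by (rule pd_eqI)
  qed
  then show ?thesis by (simp add: laplacian_def)
qed

lemma harmonic_onI:
  assumes "open S" and f: "\<And>y. y \<in> S \<Longrightarrow> (f has_derivative (\<lambda>v. G y \<bullet> v)) (at y)"
    and G: "Ck 1 S G" and div: "\<And>y. y \<in> S \<Longrightarrow> (\<Sum>i\<in>UNIV. frechet_derivative G (at y) (axis i 1) $ i) = 0"
  shows "harmonic_on S f"
proof -
  have "Ck 1 S (\<lambda>y. G y \<bullet> v)" for v
    using Ck_1_compose[OF G Ck_1_bounded_linear[OF bounded_linear_inner_left[of v], of UNIV]] by simp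
  then have "Ck (Suc 1) S f"
    unfolding Ck.simps(2) using f by (intro exI[of _ "\<lambda>y v. G y \<bullet> v"]) blast
  then show ?thesis
    using laplacian_eq_gradient[OF assms(1) _ f Ck_1D(1)[OF G]] div
    by (simp add: harmonic_on_def numeral_2_eq_2)
qed

lemma harmonic_on_add_const: "harmonic_on S f \<Longrightarrow> harmonic_on S (\<lambda>x. f x + c)"
proof -
  assume f: "harmonic_on S f"
  have "Ck (Suc 1) S f \<Longrightarrow> Ck (Suc 1) S (\<lambda>x. f x + c)"
    unfolding Ck.simps(2) by (simp only: has_derivative_add_const_iff)
  moreover have "pd i (\<lambda>x. f x + c) = pd i f" for i
    by (rule ext) (simp add: pd_def frechet_derivative_add_const)
  ultimately show ?thesis
    using f by (simp add: harmonic_on_def laplacian_def numeral_2_eq_2 del: Ck.simps)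
qed

subsection \<open>Radial primitives\<close>

text \<open>Poincare lemma on a star-shaped set: by symmetry of the Jacobian, the derivative of the
  integrand in direction \<open>v\<close> is the \<open>s\<close>-derivative of
  \<open>s *\<^sub>R X (s *\<^sub>R x) \<bullet> v\<close>, and the integral reduces to the end
  point \<open>s = 1\<close>.\<close>

lemma radial_primitive_has_derivative:
  fixes X :: "real^2 \<Rightarrow> real^2"
  assumes "open S" and star: "\<And>y s. y \<in> S \<Longrightarrow> 0 \<le> s \<Longrightarrow> s \<le> 1 \<Longrightarrow> s *\<^sub>R y \<in> S"
    and X: "Ck 1 S X"
    and sym: "\<And>y v w. y \<in> S \<Longrightarrow>
      frechet_derivative X (at y) v \<bullet> w = frechet_derivative X (at y) w \<bullet> v"
    and x: "x \<in> S"
  shows "((\<lambda>y. integral {0..1} (\<lambda>s. X (s *\<^sub>R y) \<bullet> y)) has_derivative (\<lambda>v. X x \<bullet> v)) (at x)"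
proof -
  define K' where "K' = (\<lambda>y s v. X (s *\<^sub>R y) \<bullet> v + frechet_derivative X (at (s *\<^sub>R y)) (s *\<^sub>R v) \<bullet> y)"
  have K: "((\<lambda>y. X (s *\<^sub>R y) \<bullet> y) has_derivative K' y s) (at y)" if "y \<in> S" "s \<in> {0..1}" for y s
  proof -
    have "((\<lambda>y. s *\<^sub>R y) has_derivative (\<lambda>v. s *\<^sub>R v)) (at y)"
      by (auto intro!: derivative_eq_intros)
    from has_derivative_along[OF this refl Ck_1D(1)[OF X star]] that
    have "((\<lambda>y. X (s *\<^sub>R y)) has_derivative (\<lambda>v. frechet_derivative X (at (s *\<^sub>R y)) (s *\<^sub>R v))) (at y)"
      by simp
    from has_derivative_inner[OF this has_derivative_ident] show ?thesis by (simp add: K'_def)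
  qed
  have cX: "continuous_on T (\<lambda>p. X (s p *\<^sub>R y p))"
    if "continuous_on T s" "continuous_on T y" "\<And>p. p \<in> T \<Longrightarrow> s p \<in> {0..1} \<and> y p \<in> S" for T :: "'z::topological_space set" and s y
    using that star by (intro continuous_on_compose2[OF Ck_1_imp_continuous_on[OF X]] continuous_intros) auto
  have K0: "continuous_on {0..1} (\<lambda>s. X (s *\<^sub>R y) \<bullet> y)" if "y \<in> S" for y
    using that by (intro continuous_intros cX) auto
  have cK': "continuous_on (S \<times> {0..1}) (\<lambda>(y, s). K' y s v)" for v
    unfolding K'_def case_prod_beta
    using star by (intro continuous_intros cX continuous_on_derivative_apply[OF X]) auto
  have *: "((\<lambda>y. integral {0..1} (\<lambda>s. X (s *\<^sub>R y) \<bullet> y)) has_derivative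
      (\<lambda>v. integral {0..1} (\<lambda>s. K' x s v))) (at x)"
    by (rule param_integral_Ck_1(1)[OF \<open>open S\<close> K K0 cK' x])
  have "integral {0..1} (\<lambda>s. K' x s v) = X x \<bullet> v" for v
  proof -
    have "((\<lambda>s. K' x s v) has_integral (1 *\<^sub>R X (1 *\<^sub>R x) \<bullet> v - 0 *\<^sub>R X (0 *\<^sub>R x) \<bullet> v)) {0..1}"
    proof (rule fundamental_theorem_of_calculus)
      fix s :: real assume s: "s \<in> {0..1}"
      have sx: "s *\<^sub>R x \<in> S" using star x s by simp
      have lin: "linear (frechet_derivative X (at (s *\<^sub>R x)))"
        using Ck_1D(1)[OF X sx] has_derivative_linear by blast
      have "((\<lambda>s. s *\<^sub>R x) has_derivative (\<lambda>c. c *\<^sub>R x)) (at s)"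
        by (auto intro!: derivative_eq_intros)
      from has_derivative_along[OF this refl Ck_1D(1)[OF X sx]]
      have "((\<lambda>s. X (s *\<^sub>R x)) has_derivative (\<lambda>c. c *\<^sub>R frechet_derivative X (at (s *\<^sub>R x)) x)) (at s)"
        by (simp add: linear_cmul[OF lin])
      from has_derivative_inner_left[OF has_derivative_scaleR[OF has_derivative_ident this], of v]
      have "((\<lambda>s. s *\<^sub>R X (s *\<^sub>R x) \<bullet> v) has_vector_derivative K' x s v) (at s)"
        unfolding has_vector_derivative_def K'_def linear_cmul[OF lin]
        by (simp add: inner_add_left sym[OF sx, of x v] algebra_simps)
      then show "((\<lambda>s. s *\<^sub>R X (s *\<^sub>R x) \<bullet> v) has_vector_derivative K' x s v) (at s within {0..1})"
        by (rule has_vector_derivative_at_within)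
    qed simp
    then show ?thesis by (simp add: integral_unique)
  qed
  with * show ?thesis by simp
qed

text \<open>\<open>C1_upto\<close> asks for an open neighbourhood on which the radial integral still
  makes sense. Compactness of the unit interval, through the tube lemma, makes the points whose
  whole segment lies in \<open>W\<close> such a set.\<close>

lemma open_segment_preimage:
  assumes "open (W :: (real \<times> (real^2)) set)"
  shows "open {(t, x). \<forall>s\<in>{0..1}. (t, s *\<^sub>R x) \<in> W}"
proof -
  define m where "m = (\<lambda>(z, s). (fst z, s *\<^sub>R snd z) :: real \<times> (real^2))"
  have "open (m -` W)"
    unfolding m_def case_prod_beta
    by (rule open_vimage[OF assms]) (auto intro!: continuous_intros)
  have "\<exists>T. open T \<and> z \<in> T \<and> T \<subseteq> {(t, x). \<forall>s\<in>{0..1}. (t, s *\<^sub>R x) \<in> W}"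
    if "z \<in> {(t, x). \<forall>s\<in>{0..1}. (t, s *\<^sub>R x) \<in> W}" for z
  proof -
    have "{z} \<times> {0..1} \<subseteq> m -` W" using that by (auto simp: m_def)
    then obtain X where "z \<in> X" "open X" "X \<times> {0..1} \<subseteq> m -` W"
      using Elementary_Topology.tube_lemma[OF compact_Icc \<open>open (m -` W)\<close>] by metis
    then show ?thesis by (intro exI[of _ X]) (auto simp: m_def)
  qed
  then show ?thesis by (subst open_subopen) blast
qed

text \<open>Joint regularity in time and space. It concerns an extended field on an open set, where
  the field is not known to be a gradient; the derivative therefore remains an integral.\<close>

lemma radial_primitive_Ck_1:
  fixes X :: "real \<times> (real^2) \<Rightarrow> real^2"
  assumes "open W" and X: "Ck 1 W X"
  shows "Ck 1 {(t, x). \<forall>s\<in>{0..1}. (t, s *\<^sub>R x) \<in> W}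
    (\<lambda>z. integral {0..1} (\<lambda>s. X (fst z, s *\<^sub>R snd z) \<bullet> snd z))"
proof -
  define V where "V = {(t, x). \<forall>s\<in>{0..1}. (t, s *\<^sub>R x) \<in> W}"
  define K' where "K' = (\<lambda>z s v. X (fst z, s *\<^sub>R snd z) \<bullet> snd v
    + frechet_derivative X (at (fst z, s *\<^sub>R snd z)) (fst v, s *\<^sub>R snd v) \<bullet> snd z)"
  have VW: "(fst z, s *\<^sub>R snd z) \<in> W" if "z \<in> V" "s \<in> {0..1}" for z s
    using that by (auto simp: V_def)
  have K: "((\<lambda>z. X (fst z, s *\<^sub>R snd z) \<bullet> snd z) has_derivative K' z s) (at z)"
    if "z \<in> V" "s \<in> {0..1}" for z s
  proof -
    have "((\<lambda>z. (fst z, s *\<^sub>R snd z)) has_derivative (\<lambda>v. (fst v, s *\<^sub>R snd v))) (at z)"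
      by (auto intro!: derivative_eq_intros)
    from has_derivative_along[OF this refl Ck_1D(1)[OF X VW[OF that]]]
    show ?thesis unfolding K'_def
      by (rule has_derivative_inner) (auto intro!: derivative_eq_intros)
  qed
  have cX: "continuous_on T (\<lambda>p. X (fst (z p), s p *\<^sub>R snd (z p)))"
    if "continuous_on T s" "continuous_on T z" "\<And>p. p \<in> T \<Longrightarrow> s p \<in> {0..1} \<and> z p \<in> V"
    for T :: "'z::topological_space set" and s z
  proof (rule continuous_on_compose2[OF Ck_1_imp_continuous_on[OF X]])
    show "continuous_on T (\<lambda>p. (fst (z p), s p *\<^sub>R snd (z p)))"
      by (intro continuous_intros that)
    show "(\<lambda>p. (fst (z p), s p *\<^sub>R snd (z p))) ` T \<subseteq> W"
      using VW that(3) by blast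
  qed
  have "open V" unfolding V_def by (rule open_segment_preimage[OF \<open>open W\<close>])
  have "Ck 1 V (\<lambda>z. integral {0..1} (\<lambda>s. X (fst z, s *\<^sub>R snd z) \<bullet> snd z))"
  proof (rule param_integral_Ck_1(2)[OF \<open>open V\<close> K])
    show "continuous_on {0..1} (\<lambda>s. X (fst z, s *\<^sub>R snd z) \<bullet> snd z)" if "z \<in> V" for z
      using that by (intro continuous_intros cX) auto
    show "continuous_on (V \<times> {0..1}) (\<lambda>(z, s). K' z s v)" for v
      unfolding K'_def case_prod_beta
      by (intro continuous_intros cX continuous_on_derivative_apply[OF X]) (auto intro!: VW)
  qed
  then show ?thesis by (simp add: V_def)
qed

lemma eq_on_closureI:
  fixes f g :: "'a::topological_space \<Rightarrow> 'b::real_normed_vector"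
  assumes "continuous_on (closure S) f" "continuous_on (closure S) g"
    and "\<And>x. x \<in> S \<Longrightarrow> f x = g x" "x \<in> closure S"
  shows "f x = g x"
  using continuous_constant_on_closure[OF continuous_on_diff[OF assms(1,2)], of 0 x] assms(3,4) by simp

subsection \<open>Moving domains\<close>

locale drop =
  fixes I :: "real set" and h :: "real \<Rightarrow> real^2 \<Rightarrow> real" and \<Omega> :: "real \<Rightarrow> (real^2) set"
  assumes open_I: "open I" and geom: "drop_geometry I h \<Omega>"
begin

lemma h_Ck_2: "Ck_time_circ 2 I h"
  using geom by (simp add: drop_geometry_def)

lemma h_gt: "t \<in> I \<Longrightarrow> x \<in> circ \<Longrightarrow> -1 < h t x"
  using geom unfolding drop_geometry_def by blast

lemma h_Ck_1: "Ck 1 (I \<times> (- {0})) (\<lambda>(t, y). hom_ext (h t) y)"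
  using Ck_Suc_imp_Ck[OF h_Ck_2[unfolded Ck_time_circ_def numeral_2_eq_2]] unfolding One_nat_def .

lemma Ck_circ_slice:
  assumes "Ck_time_circ k I f" "t \<in> I" shows "Ck_circ k (f t)"
  using Ck_Pair_slice[OF assms(1)[unfolded Ck_time_circ_def] assms(2)] by (simp add: Ck_circ_def)

lemma radial_domain: "t \<in> I \<Longrightarrow> radial_domain (h t) (\<Omega> t)"
proof
  assume t: "t \<in> I"
  show "Ck_circ 1 (h t)"
    using Ck_Pair_slice[OF h_Ck_1 t] by (simp add: Ck_circ_def)
  show "-1 < h t x" if "x \<in> circ" for x using h_gt[OF t that] .
  show "bounded_domain_with_boundary (\<Omega> t) (bdry_param (h t) ` circ)"
    using geom t by (simp add: drop_geometry_def)
qed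

lemma continuous_on_h: "continuous_on (I \<times> (- {0})) (\<lambda>(t, y). hom_ext (h t) y)"
  using h_Ck_1 by (rule Ck_1_imp_continuous_on)

text \<open>Near the origin, where the radial function has no continuous extension, openness comes from a
  lower bound on the radius that is uniform for nearby times.\<close>

lemma open_spacetime: "open (Sigma I \<Omega>)"
proof (subst open_subopen, intro ballI)
  fix z assume "z \<in> Sigma I \<Omega>"
  then obtain t x where z: "z = (t, x)" "t \<in> I" "x \<in> \<Omega> t" by auto
  show "\<exists>T. open T \<and> z \<in> T \<and> T \<subseteq> Sigma I \<Omega>"
  proof (cases "x = 0")
    case False
    have "continuous_on (I \<times> (- {0})) (\<lambda>z. norm (snd z) - 1 - (\<lambda>(t, y). hom_ext (h t) y) z)"
      by (intro continuous_intros continuous_on_h)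
    moreover have "open (I \<times> (- {0::real^2}))" using open_I by (intro open_Times) auto
    ultimately have "open (I \<times> (- {0}) \<inter> (\<lambda>z. norm (snd z) - 1 - (\<lambda>(t, y). hom_ext (h t) y) z) -` {..<0})"
      by (rule continuous_open_preimage) simp
    moreover have "norm x < 1 + hom_ext (h t) x"
      using z False radial_domain.domain_eq[OF radial_domain[OF z(2)]] by blast
    moreover have "y \<in> \<Omega> s" if "s \<in> I" "norm y < 1 + hom_ext (h s) y" for s y
      using that radial_domain.domain_eq[OF radial_domain[OF that(1)]] by blast
    ultimately show ?thesis
      using z False
      by (intro exI[of _ "I \<times> (- {0}) \<inter> (\<lambda>z. norm (snd z) - 1 - (\<lambda>(t, y). hom_ext (h t) y) z) -` {..<0}"])
        auto
  next
    case True
    obtain e where e: "e > 0" "cball t e \<subseteq> I"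
      using open_I z(2) open_contains_cball by blast
    have "continuous_on (cball t e \<times> circ) (\<lambda>(t, y). hom_ext (h t) y)"
      using e by (intro continuous_on_subset[OF continuous_on_h]) auto
    moreover have "compact (cball t e \<times> circ)" by (intro compact_Times) auto
    moreover have "axis 1 1 \<in> circ" by (simp add: norm_axis_1)
    then have "cball t e \<times> circ \<noteq> {}" using e by fastforce
    ultimately obtain p where p: "p \<in> cball t e \<times> circ"
        "\<And>q. q \<in> cball t e \<times> circ \<Longrightarrow> (\<lambda>(t, y). hom_ext (h t) y) p \<le> (\<lambda>(t, y). hom_ext (h t) y) q"
      using continuous_attains_inf[of "cball t e \<times> circ" "\<lambda>(t, y). hom_ext (h t) y"] by metis
    obtain t1 x1 where p1: "p = (t1, x1)" "t1 \<in> cball t e" "x1 \<in> circ" using p(1) by auto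
    define m where "m = 1 + h t1 x1"
    have "m > 0" using h_gt[of t1 x1] p1 e by (auto simp: m_def)
    have "ball t e \<times> ball 0 m \<subseteq> Sigma I \<Omega>"
    proof clarify
      fix s y assume s: "s \<in> ball t e" and y: "y \<in> ball (0 :: real^2) m"
      have "s \<in> I" using s e by auto
      moreover have "y = 0 \<or> norm y < 1 + hom_ext (h s) y"
      proof (cases "y = 0")
        case False
        then have "y /\<^sub>R norm y \<in> circ" by simp
        then have "h t1 x1 \<le> hom_ext (h s) (y /\<^sub>R norm y)"
          using p(2)[of "(s, y /\<^sub>R norm y)"] p1 s by (simp add: hom_ext_circ)
        then show ?thesis using y False hom_ext_scaleR[of "inverse (norm y)" "h s" y] by (simp add: m_def)
      qed simp
      ultimately show "s \<in> I \<and> y \<in> \<Omega> s"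
        using radial_domain.domain_eq[OF radial_domain] by blast
    qed
    then show ?thesis
      using z True e \<open>m > 0\<close> by (intro exI[of _ "ball t e \<times> ball 0 m"]) (auto intro: open_Times)
  qed
qed

lemma spacetime_radial_proj_Ck_1: "Ck 1 (I \<times> (- {0})) (\<lambda>z. (fst z, radial_proj (h (fst z)) (snd z)))"
proof -
  have "Ck 1 (I \<times> (- {0})) (\<lambda>z. hom_ext (h (fst z)) (snd z))"
    using h_Ck_1 unfolding case_prod_unfold .
  moreover have "Ck 1 (I \<times> (- {0})) (\<lambda>z. snd z /\<^sub>R norm (snd z))"
    by (rule Ck_1_compose[OF Ck_1_bounded_linear[OF bounded_linear_snd] Ck_1_unit_vector]) auto
  ultimately show ?thesis
    unfolding radial_proj_def
    by (intro Ck_1_Pair[OF Ck_1_bounded_linear[OF bounded_linear_fst]]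
        Ck_1_scaleR[OF Ck_1_add[OF Ck_1_const]])
qed

lemma radial_function_has_time_derivative:
  assumes "t \<in> I" "x \<in> circ"
  shows "((\<lambda>s. h s x) has_real_derivative deriv (\<lambda>s. h s x) t) (at t)"
proof -
  let ?H = "\<lambda>(t, y). hom_ext (h t) y"
  have x: "(t, x) \<in> I \<times> (- {0})" using assms by auto
  have "((\<lambda>s. (s, x)) has_derivative (\<lambda>s. (s, 0))) (at t)"
    by (auto intro!: derivative_eq_intros)
  from has_derivative_along[OF this refl Ck_1D(1)[OF h_Ck_1 x]]
  have "(\<lambda>s. h s x) differentiable (at t)"
    using assms by (auto simp: hom_ext_circ intro: differentiableI)
  then show ?thesis
    using real_differentiable_def DERIV_deriv_iff_real_differentiable by blast
qed

text \<open>Boundary points move along their rays, so only the radial component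
  \<open>(1 + h) / J\<close> of the normal enters.\<close>

lemma normal_velocity_eq:
  assumes "t \<in> I" "x \<in> circ"
  shows "normal_velocity h \<Omega> t x = deriv (\<lambda>s. h s x) t * ((1 + h t x) / Jac (h t) x)"
proof -
  interpret radial_domain "h t" "\<Omega> t" by (rule radial_domain[OF assms(1)])
  have "((\<lambda>s. bdry_param (h s) x) has_vector_derivative deriv (\<lambda>s. h s x) t *\<^sub>R x) (at t)"
    unfolding bdry_param_def
    using radial_function_has_time_derivative[OF assms]
    by (auto intro!: derivative_eq_intros has_vector_derivative_eq_rhs[OF has_vector_derivative_scaleR])
  then have "vector_derivative (\<lambda>s. bdry_param (h s) x) (at t) = deriv (\<lambda>s. h s x) t *\<^sub>R x"
    by (rule vector_derivative_at)
  moreover have "x \<bullet> x = 1" using assms by (simp add: norm_eq_1)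
  ultimately show ?thesis
    using tgrad_inner_radial[OF assms(2)]
    by (simp add: normal_velocity_def outer_normal_eq[OF assms(2)] inner_diff_right inner_commute divide_inverse)
qed

end

subsection \<open>Potential flow in a moving domain\<close>

text \<open>\<open>g\<close> and \<open>G\<close> are C^1 extensions of the potential and of its
  gradient, fixed so that derivatives at the boundary can be taken as two-sided ones. Off the closed
  space-time domain they carry no information; in particular \<open>G\<close> need not be the
  spatial gradient of \<open>g\<close> there.\<close>

locale drop_potential = drop I h \<Omega> for I h \<Omega> +
  fixes \<Phi> :: "real \<Rightarrow> real^2 \<Rightarrow> real" and W :: "(real \<times> (real^2)) set"
    and g :: "real \<times> (real^2) \<Rightarrow> real" and G :: "real \<times> (real^2) \<Rightarrow> real^2"
  assumes open_W: "open W" and W: "closed_spacetime I \<Omega> \<subseteq> W"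
    and g: "Ck 1 W g" and G: "Ck 1 W G"
    and \<Phi>_eq: "\<And>t x. t \<in> I \<Longrightarrow> x \<in> closure (\<Omega> t) \<Longrightarrow> \<Phi> t x = g (t, x)"
    and grad_eq: "\<And>t x. t \<in> I \<Longrightarrow> x \<in> closure (\<Omega> t) \<Longrightarrow> grad_on (closure (\<Omega> t)) (\<Phi> t) x = G (t, x)"
    and harmonic: "\<And>t. t \<in> I \<Longrightarrow> harmonic_on (\<Omega> t) (\<Phi> t)"
begin

section \<open>The potential, its gradient and its Hessian up to the boundary\<close>

abbreviation "dg z \<equiv> frechet_derivative g (at z)"
abbreviation "dG z \<equiv> frechet_derivative G (at z)"

lemma closure_in_W: "t \<in> I \<Longrightarrow> x \<in> closure (\<Omega> t) \<Longrightarrow> (t, x) \<in> W"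
  using W by (auto simp: closed_spacetime_def)

lemma domain_in_W: "t \<in> I \<Longrightarrow> x \<in> \<Omega> t \<Longrightarrow> (t, x) \<in> W"
  using closure_in_W closure_subset by blast

lemma spacetime_in_W: "Sigma I \<Omega> \<subseteq> W"
  using domain_in_W by auto

lemma has_derivative_slice:
  assumes "Ck 1 W f" "(t, x) \<in> W"
  shows "((\<lambda>y. f (t, y)) has_derivative (\<lambda>v. frechet_derivative f (at (t, x)) (0, v))) (at x)"
proof -
  have "((\<lambda>y. (t, y)) has_derivative (\<lambda>v. (0, v))) (at x)"
    by (auto intro!: derivative_eq_intros)
  from has_derivative_along[OF this refl Ck_1D(1)[OF assms]] show ?thesis .
qed

lemma continuous_on_slice:
  assumes "continuous_on W f" "t \<in> I"
  shows "continuous_on (closure (\<Omega> t)) (\<lambda>y. f (t, y))"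
  using closure_in_W[OF assms(2)]
  by (intro continuous_on_compose2[OF assms(1)] continuous_intros) auto

lemma potential_has_derivative:
  assumes "t \<in> I" "x \<in> \<Omega> t"
  shows "(\<Phi> t has_derivative (\<lambda>v. G (t, x) \<bullet> v)) (at x)"
proof -
  interpret radial_domain "h t" "\<Omega> t" by (rule radial_domain[OF assms(1)])
  have "(\<Phi> t has_derivative (\<lambda>v. dg (t, x) (0, v))) (at x)"
    by (rule has_derivative_transform_within_open[OF has_derivative_slice[OF g domain_in_W[OF assms]] open_domain assms(2)])
      (metis \<Phi>_eq assms(1) closure_subset subsetD)
  then have "(\<Phi> t has_derivative (\<lambda>v. grad_on (closure (\<Omega> t)) (\<Phi> t) x \<bullet> v)) (at x within closure (\<Omega> t))"
    by (intro grad_on_has_derivative) (simp add: at_within_closure_domain[OF assms(2)] differentiableI)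
  then show ?thesis
    using assms closure_subset grad_eq by (metis at_within_closure_domain subsetD)
qed

text \<open>Inside, \<open>g\<close> coincides with the potential on an open set. At a boundary
  point its two-sided derivative also sees values outside, and the identity is reached only through
  continuity of both sides.\<close>

lemma dg_space:
  assumes "t \<in> I" "x \<in> closure (\<Omega> t)"
  shows "dg (t, x) (0, v) = G (t, x) \<bullet> v"
proof (rule eq_on_closureI[OF _ _ _ assms(2)])
  show "continuous_on (closure (\<Omega> t)) (\<lambda>x. dg (t, x) (0, v))"
    using continuous_on_slice[OF Ck_1D(2)[OF g] assms(1)] .
  show "continuous_on (closure (\<Omega> t)) (\<lambda>x. G (t, x) \<bullet> v)"
    by (intro continuous_intros continuous_on_slice[OF Ck_1_imp_continuous_on[OF G] assms(1)])
  interpret radial_domain "h t" "\<Omega> t" by (rule radial_domain[OF assms(1)])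
  fix y assume y: "y \<in> \<Omega> t"
  have "((\<lambda>y. g (t, y)) has_derivative (\<lambda>v. G (t, y) \<bullet> v)) (at y)"
    by (rule has_derivative_transform_within_open[OF potential_has_derivative[OF assms(1) y] open_domain y])
      (metis \<Phi>_eq assms(1) closure_subset subsetD)
  then show "dg (t, y) (0, v) = G (t, y) \<bullet> v"
    using fun_cong[OF has_derivative_unique[OF has_derivative_slice[OF g domain_in_W[OF assms(1) y]]]] by simp
qed

lemma slice_derivative:
  "(t, x) \<in> W \<Longrightarrow> frechet_derivative (\<lambda>y. G (t, y)) (at x) = (\<lambda>v. dG (t, x) (0, v))"
  using frechet_derivative_at[OF has_derivative_slice[OF G]] by simp

lemma slice_Ck_1: "t \<in> I \<Longrightarrow> Ck 1 (\<Omega> t) (\<lambda>y. G (t, y))"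
  using domain_in_W
  by (intro Ck_1I[where f' = "\<lambda>x v. dG (t, x) (0, v)"] has_derivative_slice[OF G]
      continuous_on_compose2[OF Ck_1D(2)[OF G]] continuous_intros) auto

lemma dG_symmetric:
  assumes "t \<in> I" "x \<in> \<Omega> t"
  shows "dG (t, x) (0, v) \<bullet> w = dG (t, x) (0, w) \<bullet> v"
  using gradient_derivative_symmetric[OF radial_domain.open_domain[OF radial_domain[OF assms(1)]]
      potential_has_derivative[OF assms(1)] slice_Ck_1[OF assms(1)] assms(2), of v w]
  by (simp add: slice_derivative[OF domain_in_W[OF assms]])

lemma dG_trace:
  assumes "t \<in> I" "x \<in> \<Omega> t"
  shows "dG (t, x) (0, axis 1 1) $ 1 + dG (t, x) (0, axis 2 1) $ 2 = 0"
  using laplacian_eq_gradient[OF radial_domain.open_domain[OF radial_domain[OF assms(1)]] assms(2)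
      potential_has_derivative[OF assms(1)] has_derivative_slice[OF G domain_in_W[OF assms]]]
    harmonic[OF assms(1)] assms(2) by (simp add: harmonic_on_def sum_2)

lemma linear_dG: "(t, x) \<in> W \<Longrightarrow> linear (\<lambda>v. dG (t, x) (0, v))"
  using has_derivative_slice[OF G] has_derivative_linear by blast

text \<open>Exchange of time derivative and gradient. The time derivative of \<open>g\<close> is
  only known to be continuous, whereas \<open>G\<close> is C^1; \<open>mixed_derivative\<close>,
  with the inclusion of space for \<open>P\<close> and the time direction \<open>(1, 0)\<close> for
  \<open>w\<close>, supplies the missing derivative.\<close>

lemma time_derivative_has_derivative:
  assumes "t \<in> I" "x \<in> \<Omega> t"
  shows "((\<lambda>y. dg (t, y) (1, 0)) has_derivative (\<lambda>v. dG (t, x) (1, 0) \<bullet> v)) (at x)"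
proof -
  have "((\<lambda>v. dg ((t, x) + (0, v)) (1, 0)) has_derivative (\<lambda>v. dG (t, x) (1, 0) \<bullet> v)) (at 0)"
  proof (rule mixed_derivative[OF open_spacetime, where G = G])
    show "(g has_derivative dg z) (at z)" "(G has_derivative dG z) (at z)" if "z \<in> Sigma I \<Omega>" for z
      using that spacetime_in_W Ck_1D(1)[OF g] Ck_1D(1)[OF G] by auto
    show "continuous_on (Sigma I \<Omega>) (\<lambda>z. dG z (1, 0))"
      by (rule continuous_on_subset[OF Ck_1D(2)[OF G] spacetime_in_W])
    show "dg z (0, v) = G z \<bullet> v" if "z \<in> Sigma I \<Omega>" for z v
      using that dg_space closure_subset by fastforce
  qed (use assms in \<open>auto intro!: bounded_linear_Pair bounded_linear_ident bounded_linear_zero\<close>)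
  then have *: "((\<lambda>v. dg (t, x + v) (1, 0)) has_derivative (\<lambda>v. dG (t, x) (1, 0) \<bullet> v)) (at 0)" by simp
  have "((\<lambda>y. y - x) has_derivative (\<lambda>v. v)) (at x)" by (auto intro!: derivative_eq_intros)
  from has_derivative_along[OF this _ *] show ?thesis by simp
qed

text \<open>The harmonic conjugate that vanishes at the origin, so that \<open>\<kappa>\<close> is
  exactly the constant by which \<open>harmonic_conj\<close> differs from it. The explicit integral
  makes it continuous in time, which choosing a conjugate separately at each time would not
  show.\<close>

definition conj_primitive :: "real \<Rightarrow> real^2 \<Rightarrow> real"
  where "conj_primitive t x = integral {0..1} (\<lambda>s. (Jmat *v G (t, s *\<^sub>R x)) \<bullet> x)"

lemma rotated_gradient_Ck_1: "Ck 1 S G \<Longrightarrow> Ck 1 S (\<lambda>z. Jmat *v G z)"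
  by (rule Ck_1_compose[OF _ Ck_1_bounded_linear[OF bounded_linear_Jmat], of _ _ UNIV]) auto

lemma continuous_on_conj_primitive:
  "continuous_on (closed_spacetime I \<Omega>) (\<lambda>z. conj_primitive (fst z) (snd z))"
  unfolding conj_primitive_def
proof (rule continuous_on_subset[OF Ck_1_imp_continuous_on[OF radial_primitive_Ck_1[OF open_W rotated_gradient_Ck_1[OF G]]]])
  show "closed_spacetime I \<Omega> \<subseteq> {(t, x). \<forall>s\<in>{0..1}. (t, s *\<^sub>R x) \<in> W}"
    using closure_in_W radial_domain.scaleR_in_closure[OF radial_domain]
    by (auto simp: closed_spacetime_def)
qed

text \<open>The rotated gradient has a symmetric Jacobian because the trace of the Hessian vanishes:
  harmonicity of the potential is the integrability condition for its conjugate.\<close>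

lemma conj_primitive_has_derivative:
  assumes "t \<in> I" "x \<in> \<Omega> t"
  shows "(conj_primitive t has_derivative (\<lambda>v. (Jmat *v G (t, x)) \<bullet> v)) (at x)"
  unfolding conj_primitive_def[abs_def]
proof (rule radial_primitive_has_derivative[where S = "\<Omega> t" and X = "\<lambda>y. Jmat *v G (t, y)"])
  interpret radial_domain "h t" "\<Omega> t" by (rule radial_domain[OF assms(1)])
  show "open (\<Omega> t)" by (rule open_domain)
  show "s *\<^sub>R y \<in> \<Omega> t" if "y \<in> \<Omega> t" "0 \<le> s" "s \<le> 1" for y s
    using scaleR_in_domain[of y s] that closure_subset by (cases "s = 1") auto
  show "Ck 1 (\<Omega> t) (\<lambda>y. Jmat *v G (t, y))"
    by (rule Ck_1_compose[OF slice_Ck_1[OF assms(1)] Ck_1_bounded_linear[OF bounded_linear_Jmat], of UNIV]) auto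
  show "x \<in> \<Omega> t" by fact
  show "frechet_derivative (\<lambda>y. Jmat *v G (t, y)) (at y) v \<bullet> w =
      frechet_derivative (\<lambda>y. Jmat *v G (t, y)) (at y) w \<bullet> v" if y: "y \<in> \<Omega> t" for y v w
  proof -
    let ?L = "\<lambda>v. dG (t, y) (0, v)"
    have "((\<lambda>y. Jmat *v G (t, y)) has_derivative (\<lambda>v. Jmat *v ?L v)) (at y)"
      by (rule bounded_linear.has_derivative[OF bounded_linear_Jmat has_derivative_slice[OF G domain_in_W[OF assms(1) y]]])
    then have eq: "frechet_derivative (\<lambda>y. Jmat *v G (t, y)) (at y) = (\<lambda>v. Jmat *v ?L v)"
      by (rule frechet_derivative_at[symmetric])
    show ?thesis
      unfolding eq
    proof (rule linear_symmetric_real2)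
      show "linear (\<lambda>v. Jmat *v ?L v)"
        using linear_compose[OF linear_dG[OF domain_in_W[OF assms(1) y]] bounded_linear.linear[OF bounded_linear_Jmat]]
        by (simp add: o_def)
      show "(Jmat *v ?L (axis 1 1)) $ 2 = (Jmat *v ?L (axis 2 1)) $ 1"
        using dG_trace[OF assms(1) y] by simp
    qed
  qed
qed

lemma conj_primitive_zero: "conj_primitive t 0 = 0"
  by (simp add: conj_primitive_def)

section \<open>Identification of the chosen harmonic extension and conjugate\<close>

lemma is_harmonic_ext_potential:
  assumes "t \<in> I" "\<forall>x\<in>circ. \<Phi> t (bdry_param (h t) x) = \<psi> x"
  shows "is_harmonic_ext (enclosed (h t)) (h t) \<psi> (\<Phi> t)"
proof -
  interpret radial_domain "h t" "\<Omega> t" by (rule radial_domain[OF assms(1)])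
  have "continuous_on (closure (\<Omega> t)) (\<Phi> t)"
    using continuous_on_slice[OF Ck_1_imp_continuous_on[OF g] assms(1)]
    by (rule continuous_on_eq) (simp add: \<Phi>_eq[OF assms(1)])
  then show ?thesis
    using harmonic[OF assms(1)] assms(2) by (simp add: is_harmonic_ext_def enclosed_eq)
qed

text \<open>The given potential shows that the choice in \<open>harmonic_ext\<close> is possible,
  and comparison in both directions forces the chosen function to agree with it on the
  closure.\<close>

lemma harmonic_ext_eq:
  assumes "t \<in> I" "\<forall>x\<in>circ. \<Phi> t (bdry_param (h t) x) = \<psi> x" "y \<in> closure (\<Omega> t)"
  shows "harmonic_ext (h t) \<psi> y = \<Phi> t y"
proof -
  interpret radial_domain "h t" "\<Omega> t" by (rule radial_domain[OF assms(1)])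
  have 1: "is_harmonic_ext (\<Omega> t) (h t) \<psi> (\<Phi> t)"
    using is_harmonic_ext_potential[OF assms(1,2)] by (simp add: enclosed_eq)
  have 2: "is_harmonic_ext (\<Omega> t) (h t) \<psi> (harmonic_ext (h t) \<psi>)"
    unfolding harmonic_ext_def enclosed_eq by (rule someI[of "is_harmonic_ext (\<Omega> t) (h t) \<psi>", OF 1])
  have fr: "harmonic_ext (h t) \<psi> y = \<Phi> t y" if "y \<in> frontier (\<Omega> t)" for y
    using that 1 2 by (auto simp: is_harmonic_ext_def frontier_domain)
  note 1 = 1[unfolded is_harmonic_ext_def] and 2 = 2[unfolded is_harmonic_ext_def]
  have "harmonic_ext (h t) \<psi> y \<le> \<Phi> t y"
    by (rule harmonic_comparison[OF open_domain bounded_domain _ _ _ _ _ assms(3)]) (use 1 2 fr in simp_all)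
  moreover have "\<Phi> t y \<le> harmonic_ext (h t) \<psi> y"
    by (rule harmonic_comparison[OF open_domain bounded_domain _ _ _ _ _ assms(3)]) (use 1 2 fr in simp_all)
  ultimately show ?thesis by simp
qed

text \<open>The chosen extension is determined on the closure only. This suffices, since the
  gradient within the closure sees no other values.\<close>

lemma DN_eq:
  assumes "t \<in> I" "\<forall>x\<in>circ. \<Phi> t (bdry_param (h t) x) = \<psi> x" "x \<in> circ"
  shows "DN (h t) \<psi> x = G (t, bdry_param (h t) x) \<bullet> outer_normal (\<Omega> t) (bdry_param (h t) x)"
proof -
  interpret radial_domain "h t" "\<Omega> t" by (rule radial_domain[OF assms(1)])
  note c = bdry_param_in_closure[OF assms(3)]
  have "grad_on (closure (\<Omega> t)) (harmonic_ext (h t) \<psi>) (bdry_param (h t) x)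
      = grad_on (closure (\<Omega> t)) (\<Phi> t) (bdry_param (h t) x)"
    unfolding grad_on_def
    using frechet_derivative_within_cong[OF c harmonic_ext_eq[OF assms(1,2)]] by simp
  then show ?thesis
    by (simp add: DN_def enclosed_eq grad_eq[OF assms(1) c])
qed

text \<open>\<open>conj_primitive\<close> shifted by \<open>\<kappa>\<close> witnesses the choice.
  Its difference to the chosen function has zero derivative on a connected domain and vanishes at
  the origin.\<close>

lemma harmonic_conj_eq:
  assumes t: "t \<in> I" and \<psi>: "\<forall>x\<in>circ. \<Phi> t (bdry_param (h t) x) = \<psi> x"
    and y: "y \<in> closure (\<Omega> t)"
  shows "harmonic_conj \<kappa> (h t) \<psi> y = \<kappa> (h t) \<psi> + conj_primitive t y"
proof -
  interpret radial_domain "h t" "\<Omega> t" by (rule radial_domain[OF t])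
  have gr: "grad (harmonic_ext (h t) \<psi>) x = G (t, x)" if "x \<in> \<Omega> t" for x
  proof (rule grad_eqI, rule has_derivative_transform_within_open[OF potential_has_derivative[OF t that] open_domain that])
    show "\<Phi> t x = harmonic_ext (h t) \<psi> x" if "x \<in> \<Omega> t" for x
      using harmonic_ext_eq[OF t \<psi>] that closure_subset by (metis subsetD)
  qed
  define P where "P = (\<lambda>\<Psi>. continuous_on (closure (enclosed (h t))) \<Psi> \<and>
    (\<forall>y\<in>enclosed (h t).
       (\<Psi> has_derivative (\<lambda>v. (Jmat *v grad (harmonic_ext (h t) \<psi>) y) \<bullet> v)) (at y)) \<and>
    \<Psi> 0 = \<kappa> (h t) \<psi>)"
  have P: "P \<Psi> \<longleftrightarrow> continuous_on (closure (\<Omega> t)) \<Psi> \<and>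
      (\<forall>x\<in>\<Omega> t. (\<Psi> has_derivative (\<lambda>v. (Jmat *v G (t, x)) \<bullet> v)) (at x)) \<and> \<Psi> 0 = \<kappa> (h t) \<psi>" for \<Psi>
    unfolding P_def enclosed_eq using gr by simp
  let ?F = "\<lambda>y. \<kappa> (h t) \<psi> + conj_primitive t y"
  have cF: "continuous_on (closure (\<Omega> t)) (conj_primitive t)"
    using continuous_on_compose2[OF continuous_on_conj_primitive, of "closure (\<Omega> t)" "\<lambda>y. (t, y)"] t
    by (force simp: closed_spacetime_def intro!: continuous_intros)
  have F: "P ?F"
    unfolding P using conj_primitive_has_derivative[OF t]
    by (auto intro!: continuous_intros cF derivative_eq_intros simp: conj_primitive_zero)
  have H: "P (harmonic_conj \<kappa> (h t) \<psi>)"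
    unfolding harmonic_conj_def P_def[symmetric] by (rule someI[of P, OF F])
  show ?thesis
  proof (rule eq_on_closureI[OF _ _ _ y])
    fix x assume x: "x \<in> \<Omega> t"
    have "harmonic_conj \<kappa> (h t) \<psi> x - ?F x = harmonic_conj \<kappa> (h t) \<psi> 0 - ?F 0"
    proof (rule has_derivative_zero_unique_connected[OF open_domain connected_domain _ x zero_in_domain])
      fix z assume "z \<in> \<Omega> t"
      then show "((\<lambda>x. harmonic_conj \<kappa> (h t) \<psi> x - ?F x) has_derivative (\<lambda>x. 0)) (at z)"
        using F H has_derivative_diff unfolding P by fastforce
    qed
    then show "harmonic_conj \<kappa> (h t) \<psi> x = ?F x" using F H unfolding P by simp
  qed (use F H P in blast)+
qed

text \<open>The negative of the pressure given by Bernoulli's law, with \<open>k\<close> the value of the harmonic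
  conjugate at the origin.\<close>

definition bernoulli :: "real \<Rightarrow> real \<Rightarrow> real \<Rightarrow> real^2 \<Rightarrow> real"
  where "bernoulli \<alpha> k t x = dg (t, x) (1, 0) + 1 / 2 * (G (t, x) \<bullet> G (t, x))
    - \<alpha> / 2 * (G (t, x) \<bullet> (Jmat *v x)) - \<alpha>\<^sup>2 / 8 * (x \<bullet> x) - \<alpha> * (k + conj_primitive t x)"

lemma continuous_on_bernoulli:
  assumes "continuous_on I k"
  shows "continuous_on (closed_spacetime I \<Omega>) (\<lambda>z. bernoulli \<alpha> (k (fst z)) (fst z) (snd z))"
proof -
  note cg = continuous_on_subset[OF Ck_1D(2)[OF g] W] and cG = continuous_on_subset[OF Ck_1_imp_continuous_on[OF G] W]
  have "continuous_on (closed_spacetime I \<Omega>) (\<lambda>z. k (fst z))"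
    by (rule continuous_on_compose2[OF assms]) (auto simp: closed_spacetime_def intro!: continuous_intros)
  then show ?thesis
    unfolding bernoulli_def prod.collapse
    by (intro continuous_intros cg cG continuous_on_conj_primitive
        bounded_linear.continuous_on[OF bounded_linear_Jmat])
qed

text \<open>The gradient is the acceleration of the flow with velocity \<open>U\<close>. Symmetry of
  the Hessian collects the terms with spatial \<open>dG\<close> into its action on \<open>U\<close>.
  Half of the conjugate term is cancelled by the derivative of the factor \<open>Jmat *v x\<close>;
  the other half and the quadratic term form
  \<open>- (\<alpha> / 2) *\<^sub>R (Jmat *v U)\<close>.\<close>

lemma bernoulli_has_derivative:
  assumes t: "t \<in> I" and x: "x \<in> \<Omega> t" and U: "U = G (t, x) - (\<alpha> / 2) *\<^sub>R (Jmat *v x)"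
  shows "(bernoulli \<alpha> k t has_derivative
    (\<lambda>v. (dG (t, x) (1, 0) + (dG (t, x) (0, U) - (\<alpha> / 2) *\<^sub>R (Jmat *v U))) \<bullet> v)) (at x)"
proof -
  let ?G = "G (t, x)" and ?L = "\<lambda>v. dG (t, x) (0, v)"
  note dx = has_derivative_slice[OF G domain_in_W[OF t x]]
  have J: "((\<lambda>x. Jmat *v x) has_derivative (\<lambda>v. Jmat *v v)) (at x)"
    by (rule bounded_linear.has_derivative[OF bounded_linear_Jmat has_derivative_ident])
  have "(bernoulli \<alpha> k t has_derivative (\<lambda>v. dG (t, x) (1, 0) \<bullet> v + 1 / 2 * (?G \<bullet> ?L v + ?L v \<bullet> ?G)
      - \<alpha> / 2 * (?G \<bullet> (Jmat *v v) + ?L v \<bullet> (Jmat *v x)) - \<alpha>\<^sup>2 / 8 * (x \<bullet> v + v \<bullet> x)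
      - \<alpha> * (0 + (Jmat *v ?G) \<bullet> v))) (at x)"
    unfolding bernoulli_def[abs_def]
    by (intro has_derivative_diff has_derivative_add has_derivative_mult_right
        has_derivative_inner time_derivative_has_derivative[OF t x] dx J has_derivative_ident
        has_derivative_const conj_primitive_has_derivative[OF t x])
  moreover have "dG (t, x) (1, 0) \<bullet> v + 1 / 2 * (?G \<bullet> ?L v + ?L v \<bullet> ?G)
      - \<alpha> / 2 * (?G \<bullet> (Jmat *v v) + ?L v \<bullet> (Jmat *v x)) - \<alpha>\<^sup>2 / 8 * (x \<bullet> v + v \<bullet> x)
      - \<alpha> * (0 + (Jmat *v ?G) \<bullet> v)
      = (dG (t, x) (1, 0) + (?L U - (\<alpha> / 2) *\<^sub>R (Jmat *v U))) \<bullet> v" for v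
  proof -
    have "?L U \<bullet> v = ?L v \<bullet> U" by (rule dG_symmetric[OF t x])
    also have "\<dots> = ?L v \<bullet> ?G - \<alpha> / 2 * (?L v \<bullet> (Jmat *v x))"
      by (simp add: U inner_diff_right)
    finally have 1: "?L U \<bullet> v = ?L v \<bullet> ?G - \<alpha> / 2 * (?L v \<bullet> (Jmat *v x))" .
    have "Jmat *v U = Jmat *v ?G + (\<alpha> / 2) *\<^sub>R x"
      by (simp add: U vec_eq_iff forall_2)
    then have 2: "(Jmat *v U) \<bullet> v = (Jmat *v ?G) \<bullet> v + \<alpha> / 2 * (x \<bullet> v)"
      by (simp add: inner_add_left)
    have 3: "?G \<bullet> (Jmat *v v) = - ((Jmat *v ?G) \<bullet> v)" by (simp add: inner_Jmat_left)
    show ?thesis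
      by (simp add: inner_add_left inner_diff_left 1 2 3 inner_commute[of v x] inner_commute[of ?G "?L v"]
          power2_eq_square algebra_simps)
  qed
  ultimately show ?thesis by simp
qed

section \<open>Kinematics of the flow and the Euler equation\<close>

lemma rotating_velocity_eq:
  "t \<in> I \<Longrightarrow> x \<in> closure (\<Omega> t) \<Longrightarrow>
    rotating_velocity \<alpha> \<Omega> \<Phi> t x = G (t, x) - (\<alpha> / 2) *\<^sub>R (Jmat *v x)"
  by (simp add: rotating_velocity_def grad_eq)

lemma is_interior_velocity:
  assumes "\<forall>s\<in>I. \<forall>y\<in>closure (\<Omega> s). u s y = rotating_velocity \<alpha> \<Omega> \<Phi> s y"
    and "t \<in> I" "x \<in> \<Omega> t"
  shows "u t x = G (t, x) - (\<alpha> / 2) *\<^sub>R (Jmat *v x)"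
  using assms subsetD[OF closure_subset assms(3)] by (simp add: rotating_velocity_eq)

lemma velocity_has_derivative:
  assumes u: "\<forall>s\<in>I. \<forall>y\<in>closure (\<Omega> s). u s y = rotating_velocity \<alpha> \<Omega> \<Phi> s y"
    and t: "t \<in> I" and x: "x \<in> \<Omega> t"
  shows "(u t has_derivative (\<lambda>v. dG (t, x) (0, v) - (\<alpha> / 2) *\<^sub>R (Jmat *v v))) (at x)"
proof -
  interpret radial_domain "h t" "\<Omega> t" by (rule radial_domain[OF t])
  have "((\<lambda>x. G (t, x) - (\<alpha> / 2) *\<^sub>R (Jmat *v x)) has_derivative
      (\<lambda>v. dG (t, x) (0, v) - (\<alpha> / 2) *\<^sub>R (Jmat *v v))) (at x)"
    by (intro has_derivative_diff has_derivative_slice[OF G domain_in_W[OF t x]] has_derivative_scaleR_right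
        bounded_linear.has_derivative[OF bounded_linear_Jmat has_derivative_ident])
  then show ?thesis
    by (rule has_derivative_transform_within_open[OF _ open_domain x])
      (rule is_interior_velocity[OF u t, symmetric])
qed

lemma velocity_vector_derivative:
  assumes u: "\<forall>s\<in>I. \<forall>y\<in>closure (\<Omega> s). u s y = rotating_velocity \<alpha> \<Omega> \<Phi> s y"
    and t: "t \<in> I" and x: "x \<in> \<Omega> t"
  shows "vector_derivative (\<lambda>s. u s x) (at t) = dG (t, x) (1, 0)"
proof -
  have W: "(t, x) \<in> W" by (rule domain_in_W[OF t x])
  have "((\<lambda>s. (s, x)) has_derivative (\<lambda>c. (c, 0))) (at t)"
    by (auto intro!: derivative_eq_intros)
  from has_derivative_along[OF this refl Ck_1D(1)[OF G W]]
  have "((\<lambda>s. G (s, x) - (\<alpha> / 2) *\<^sub>R (Jmat *v x)) has_derivative (\<lambda>c. dG (t, x) (c, 0) - 0)) (at t)"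
    by (intro has_derivative_diff has_derivative_const)
  moreover have "dG (t, x) (c, 0) - 0 = c *\<^sub>R dG (t, x) (1, 0)" for c
    using linear_cmul[OF has_derivative_linear[OF Ck_1D(1)[OF G W]], of c "(1, 0)"] by simp
  ultimately have *: "((\<lambda>s. G (s, x) - (\<alpha> / 2) *\<^sub>R (Jmat *v x)) has_derivative (\<lambda>c. c *\<^sub>R dG (t, x) (1, 0))) (at t)"
    by (simp only:)
  \<comment> \<open>A point of the domain at time \<open>t\<close> stays in the domain for nearby
    times because the space-time domain is open, so the formula for the velocity may be
    differentiated in time.\<close>
  have op: "open ((\<lambda>s. (s, x)) -` Sigma I \<Omega>)"
    by (rule open_vimage[OF open_spacetime]) (intro continuous_intros)
  have "((\<lambda>s. u s x) has_derivative (\<lambda>c. c *\<^sub>R dG (t, x) (1, 0))) (at t)"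
    by (rule has_derivative_transform_within_open[OF * op]) (use t x is_interior_velocity[OF u] in auto)
  then show ?thesis
    by (intro vector_derivative_at) (simp add: has_vector_derivative_def)
qed

lemma velocity_pd:
  assumes u: "\<forall>s\<in>I. \<forall>y\<in>closure (\<Omega> s). u s y = rotating_velocity \<alpha> \<Omega> \<Phi> s y"
    and t: "t \<in> I" and x: "x \<in> \<Omega> t"
  shows "pd j (u t) x = dG (t, x) (0, axis j 1) - (\<alpha> / 2) *\<^sub>R (Jmat *v axis j 1)"
    and "pd j (\<lambda>y. u t y $ i) x = (dG (t, x) (0, axis j 1) - (\<alpha> / 2) *\<^sub>R (Jmat *v axis j 1)) $ i"
  using pd_eqI[OF velocity_has_derivative[OF u t x]]
    pd_eqI[OF bounded_linear.has_derivative[OF bounded_linear_vec_nth velocity_has_derivative[OF u t x]]]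
  by simp_all

lemma velocity_divergence_curl:
  assumes u: "\<forall>s\<in>I. \<forall>y\<in>closure (\<Omega> s). u s y = rotating_velocity \<alpha> \<Omega> \<Phi> s y"
    and t: "t \<in> I" and x: "x \<in> \<Omega> t"
  shows "divergence (u t) x = 0" and "curl (u t) x = \<alpha>"
proof -
  show "divergence (u t) x = 0"
    using dG_trace[OF t x] by (simp add: divergence_def velocity_pd(2)[OF u t x] sum_2 axis_def)
  have "dG (t, x) (0, axis 1 1) $ 2 = dG (t, x) (0, axis 2 1) $ 1"
    using dG_symmetric[OF t x, of "axis 1 1" "axis 2 1"] by (simp add: inner_axis)
  then show "curl (u t) x = \<alpha>"
    by (simp add: curl_def velocity_pd(2)[OF u t x] axis_def)
qed

lemma material_derivative:
  assumes u: "\<forall>s\<in>I. \<forall>y\<in>closure (\<Omega> s). u s y = rotating_velocity \<alpha> \<Omega> \<Phi> s y"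
    and t: "t \<in> I" and x: "x \<in> \<Omega> t"
  shows "vector_derivative (\<lambda>s. u s x) (at t) + (\<Sum>j\<in>UNIV. (u t x $ j) *\<^sub>R pd j (u t) x) =
    dG (t, x) (1, 0) + (dG (t, x) (0, u t x) - (\<alpha> / 2) *\<^sub>R (Jmat *v u t x))"
  unfolding velocity_vector_derivative[OF u t x] velocity_pd(1)[OF u t x]
  by (subst linear_axis_sum[OF has_derivative_linear[OF velocity_has_derivative[OF u t x]]]) simp

lemma bernoulli_has_derivative_velocity:
  assumes u: "\<forall>s\<in>I. \<forall>y\<in>closure (\<Omega> s). u s y = rotating_velocity \<alpha> \<Omega> \<Phi> s y"
    and t: "t \<in> I" and x: "x \<in> \<Omega> t"
  shows "(bernoulli \<alpha> k t has_derivative (\<lambda>v.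
    (vector_derivative (\<lambda>s. u s x) (at t) + (\<Sum>j\<in>UNIV. (u t x $ j) *\<^sub>R pd j (u t) x)) \<bullet> v)) (at x)"
  unfolding material_derivative[OF u t x]
  by (rule bernoulli_has_derivative[OF t x is_interior_velocity[OF u t x]])

text \<open>The sum has zero gradient in the connected domain. The pressure is merely continuous up
  to the boundary, so boundary points are reached by continuity; the origin is a reference point
  common to all times.\<close>

lemma bernoulli_law:
  assumes u: "\<forall>s\<in>I. \<forall>y\<in>closure (\<Omega> s). u s y = rotating_velocity \<alpha> \<Omega> \<Phi> s y"
    and p: "continuous_on (closed_spacetime I \<Omega>) (\<lambda>(t, x). p t x)"
    and euler: "\<And>x. x \<in> \<Omega> t \<Longrightarrow> p t differentiable (at x) \<and>
      vector_derivative (\<lambda>s. u s x) (at t) + (\<Sum>j\<in>UNIV. (u t x $ j) *\<^sub>R pd j (u t) x) + grad (p t) x = 0"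
    and t: "t \<in> I" and x: "x \<in> closure (\<Omega> t)"
  shows "bernoulli \<alpha> k t x + p t x = bernoulli \<alpha> k t 0 + p t 0"
proof (rule eq_on_closureI[OF _ _ _ x])
  interpret radial_domain "h t" "\<Omega> t" by (rule radial_domain[OF t])
  have slice: "continuous_on (closure (\<Omega> t)) (\<lambda>y. f (t, y))"
    if "continuous_on (closed_spacetime I \<Omega>) f" for f :: "real \<times> (real^2) \<Rightarrow> real"
    by (rule continuous_on_compose2[OF that]) (use t in \<open>auto simp: closed_spacetime_def intro!: continuous_intros\<close>)
  have "continuous_on (closure (\<Omega> t)) (bernoulli \<alpha> k t)"
    using slice[OF continuous_on_bernoulli[OF continuous_on_const]] by simp
  moreover have "continuous_on (closure (\<Omega> t)) (p t)"
    using slice[OF p] by simp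
  ultimately show "continuous_on (closure (\<Omega> t)) (\<lambda>x. bernoulli \<alpha> k t x + p t x)"
    by (intro continuous_intros)
  fix y assume y: "y \<in> \<Omega> t"
  show "bernoulli \<alpha> k t y + p t y = bernoulli \<alpha> k t 0 + p t 0"
  proof (rule has_derivative_zero_unique_connected[OF open_domain connected_domain _ y zero_in_domain])
    fix z assume z: "z \<in> \<Omega> t"
    let ?D = "vector_derivative (\<lambda>s. u s z) (at t) + (\<Sum>j\<in>UNIV. (u t z $ j) *\<^sub>R pd j (u t) z)"
    have "(p t has_derivative (\<lambda>v. grad (p t) z \<bullet> v)) (at z)"
      using euler[OF z] by (intro grad_on_has_derivative) simp
    from has_derivative_add[OF bernoulli_has_derivative_velocity[OF u t z] this]
    have "((\<lambda>x. bernoulli \<alpha> k t x + p t x) has_derivative (\<lambda>v. (?D + grad (p t) z) \<bullet> v)) (at z)"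
      by (simp add: inner_add_left)
    then show "((\<lambda>x. bernoulli \<alpha> k t x + p t x) has_derivative (\<lambda>v. 0)) (at z)"
      using euler[OF z] by simp
  qed
qed (rule continuous_on_const)

section \<open>Traces on the moving boundary and the two boundary conditions\<close>

lemma trace_Ck_1:
  assumes "\<forall>t\<in>I. \<forall>x\<in>circ. \<Phi> t (bdry_param (h t) x) = \<psi> t x"
  shows "Ck_time_circ 1 I \<psi>"
  unfolding Ck_time_circ_def
\<comment> \<open>The 0-homogeneous extension of the trace is \<open>g\<close> composed with the
  radial projection in space-time.\<close>
proof (rule Ck_1_cong[OF _ Ck_1_compose[OF spacetime_radial_proj_Ck_1 g]])
  have c: "radial_proj (h t) y \<in> closure (\<Omega> t)" if "t \<in> I" "y \<noteq> 0" for t y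
    using radial_domain.radial_proj_in_frontier[OF radial_domain[OF that(1)] that(2)] by (simp add: frontier_def)
  show "open (I \<times> (- {0::real^2}))" using open_I by (intro open_Times) auto
  show "(\<lambda>z. (fst z, radial_proj (h (fst z)) (snd z))) ` (I \<times> (- {0})) \<subseteq> W"
    by (intro image_subsetI closure_in_W c) auto
  show "g (fst z, radial_proj (h (fst z)) (snd z)) = (\<lambda>(t, y). hom_ext (\<psi> t) y) z"
    if zI: "z \<in> I \<times> (- {0})" for z
  proof -
    obtain t y where z: "z = (t, y)" "t \<in> I" "y \<noteq> 0" using zI by auto
    have "g (t, radial_proj (h t) y) = \<Phi> t (radial_proj (h t) y)"
      using \<Phi>_eq[OF z(2) c[OF z(2,3)]] by simp
    then show ?thesis
      using z assms by (simp add: radial_proj_eq hom_ext_def)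
  qed
qed

text \<open>Chain rule through \<open>radial_proj\<close>, where \<open>dg_space\<close> replaces
  the derivative of the extension by the gradient. The choice \<open>v = x\<close> gives 0, and
  \<open>v = Jmat *v x\<close> mixes the radial and the angular component of the gradient.\<close>

lemma trace_tgrad:
  assumes \<psi>: "\<forall>x\<in>circ. \<Phi> t (bdry_param (h t) x) = \<psi> x" and t: "t \<in> I" and x: "x \<in> circ"
  shows "tgrad \<psi> x \<bullet> v =
    G (t, bdry_param (h t) x) \<bullet> ((tgrad (h t) x \<bullet> v) *\<^sub>R x + (1 + h t x) *\<^sub>R (v - (x \<bullet> v) *\<^sub>R x))"
proof -
  interpret radial_domain "h t" "\<Omega> t" by (rule radial_domain[OF t])
  have x0: "x \<noteq> 0" and rx: "radial_proj (h t) x = bdry_param (h t) x"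
    using x by (auto simp: radial_proj_eq)
  note c = bdry_param_in_closure[OF x]
  let ?D = "\<lambda>v. G (t, bdry_param (h t) x) \<bullet> ((tgrad (h t) x \<bullet> v) *\<^sub>R x + (1 + h t x) *\<^sub>R (v - (x \<bullet> v) *\<^sub>R x))"
  have "((\<lambda>y. g (t, radial_proj (h t) y)) has_derivative ?D) (at x)"
    using has_derivative_along[OF radial_proj_has_derivative[OF x] rx has_derivative_slice[OF g closure_in_W[OF t c]]]
    unfolding dg_space[OF t c] .
  then have D: "(hom_ext \<psi> has_derivative ?D) (at x)"
  proof (rule has_derivative_transform_within_open)
    show "open (- {0 :: real^2})" by (rule open_Compl) simp
    show "x \<in> - {0}" using x0 by simp
    fix y :: "real^2" assume "y \<in> - {0}"
    then have "radial_proj (h t) y \<in> closure (\<Omega> t)" "y /\<^sub>R norm y \<in> circ"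
      using radial_proj_in_frontier[of y] by (auto simp: frontier_def)
    then show "g (t, radial_proj (h t) y) = hom_ext \<psi> y"
      using \<Phi>_eq[OF t, symmetric] \<psi> by (simp add: radial_proj_eq hom_ext_def)
  qed
  have "(hom_ext \<psi> has_derivative (\<lambda>v. tgrad \<psi> x \<bullet> v)) (at x)"
    unfolding tgrad_def by (rule grad_on_has_derivative) (rule differentiableI[OF D])
  from fun_cong[OF has_derivative_unique[OF this D], of v] show ?thesis .
qed

text \<open>The trace follows a boundary point that moves along its ray, which adds the radial
  component of the gradient times the speed of that point.\<close>

lemma trace_time_derivative:
  assumes \<psi>: "\<forall>t\<in>I. \<forall>x\<in>circ. \<Phi> t (bdry_param (h t) x) = \<psi> t x"
    and t: "t \<in> I" and x: "x \<in> circ"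
  shows "deriv (\<lambda>s. \<psi> s x) t = dg (t, bdry_param (h t) x) (1, 0)
    + (G (t, bdry_param (h t) x) \<bullet> x) * deriv (\<lambda>s. h s x) t"
proof -
  interpret radial_domain "h t" "\<Omega> t" by (rule radial_domain[OF t])
  let ?y = "bdry_param (h t) x" and ?d = "deriv (\<lambda>s. h s x) t"
  note c = bdry_param_in_closure[OF x] and W = closure_in_W[OF t bdry_param_in_closure[OF x]]
  have "((\<lambda>s. h s x) has_derivative (\<lambda>c. c * ?d)) (at t)"
    using radial_function_has_time_derivative[OF t x]
    by (simp add: has_field_derivative_def mult_commute_abs)
  then have "((\<lambda>s. (s, bdry_param (h s) x)) has_derivative (\<lambda>c. (c, (c * ?d) *\<^sub>R x))) (at t)"
    unfolding bdry_param_def by (auto intro!: derivative_eq_intros)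
  from has_derivative_along[OF this refl Ck_1D(1)[OF g W]]
  have "((\<lambda>s. g (s, bdry_param (h s) x)) has_derivative (\<lambda>c. dg (t, ?y) (c, (c * ?d) *\<^sub>R x))) (at t)" .
  moreover have "dg (t, ?y) (c, (c * ?d) *\<^sub>R x) = (dg (t, ?y) (1, 0) + (G (t, ?y) \<bullet> x) * ?d) * c" for c
  proof -
    have lin: "linear (dg (t, ?y))" by (rule has_derivative_linear[OF Ck_1D(1)[OF g W]])
    have "dg (t, ?y) (c *\<^sub>R (1, 0) + (0, (c * ?d) *\<^sub>R x)) = c * dg (t, ?y) (1, 0) + G (t, ?y) \<bullet> ((c * ?d) *\<^sub>R x)"
      by (simp only: linear_add[OF lin] linear_cmul[OF lin] dg_space[OF t c] real_scaleR_def)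
    then show ?thesis by (simp add: algebra_simps)
  qed
  ultimately have "((\<lambda>s. g (s, bdry_param (h s) x)) has_real_derivative
      dg (t, ?y) (1, 0) + (G (t, ?y) \<bullet> x) * ?d) (at t)"
    by (simp add: has_field_derivative_def)
  then have "((\<lambda>s. \<psi> s x) has_real_derivative dg (t, ?y) (1, 0) + (G (t, ?y) \<bullet> x) * ?d) (at t)"
  proof (rule has_field_derivative_transform_within_open[OF _ open_I t])
    fix s assume s: "s \<in> I"
    show "g (s, bdry_param (h s) x) = \<psi> s x"
      using \<Phi>_eq[OF s radial_domain.bdry_param_in_closure[OF radial_domain[OF s] x]] \<psi> s x by simp
  qed
  then show ?thesis by (rule DERIV_imp_deriv)
qed

lemma DN_frame:
  assumes \<psi>: "\<forall>x\<in>circ. \<Phi> t (bdry_param (h t) x) = \<psi> x" and t: "t \<in> I" and x: "x \<in> circ"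
  shows "DN (h t) \<psi> x = ((1 + h t x) * (G (t, bdry_param (h t) x) \<bullet> x)
    - (tgrad (h t) x \<bullet> (Jmat *v x)) * (G (t, bdry_param (h t) x) \<bullet> (Jmat *v x))) / Jac (h t) x"
proof -
  interpret radial_domain "h t" "\<Omega> t" by (rule radial_domain[OF t])
  have "norm x = 1" using x by simp
  from orthonormal_frame_inner[OF this, of "G (t, bdry_param (h t) x)" "tgrad (h t) x"]
  show ?thesis
    unfolding DN_eq[OF t \<psi> x] outer_normal_eq[OF x]
    by (simp add: inner_diff_right tgrad_inner_radial[OF x] divide_inverse mult.commute)
qed

text \<open>The rigid rotation enters through
  \<open>(Jmat *v y) \<bullet> \<nu> = - ((1 + h) / J) * Mop h\<close>, the origin of the transport
  term. Multiplication by the positive factor \<open>J / (1 + h)\<close> is reversible, hence the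
  equivalence.\<close>

lemma kinematic_condition_iff:
  assumes \<psi>: "\<forall>x\<in>circ. \<Phi> t (bdry_param (h t) x) = \<psi> x" and t: "t \<in> I" and x: "x \<in> circ"
  shows "normal_velocity h \<Omega> t x =
      rotating_velocity \<alpha> \<Omega> \<Phi> t (bdry_param (h t) x) \<bullet> outer_normal (\<Omega> t) (bdry_param (h t) x)
    \<longleftrightarrow> deriv (\<lambda>s. h s x) t = Jac (h t) x / (1 + h t x) * DN (h t) \<psi> x + \<alpha> / 2 * Mop (h t) x"
proof -
  interpret radial_domain "h t" "\<Omega> t" by (rule radial_domain[OF t])
  let ?A = "1 + h t x" and ?J = "Jac (h t) x" and ?y = "bdry_param (h t) x"
  have pos: "?A > 0" "?J > 0" using h_gt[OF x] Jac_pos[OF x] by auto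
  have "rotating_velocity \<alpha> \<Omega> \<Phi> t ?y \<bullet> outer_normal (\<Omega> t) ?y
      = DN (h t) \<psi> x - \<alpha> / 2 * ((Jmat *v ?y) \<bullet> outer_normal (\<Omega> t) ?y)"
    unfolding rotating_velocity_eq[OF t bdry_param_in_closure[OF x]] DN_eq[OF t \<psi> x]
    by (simp add: inner_diff_left)
  also have "(Jmat *v ?y) \<bullet> outer_normal (\<Omega> t) ?y = - (?A / ?J) * Mop (h t) x"
    unfolding outer_normal_eq[OF x]
    by (simp add: bdry_param_def Mop_def matrix_vector_mult_scaleR inner_diff_right
        inner_commute[of _ "tgrad (h t) x"] divide_inverse)
  finally have eq: "rotating_velocity \<alpha> \<Omega> \<Phi> t ?y \<bullet> outer_normal (\<Omega> t) ?y
      = DN (h t) \<psi> x - \<alpha> / 2 * (- (?A / ?J) * Mop (h t) x)" .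
  have "d * (A / J) = D - \<alpha> / 2 * (- (A / J) * M) \<longleftrightarrow> d = J / A * D + \<alpha> / 2 * M"
    if "A > 0" "J > 0" for d A J D M :: real
    using that by (auto simp: field_simps)
  from this[OF pos] show ?thesis
    unfolding normal_velocity_eq[OF t x] eq .
qed

text \<open>The kinematic equation serves to eliminate the time derivative of \<open>h\<close> from
  the derivative of the trace. What remains at the boundary point is algebra in the radius
  \<open>A\<close>, the angular derivative \<open>k\<close> of \<open>h\<close>, and the radial and
  angular components \<open>P\<close>, \<open>Q\<close> of the gradient.\<close>

lemma dynamic_condition_iff:
  assumes \<psi>: "\<forall>t\<in>I. \<forall>x\<in>circ. \<Phi> t (bdry_param (h t) x) = \<psi> t x"
    and t: "t \<in> I" and x: "x \<in> circ"
    and kin: "deriv (\<lambda>s. h s x) t = Jac (h t) x / (1 + h t x) * DN (h t) (\<psi> t) x + \<alpha> / 2 * Mop (h t) x"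
  shows "deriv (\<lambda>s. \<psi> s x) t =
        1 / 2 * (DN (h t) (\<psi> t) x
                 + (tgrad (\<psi> t) x \<bullet> tgrad (h t) x) / (Jac (h t) x * (1 + h t x)))\<^sup>2
        - (norm (tgrad (\<psi> t) x))\<^sup>2 / (2 * (1 + h t x)\<^sup>2)
        - \<sigma> * Hop (h t) x
        + \<alpha> / 2 * Mop (\<psi> t) x
        + \<alpha>\<^sup>2 / 8 * (1 + h t x)\<^sup>2
        + \<alpha> * Kop \<kappa> (h t) (\<psi> t) x
        + \<sigma> - \<alpha>\<^sup>2 / 8
    \<longleftrightarrow> bernoulli \<alpha> (\<kappa> (h t) (\<psi> t)) t (bdry_param (h t) x)
        + \<sigma> * bdry_curvature (\<Omega> t) (bdry_param (h t) x) = \<sigma> - \<alpha>\<^sup>2 / 8"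
proof -
  interpret radial_domain "h t" "\<Omega> t" by (rule radial_domain[OF t])
  define y where "y = bdry_param (h t) x"
  define A where "A = 1 + h t x"
  define J where "J = Jac (h t) x"
  define k where "k = tgrad (h t) x \<bullet> (Jmat *v x)"
  define P where "P = G (t, y) \<bullet> x"
  define Q where "Q = G (t, y) \<bullet> (Jmat *v x)"
  define K where "K = Kop \<kappa> (h t) (\<psi> t) x"
  define H where "H = Hop (h t) x"
  have pos: "A > 0" "J > 0" using h_gt[OF x] Jac_pos[OF x] by (auto simp: A_def J_def)
  have x1: "norm x = 1" using x by simp
  have th: "tgrad (h t) x \<bullet> x = 0" by (rule tgrad_inner_radial[OF x])
  have J2: "J\<^sup>2 = A\<^sup>2 + k\<^sup>2"
    using norm_sq_orthonormal_frame[OF x1, of "tgrad (h t) x"] Jac_sq[OF x] th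
    by (simp add: J_def A_def k_def)
  have DN: "DN (h t) (\<psi> t) x = (A * P - k * Q) / J"
    using DN_frame[OF bspec[OF \<psi> t] t x] by (simp add: A_def J_def k_def P_def Q_def y_def)
  note tg = trace_tgrad[OF bspec[OF \<psi> t] t x]
  have tx: "tgrad (\<psi> t) x \<bullet> x = 0"
    using x1 unfolding tg by (simp add: th norm_eq_1)
  have tJ: "tgrad (\<psi> t) x \<bullet> (Jmat *v x) = k * P + A * Q"
    unfolding tg by (simp add: inner_add_right k_def P_def A_def Q_def y_def)
  have tn: "(norm (tgrad (\<psi> t) x))\<^sup>2 = (k * P + A * Q)\<^sup>2"
    using norm_sq_orthonormal_frame[OF x1, of "tgrad (\<psi> t) x"] by (simp add: tx tJ)
  have tt: "tgrad (\<psi> t) x \<bullet> tgrad (h t) x = (k * P + A * Q) * k"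
    using orthonormal_frame_inner[OF x1, of "tgrad (\<psi> t) x" "tgrad (h t) x"] by (simp add: tx tJ th k_def)
  have hd: "deriv (\<lambda>s. h s x) t = (A * P - k * Q) / A + \<alpha> / 2 * k"
    using kin pos by (simp add: DN A_def[symmetric] J_def[symmetric] Mop_def k_def)
  have \<psi>d: "deriv (\<lambda>s. \<psi> s x) t = dg (t, y) (1, 0) + P * ((A * P - k * Q) / A + \<alpha> / 2 * k)"
    using trace_time_derivative[OF \<psi> t x] by (simp add: hd P_def y_def)
  have Kc: "K = \<kappa> (h t) (\<psi> t) + conj_primitive t y"
    using harmonic_conj_eq[OF t bspec[OF \<psi> t] bdry_param_in_closure[OF x]] by (simp add: K_def Kop_def y_def)
  have Hc: "H = bdry_curvature (\<Omega> t) y"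
    by (simp add: H_def Hop_def enclosed_eq y_def)
  have GG: "G (t, y) \<bullet> G (t, y) = P\<^sup>2 + Q\<^sup>2"
    using norm_sq_orthonormal_frame[OF x1, of "G (t, y)"] by (simp add: power2_norm_eq_inner P_def Q_def)
  have GJ: "G (t, y) \<bullet> (Jmat *v y) = A * Q"
    by (simp add: y_def bdry_param_def matrix_vector_mult_scaleR A_def Q_def)
  have yy: "y \<bullet> y = A\<^sup>2"
    using x1 by (simp add: y_def bdry_param_def A_def norm_eq_1 power2_eq_square)
  \<comment> \<open>In the bracket of the equation the angular component \<open>Q\<close> cancels,
    which leaves \<open>P * J / A\<close>.\<close>
  have sq: "((A * P - k * Q) / J + (k * P + A * Q) * k / (J * A))\<^sup>2 = P\<^sup>2 * (A\<^sup>2 + k\<^sup>2) / A\<^sup>2"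
  proof -
    have "(A * P - k * Q) / J + (k * P + A * Q) * k / (J * A) = P * (A\<^sup>2 + k\<^sup>2) / (J * A)"
      using pos by (simp add: field_simps power2_eq_square)
    also have "\<dots> = P * J / A"
      unfolding J2[symmetric] using pos by (simp add: field_simps power2_eq_square)
    finally show ?thesis
      by (simp add: power_mult_distrib power_divide J2)
  qed
  \<comment> \<open>The motion of the boundary point, the square and the tangential gradient combine
    to the kinetic energy of the potential part; in the terms with \<open>\<alpha>\<close> the
    contributions of \<open>k\<close> cancel.\<close>
  have key: "P * ((A * P - k * Q) / A + \<alpha> / 2 * k) - 1 / 2 * (P\<^sup>2 * (A\<^sup>2 + k\<^sup>2) / A\<^sup>2)
      + (k * P + A * Q)\<^sup>2 / (2 * A\<^sup>2) - \<alpha> / 2 * (k * P + A * Q) = 1 / 2 * (P\<^sup>2 + Q\<^sup>2) - \<alpha> / 2 * (A * Q)"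
    using pos by (simp add: field_simps power2_eq_square)
  have M: "Mop (\<psi> t) x = k * P + A * Q" by (simp add: Mop_def tJ)
  show ?thesis
    unfolding \<psi>d DN tt tn M sq bernoulli_def y_def[symmetric] A_def[symmetric] J_def[symmetric]
      K_def[symmetric] H_def[symmetric] Hc[symmetric] Kc[symmetric] GG GJ yy
    using key by linarith
qed

end

subsection \<open>Existence of velocity potentials\<close>

context drop
begin

lemma regular_potential_extension:
  assumes "regular_potential I \<Omega> \<Phi>" and "\<forall>t\<in>I. harmonic_on (\<Omega> t) (\<Phi> t)"
  obtains W g G where "drop_potential I h \<Omega> \<Phi> W g G"
proof -
  let ?D = "closed_spacetime I \<Omega>"
  obtain W1 g where g: "open W1" "?D \<subseteq> W1" "Ck 1 W1 g" "\<forall>z\<in>?D. (\<lambda>(t, x). \<Phi> t x) z = g z"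
    using assms(1) unfolding regular_potential_def C1_upto_def by blast
  obtain W2 G where G: "open W2" "?D \<subseteq> W2" "Ck 1 W2 G"
      "\<forall>z\<in>?D. (\<lambda>(t, x). grad_on (closure (\<Omega> t)) (\<Phi> t) x) z = G z"
    using assms(1) unfolding regular_potential_def C1_upto_def by blast
  have "drop_potential I h \<Omega> \<Phi> (W1 \<inter> W2) g G"
  proof
    show "Ck 1 (W1 \<inter> W2) g" "Ck 1 (W1 \<inter> W2) G"
      by (rule Ck_mono_set[OF g(3)] Ck_mono_set[OF G(3)]; blast)+
    show "\<Phi> t x = g (t, x)" "grad_on (closure (\<Omega> t)) (\<Phi> t) x = G (t, x)"
      if "t \<in> I" "x \<in> closure (\<Omega> t)" for t x
      using that bspec[OF g(4), of "(t, x)"] bspec[OF G(4), of "(t, x)"]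
      by (simp_all add: closed_spacetime_def)
  qed (use g G assms(2) in auto)
  then show thesis by (rule that)
qed

lemma velocity_potential_exists:
  assumes "C1_upto (closed_spacetime I \<Omega>) (\<lambda>(t, x). u t x)"
    and div: "\<And>t x. t \<in> I \<Longrightarrow> x \<in> \<Omega> t \<Longrightarrow> divergence (u t) x = 0"
    and curl: "\<And>t x. t \<in> I \<Longrightarrow> x \<in> \<Omega> t \<Longrightarrow> curl (u t) x = \<alpha>"
  shows "\<exists>\<Phi>. velocity_potential \<alpha> I \<Omega> u \<Phi>"
proof -
  let ?D = "closed_spacetime I \<Omega>"
  obtain W w where W: "open W" "?D \<subseteq> W" and w: "Ck 1 W w" and uw: "\<forall>z\<in>?D. (\<lambda>(t, x). u t x) z = w z"
    using assms(1) unfolding C1_upto_def by blast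
  \<comment> \<open>With the curl convention in use, \<open>Jmat *v x\<close> has curl -2 and
    divergence 0, so the added multiple cancels the vorticity \<open>\<alpha>\<close> and keeps the
    field divergence free.\<close>
  define G where "G = (\<lambda>z. w z + (\<alpha> / 2) *\<^sub>R (Jmat *v snd z))"
  have G: "Ck 1 W G"
    unfolding G_def
    by (intro Ck_1_add[OF w] Ck_1_scaleR[OF Ck_1_const] Ck_1_bounded_linear
        bounded_linear_compose[OF bounded_linear_Jmat bounded_linear_snd])
  have inD: "(t, x) \<in> ?D" if "t \<in> I" "x \<in> closure (\<Omega> t)" for t x
    using that by (simp add: closed_spacetime_def)
  have ueq: "u t x = w (t, x)" if "t \<in> I" "x \<in> closure (\<Omega> t)" for t x
    using bspec[OF uw inD[OF that]] by simp
  have inW: "(t, x) \<in> W" if "t \<in> I" "x \<in> \<Omega> t" for t x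
    using inD[OF that(1)] that(2) W(2) closure_subset by blast
  have slice: "((\<lambda>y. f (t, y)) has_derivative (\<lambda>v. frechet_derivative f (at (t, x)) (0, v))) (at x)"
    if f: "Ck 1 S f" "(t, x) \<in> S" for f :: "real \<times> (real^2) \<Rightarrow> 'z::real_normed_vector" and S t x
  proof -
    have "((\<lambda>y. (t, y)) has_derivative (\<lambda>v. (0, v))) (at x)"
      by (auto intro!: derivative_eq_intros)
    from has_derivative_along[OF this refl Ck_1D(1)[OF f]] show ?thesis .
  qed
  have Gs: "Ck 1 (\<Omega> t) (\<lambda>y. G (t, y))" if "t \<in> I" for t
    using inW[OF that]
    by (intro Ck_1I[where f' = "\<lambda>x v. frechet_derivative G (at (t, x)) (0, v)"] slice[OF G]
      continuous_on_compose2[OF Ck_1D(2)[OF G]] continuous_intros) auto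
  have dG: "frechet_derivative (\<lambda>y. G (t, y)) (at x) v =
      frechet_derivative w (at (t, x)) (0, v) + (\<alpha> / 2) *\<^sub>R (Jmat *v v)" if "t \<in> I" "x \<in> \<Omega> t" for t x v
  proof -
    have "((\<lambda>y. G (t, y)) has_derivative
        (\<lambda>v. frechet_derivative w (at (t, x)) (0, v) + (\<alpha> / 2) *\<^sub>R (Jmat *v v))) (at x)"
      unfolding G_def snd_conv
      by (intro has_derivative_add slice[OF w inW[OF that]] has_derivative_scaleR_right
          bounded_linear.has_derivative[OF bounded_linear_Jmat has_derivative_ident])
    from fun_cong[OF frechet_derivative_at[OF this], of v] show ?thesis by simp
  qed
  have upd: "pd i (\<lambda>y. u t y $ j) x = frechet_derivative w (at (t, x)) (0, axis i 1) $ j"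
    if "t \<in> I" "x \<in> \<Omega> t" for t x i j
  proof -
    have "((\<lambda>y. w (t, y) $ j) has_derivative (\<lambda>v. frechet_derivative w (at (t, x)) (0, v) $ j)) (at x)"
      by (rule bounded_linear.has_derivative[OF bounded_linear_vec_nth slice[OF w inW[OF that]]])
    then have "((\<lambda>y. u t y $ j) has_derivative (\<lambda>v. frechet_derivative w (at (t, x)) (0, v) $ j)) (at x)"
    proof (rule has_derivative_transform_within_open)
      show "open (\<Omega> t)" by (rule radial_domain.open_domain[OF radial_domain[OF that(1)]])
      show "w (t, y) $ j = u t y $ j" if "y \<in> \<Omega> t" for y
        using ueq[OF \<open>t \<in> I\<close>] that closure_subset by (metis subsetD)
    qed (rule that(2))
    then show ?thesis by (rule pd_eqI)
  qed
  define V where "V = {(t, x). \<forall>s\<in>{0..1}. (t, s *\<^sub>R x) \<in> W}"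
  define F where "F = (\<lambda>z. integral {0..1} (\<lambda>s. G (fst z, s *\<^sub>R snd z) \<bullet> snd z))"
  define \<Phi> where "\<Phi> = (\<lambda>t x. F (t, x))"
  have V: "open V" unfolding V_def by (rule open_segment_preimage[OF W(1)])
  have F: "Ck 1 V F" unfolding V_def F_def by (rule radial_primitive_Ck_1[OF W(1) G])
  have DV: "?D \<subseteq> V"
  proof clarify
    fix t x assume "(t, x) \<in> ?D"
    then have t: "t \<in> I" and x: "x \<in> closure (\<Omega> t)" by (auto simp: closed_spacetime_def)
    then have "(t, s *\<^sub>R x) \<in> W" if "s \<in> {0..1}" for s
      using radial_domain.scaleR_in_closure[OF radial_domain[OF t] x] that W(2) inD[OF t] by auto
    then show "(t, x) \<in> V" by (simp add: V_def)
  qed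
  have der: "(\<Phi> t has_derivative (\<lambda>v. G (t, x) \<bullet> v)) (at x)" if t: "t \<in> I" and x: "x \<in> \<Omega> t" for t x
    unfolding \<Phi>_def F_def fst_conv snd_conv
  proof (rule radial_primitive_has_derivative[where S = "\<Omega> t" and X = "\<lambda>y. G (t, y)"])
    interpret radial_domain "h t" "\<Omega> t" by (rule radial_domain[OF t])
    show "open (\<Omega> t)" by (rule open_domain)
    show "s *\<^sub>R y \<in> \<Omega> t" if "y \<in> \<Omega> t" "0 \<le> s" "s \<le> 1" for y s
      using scaleR_in_domain[of y s] that closure_subset by (cases "s = 1") auto
    show "Ck 1 (\<Omega> t) (\<lambda>y. G (t, y))" by (rule Gs[OF t])
    show "frechet_derivative (\<lambda>y. G (t, y)) (at y) v \<bullet> w = frechet_derivative (\<lambda>y. G (t, y)) (at y) w \<bullet> v"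
      if y: "y \<in> \<Omega> t" for y v w
    proof (rule linear_symmetric_real2)
      show "linear (frechet_derivative (\<lambda>y. G (t, y)) (at y))"
        using Ck_1D(1)[OF Gs[OF t] y] has_derivative_linear by blast
      show "frechet_derivative (\<lambda>y. G (t, y)) (at y) (axis 1 1) $ 2 =
          frechet_derivative (\<lambda>y. G (t, y)) (at y) (axis 2 1) $ 1"
        using curl[OF t y] by (simp add: curl_def upd[OF t y] dG[OF t y] axis_def)
    qed
  qed (rule x)
  \<comment> \<open>At boundary points \<open>F\<close> depends on an extension of the field that
    need not be curl free off the domain, so the formula is obtained there as a limit from
    inside.\<close>
  have dF: "frechet_derivative F (at (t, x)) (0, v) = G (t, x) \<bullet> v"
    if t: "t \<in> I" and x: "x \<in> closure (\<Omega> t)" for t x v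
  proof (rule eq_on_closureI[OF _ _ _ x])
    have slice_cont: "continuous_on (closure (\<Omega> t)) (\<lambda>y. f (t, y))"
      if "continuous_on S f" "?D \<subseteq> S" for f :: "real \<times> (real^2) \<Rightarrow> 'z::real_normed_vector" and S
      using that inD[OF t] by (intro continuous_on_compose2[OF that(1)] continuous_intros) auto
    show "continuous_on (closure (\<Omega> t)) (\<lambda>x. frechet_derivative F (at (t, x)) (0, v))"
      by (rule slice_cont[OF Ck_1D(2)[OF F] DV])
    show "continuous_on (closure (\<Omega> t)) (\<lambda>x. G (t, x) \<bullet> v)"
      by (intro continuous_intros slice_cont[OF Ck_1_imp_continuous_on[OF G] W(2)])
    fix y assume y: "y \<in> \<Omega> t"
    then have "(t, y) \<in> V" using DV inD[OF t] closure_subset by blast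
    from fun_cong[OF has_derivative_unique[OF slice[OF F this] der[OF t y, unfolded \<Phi>_def]]]
    show "frechet_derivative F (at (t, y)) (0, v) = G (t, y) \<bullet> v" .
  qed
  have grad: "grad_on (closure (\<Omega> t)) (\<Phi> t) x = G (t, x)" if t: "t \<in> I" and x: "x \<in> closure (\<Omega> t)" for t x
  proof (rule radial_domain.grad_on_closure_eqI[OF radial_domain[OF t] x])
    have "(t, x) \<in> V" using DV inD[OF t x] by blast
    from slice[OF F this] have "(\<Phi> t has_derivative (\<lambda>v. G (t, x) \<bullet> v)) (at x)"
      unfolding dF[OF t x] \<Phi>_def .
    then show "(\<Phi> t has_derivative (\<lambda>v. G (t, x) \<bullet> v)) (at x within closure (\<Omega> t))"
      by (rule has_derivative_at_withinI)
  qed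
  have harm: "harmonic_on (\<Omega> t) (\<Phi> t)" if t: "t \<in> I" for t
  proof (rule harmonic_onI[OF _ der[OF t] Gs[OF t]])
    show "open (\<Omega> t)" by (rule radial_domain.open_domain[OF radial_domain[OF t]])
    show "(\<Sum>i\<in>UNIV. frechet_derivative (\<lambda>y. G (t, y)) (at y) (axis i 1) $ i) = 0" if y: "y \<in> \<Omega> t" for y
      using div[OF t y] by (simp add: divergence_def upd[OF t y] dG[OF t y] sum_2 axis_def)
  qed
  have "regular_potential I \<Omega> \<Phi>"
    unfolding regular_potential_def C1_upto_def
  proof (intro conjI exI)
    show "\<forall>z\<in>?D. (\<lambda>(t, x). \<Phi> t x) z = F z" by (auto simp: \<Phi>_def)
    show "\<forall>z\<in>?D. (\<lambda>(t, x). grad_on (closure (\<Omega> t)) (\<Phi> t) x) z = G z"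
      using grad by (auto simp: closed_spacetime_def)
  qed (use V F DV W G in auto)
  moreover have "u t x = rotating_velocity \<alpha> \<Omega> \<Phi> t x" if "t \<in> I" "x \<in> closure (\<Omega> t)" for t x
    by (simp add: rotating_velocity_def grad[OF that] ueq[OF that] G_def)
  ultimately show ?thesis
    unfolding velocity_potential_def using harm by blast
qed

end

subsection \<open>Equivalence of the two problems\<close>

context drop_potential
begin

lemma regular_potential: "regular_potential I \<Omega> \<Phi>"
  unfolding regular_potential_def C1_upto_def
proof (intro conjI exI)
  show "\<forall>z\<in>closed_spacetime I \<Omega>. (\<lambda>(t, x). \<Phi> t x) z = g z"
    using \<Phi>_eq by (auto simp: closed_spacetime_def)
  show "\<forall>z\<in>closed_spacetime I \<Omega>. (\<lambda>(t, x). grad_on (closure (\<Omega> t)) (\<Phi> t) x) z = G z"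
    using grad_eq by (auto simp: closed_spacetime_def)
qed (use open_W W g G in auto)

text \<open>\<open>c\<close> is only known to be differentiable on \<open>I\<close>, hence the cut
  of the neighbourhood to times in \<open>I\<close>. The gradient, and with it \<open>G\<close>, is
  unchanged.\<close>

lemma add_function_of_time:
  assumes c: "\<And>t. t \<in> I \<Longrightarrow> (c has_real_derivative c' t) (at t)" and c': "continuous_on I c'"
  shows "drop_potential I h \<Omega> (\<lambda>t x. \<Phi> t x + c t) (W \<inter> I \<times> UNIV) (\<lambda>z. g z + c (fst z)) G"
proof
  show "open (W \<inter> I \<times> UNIV)" using open_W open_I by (intro open_Int open_Times) auto
  show "closed_spacetime I \<Omega> \<subseteq> W \<inter> I \<times> UNIV" using W by (auto simp: closed_spacetime_def)
  have "Ck 1 (W \<inter> I \<times> UNIV) (\<lambda>z. c (fst z))"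
  proof (rule Ck_1I[where f' = "\<lambda>z v. c' (fst z) * fst v"])
    show "((\<lambda>z. c (fst z)) has_derivative (\<lambda>v. c' (fst z) * fst v)) (at z)" if "z \<in> W \<inter> I \<times> UNIV" for z
      using has_derivative_along[OF has_derivative_fst[OF has_derivative_ident] refl
          c[unfolded has_field_derivative_def], of z] that by auto
    show "continuous_on (W \<inter> I \<times> UNIV) (\<lambda>z. c' (fst z) * fst v)" for v :: "real \<times> (real^2)"
      by (intro continuous_intros continuous_on_compose2[OF c']) auto
  qed
  then show "Ck 1 (W \<inter> I \<times> UNIV) (\<lambda>z. g z + c (fst z))"
    by (intro Ck_1_add Ck_mono_set[OF g]) auto
  show "Ck 1 (W \<inter> I \<times> UNIV) G" by (rule Ck_mono_set[OF G]) auto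
  show "grad_on (closure (\<Omega> t)) (\<lambda>x. \<Phi> t x + c t) x = G (t, x)" if "t \<in> I" "x \<in> closure (\<Omega> t)" for t x
    using grad_eq[OF that] by (simp add: grad_on_def frechet_derivative_add_const)
qed (simp_all add: \<Phi>_eq harmonic harmonic_on_add_const)

text \<open>The hypothesis \<open>const\<close> prescribes at the origin the function of time left
  open by Bernoulli's law. The law transports the value to the boundary, where the pressure is given
  by the curvature.\<close>

lemma circle_system_if_free_boundary:
  assumes fb: "free_boundary_solution \<sigma> \<alpha> I h \<Omega> u p"
    and u: "\<forall>s\<in>I. \<forall>y\<in>closure (\<Omega> s). u s y = rotating_velocity \<alpha> \<Omega> \<Phi> s y"
    and const: "\<And>t. t \<in> I \<Longrightarrow>
      bernoulli \<alpha> (\<kappa> (h t) (bdry_trace h \<Phi> t)) t 0 + p t 0 = \<sigma> - \<alpha>\<^sup>2 / 8"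
  shows "circle_system_solution \<kappa> \<sigma> \<alpha> I h (bdry_trace h \<Phi>)"
  unfolding circle_system_solution_def
proof (intro conjI ballI)
  have \<psi>: "\<forall>t\<in>I. \<forall>x\<in>circ. \<Phi> t (bdry_param (h t) x) = bdry_trace h \<Phi> t x"
    by (simp add: bdry_trace_def)
  show "Ck_time_circ 2 I h" by (rule h_Ck_2)
  show "Ck_time_circ 1 I (bdry_trace h \<Phi>)" by (rule trace_Ck_1[OF \<psi>])
  fix t x assume t: "t \<in> I" and x: "x \<in> circ"
  interpret radial_domain "h t" "\<Omega> t" by (rule radial_domain[OF t])
  note c = bdry_param_in_closure[OF x]
  have "normal_velocity h \<Omega> t x = u t (bdry_param (h t) x) \<bullet> outer_normal (\<Omega> t) (bdry_param (h t) x)"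
    using fb t x unfolding free_boundary_solution_def by blast
  also have "u t (bdry_param (h t) x) = rotating_velocity \<alpha> \<Omega> \<Phi> t (bdry_param (h t) x)"
    using u t c by blast
  finally show kin: "deriv (\<lambda>s. h s x) t = Jac (h t) x / (1 + h t x) * DN (h t) (bdry_trace h \<Phi> t) x
      + \<alpha> / 2 * Mop (h t) x"
    using kinematic_condition_iff[OF bspec[OF \<psi> t] t x] by blast
  have "bernoulli \<alpha> (\<kappa> (h t) (bdry_trace h \<Phi> t)) t (bdry_param (h t) x) + p t (bdry_param (h t) x)
      = \<sigma> - \<alpha>\<^sup>2 / 8"
    unfolding const[OF t, symmetric]
  proof (rule bernoulli_law[OF u _ _ t c])
    show "continuous_on (closed_spacetime I \<Omega>) (\<lambda>(t, x). p t x)"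
      using fb unfolding free_boundary_solution_def by blast
    show "p t differentiable (at x) \<and>
        vector_derivative (\<lambda>s. u s x) (at t) + (\<Sum>j\<in>UNIV. (u t x $ j) *\<^sub>R pd j (u t) x) + grad (p t) x = 0"
      if "x \<in> \<Omega> t" for x
      using fb t that unfolding free_boundary_solution_def by blast
  qed
  moreover have "p t (bdry_param (h t) x) = \<sigma> * bdry_curvature (\<Omega> t) (bdry_param (h t) x)"
    using fb t bdry_param_in_frontier[OF x] unfolding free_boundary_solution_def by blast
  ultimately have "bernoulli \<alpha> (\<kappa> (h t) (bdry_trace h \<Phi> t)) t (bdry_param (h t) x)
      + \<sigma> * bdry_curvature (\<Omega> t) (bdry_param (h t) x) = \<sigma> - \<alpha>\<^sup>2 / 8" by simp
  then show "deriv (\<lambda>s. bdry_trace h \<Phi> s x) t =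
        1 / 2 * (DN (h t) (bdry_trace h \<Phi> t) x
                 + (tgrad (bdry_trace h \<Phi> t) x \<bullet> tgrad (h t) x) / (Jac (h t) x * (1 + h t x)))\<^sup>2
        - (norm (tgrad (bdry_trace h \<Phi> t) x))\<^sup>2 / (2 * (1 + h t x)\<^sup>2)
        - \<sigma> * Hop (h t) x
        + \<alpha> / 2 * Mop (bdry_trace h \<Phi> t) x
        + \<alpha>\<^sup>2 / 8 * (1 + h t x)\<^sup>2
        + \<alpha> * Kop \<kappa> (h t) (bdry_trace h \<Phi> t) x
        + \<sigma> - \<alpha>\<^sup>2 / 8"
    using dynamic_condition_iff[OF \<psi> t x kin] by blast
qed

lemma free_boundary_if_circle_system:
  assumes sys: "circle_system_solution \<kappa> \<sigma> \<alpha> I h \<psi>"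
    and \<psi>: "\<forall>t\<in>I. \<forall>x\<in>circ. \<Phi> t (bdry_param (h t) x) = \<psi> t x"
    and \<kappa>: "continuous_on I (\<lambda>t. \<kappa> (h t) (\<psi> t))"
  shows "\<exists>p. free_boundary_solution \<sigma> \<alpha> I h \<Omega> (rotating_velocity \<alpha> \<Omega> \<Phi>) p"
proof -
  let ?u = "rotating_velocity \<alpha> \<Omega> \<Phi>"
  \<comment> \<open>Continuity of this pressure in time rests on that of \<open>\<kappa>\<close>
    along the solution, which is the hypothesis of the lemma.\<close>
  define p where "p = (\<lambda>t x. \<sigma> - \<alpha>\<^sup>2 / 8 - bernoulli \<alpha> (\<kappa> (h t) (\<psi> t)) t x)"
  have u: "\<forall>s\<in>I. \<forall>y\<in>closure (\<Omega> s). ?u s y = ?u s y" by simp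
  have "free_boundary_solution \<sigma> \<alpha> I h \<Omega> ?u p"
    unfolding free_boundary_solution_def
  proof (intro conjI ballI)
    have "Ck 1 W (\<lambda>z. G z + (- (\<alpha> / 2)) *\<^sub>R (Jmat *v snd z))"
      by (intro Ck_1_add[OF G] Ck_1_scaleR[OF Ck_1_const] Ck_1_bounded_linear
          bounded_linear_compose[OF bounded_linear_Jmat bounded_linear_snd])
    moreover have "\<forall>z\<in>closed_spacetime I \<Omega>. (\<lambda>(t, x). ?u t x) z = G z + (- (\<alpha> / 2)) *\<^sub>R (Jmat *v snd z)"
      by (auto simp: closed_spacetime_def rotating_velocity_eq)
    ultimately show "C1_upto (closed_spacetime I \<Omega>) (\<lambda>(t, x). ?u t x)"
      unfolding C1_upto_def using open_W W by blast
    show "continuous_on (closed_spacetime I \<Omega>) (\<lambda>(t, x). p t x)"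
      unfolding p_def case_prod_unfold
      by (intro continuous_intros continuous_on_bernoulli[OF \<kappa>])
  next
    fix t x assume t: "t \<in> I" and x: "x \<in> \<Omega> t"
    let ?D = "vector_derivative (\<lambda>s. ?u s x) (at t) + (\<Sum>j\<in>UNIV. (?u t x $ j) *\<^sub>R pd j (?u t) x)"
    from has_derivative_diff[OF has_derivative_const bernoulli_has_derivative_velocity[OF u t x]]
    have d: "(p t has_derivative (\<lambda>v. (- ?D) \<bullet> v)) (at x)"
      unfolding p_def by (simp only: diff_0 inner_minus_left)
    then show "p t differentiable (at x)" by (rule differentiableI)
    show "divergence (?u t) x = 0" "curl (?u t) x = \<alpha>"
      by (rule velocity_divergence_curl[OF u t x])+
    show "?D + grad (p t) x = 0"
      unfolding grad_eqI[OF d] by simp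
  next
    fix t y assume t: "t \<in> I" and "y \<in> frontier (\<Omega> t)"
    interpret radial_domain "h t" "\<Omega> t" by (rule radial_domain[OF t])
    obtain x where x: "x \<in> circ" "y = bdry_param (h t) x"
      using \<open>y \<in> frontier (\<Omega> t)\<close> unfolding frontier_domain by blast
    have "deriv (\<lambda>s. h s x) t = Jac (h t) x / (1 + h t x) * DN (h t) (\<psi> t) x + \<alpha> / 2 * Mop (h t) x"
      using sys t x(1) unfolding circle_system_solution_def by blast
    from dynamic_condition_iff[OF \<psi> t x(1) this, of \<sigma> \<kappa>] sys t x
    show "p t y = \<sigma> * bdry_curvature (\<Omega> t) y"
      unfolding circle_system_solution_def by (simp add: p_def)
  next
    fix t x assume t: "t \<in> I" and x: "x \<in> circ"
    show "normal_velocity h \<Omega> t x = ?u t (bdry_param (h t) x) \<bullet> outer_normal (\<Omega> t) (bdry_param (h t) x)"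
      using kinematic_condition_iff[OF bspec[OF \<psi> t] t x] sys t x
      unfolding circle_system_solution_def by blast
  qed
  then show ?thesis by blast
qed

end

section \<open>Choice of the function of time\<close>

lemma normalization_continuous:
  assumes "normalization \<kappa>" "open I" "is_interval I" "drop_geometry I h \<Omega>" "Ck_time_circ 1 I \<psi>"
  shows "continuous_on I (\<lambda>t. \<kappa> (h t) (\<psi> t))"
  using assms unfolding normalization_def drop_geometry_def by blast

lemma normalization_add_const:
  assumes "normalization \<kappa>" "Ck_circ 2 h" "\<forall>x\<in>circ. -1 < h x" "Ck_circ 1 \<psi>"
  shows "\<kappa> h (\<lambda>x. \<psi> x + c) = \<kappa> h \<psi>"
  using assms unfolding normalization_def by blast

text \<open>Adding \<open>c\<close> to the potential changes the Bernoulli function by the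
  derivative of \<open>c\<close> alone, since the gradient, the conjugate and
  \<open>\<kappa>\<close> ignore constants. The required derivative is thus known in advance, and an
  antiderivative takes the place of an implicit equation for \<open>c\<close>.\<close>

lemma normalized_potential_exists:
  assumes I: "open I" "is_interval I" and geom: "drop_geometry I h \<Omega>" and \<kappa>: "normalization \<kappa>"
    and fb: "free_boundary_solution \<sigma> \<alpha> I h \<Omega> u p" and pot: "velocity_potential \<alpha> I \<Omega> u \<Phi>"
  shows "\<exists>c. velocity_potential \<alpha> I \<Omega> u (\<lambda>t x. \<Phi> t x + c t) \<and>
    circle_system_solution \<kappa> \<sigma> \<alpha> I h (bdry_trace h (\<lambda>t x. \<Phi> t x + c t))"
proof -
  interpret drop I h \<Omega> using I geom by unfold_locales
  obtain W g G where "drop_potential I h \<Omega> \<Phi> W g G"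
    using regular_potential_extension pot unfolding velocity_potential_def by blast
  then interpret P: drop_potential I h \<Omega> \<Phi> W g G .
  define \<psi> where "\<psi> = bdry_trace h \<Phi>"
  define k where "k = (\<lambda>t. \<kappa> (h t) (\<psi> t))"
  have \<psi>: "Ck_time_circ 1 I \<psi>"
    by (rule P.trace_Ck_1) (simp add: \<psi>_def bdry_trace_def)
  have k: "continuous_on I k"
    unfolding k_def by (rule normalization_continuous[OF \<kappa> I geom \<psi>])
  \<comment> \<open>The defect of the Bernoulli constant, measured at the origin, which lies in
    every \<open>\<Omega> t\<close>.\<close>
  define b where "b = (\<lambda>t. \<sigma> - \<alpha>\<^sup>2 / 8 - (P.bernoulli \<alpha> (k t) t 0 + p t 0))"
  have axis0: "continuous_on I (\<lambda>t. f (t, 0))"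
    if "continuous_on (closed_spacetime I \<Omega>) f" for f :: "real \<times> (real^2) \<Rightarrow> real"
  proof (rule continuous_on_compose2[OF that])
    show "(\<lambda>t. (t, 0)) ` I \<subseteq> closed_spacetime I \<Omega>"
      using radial_domain.zero_in_domain[OF radial_domain] closure_subset
      by (fastforce simp: closed_spacetime_def)
  qed (intro continuous_intros)
  have "continuous_on (closed_spacetime I \<Omega>) (\<lambda>(t, x). p t x)"
    using fb unfolding free_boundary_solution_def by blast
  from axis0[OF this] axis0[OF P.continuous_on_bernoulli[OF k]]
  have "continuous_on I b"
    unfolding b_def by (intro continuous_intros) simp_all
  then obtain c where c: "\<And>t. t \<in> I \<Longrightarrow> (c has_real_derivative b t) (at t)"
    using antiderivative_open_interval[OF I] by blast
  interpret Q: drop_potential I h \<Omega> "\<lambda>t x. \<Phi> t x + c t" "W \<inter> I \<times> UNIV" "\<lambda>z. g z + c (fst z)" G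
    by (rule P.add_function_of_time[OF c \<open>continuous_on I b\<close>])
  have u: "\<forall>s\<in>I. \<forall>y\<in>closure (\<Omega> s). u s y = rotating_velocity \<alpha> \<Omega> (\<lambda>t x. \<Phi> t x + c t) s y"
    using pot by (simp add: velocity_potential_def rotating_velocity_def grad_on_def frechet_derivative_add_const)
  have "velocity_potential \<alpha> I \<Omega> u (\<lambda>t x. \<Phi> t x + c t)"
    unfolding velocity_potential_def using Q.regular_potential Q.harmonic u by blast
  moreover have "circle_system_solution \<kappa> \<sigma> \<alpha> I h (bdry_trace h (\<lambda>t x. \<Phi> t x + c t))"
  proof (rule Q.circle_system_if_free_boundary[OF fb u])
    fix t assume t: "t \<in> I"
    have "0 \<in> closure (\<Omega> t)"
      using radial_domain.zero_in_domain[OF radial_domain[OF t]] closure_subset by blast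
    then have W: "(t, 0) \<in> W" by (rule P.closure_in_W[OF t])
    have "((\<lambda>z. c (fst z)) has_derivative (\<lambda>v. b t * fst v)) (at (t, 0 :: real^2))"
      using has_derivative_along[OF has_derivative_fst[OF has_derivative_ident] fst_conv
          c[OF t, unfolded has_field_derivative_def]] .
    from has_derivative_add[OF Ck_1D(1)[OF P.g W] this]
    have dQ: "frechet_derivative (\<lambda>z. g z + c (fst z)) (at (t, 0)) =
        (\<lambda>v. frechet_derivative g (at (t, 0)) v + b t * fst v)"
      by (rule frechet_derivative_at[symmetric])
    have "\<kappa> (h t) (\<lambda>x. \<psi> t x + c t) = k t"
      unfolding k_def
      by (rule normalization_add_const[OF \<kappa> Ck_circ_slice[OF h_Ck_2 t] _ Ck_circ_slice[OF \<psi> t]])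
        (use h_gt[OF t] in blast)
    moreover have "bdry_trace h (\<lambda>t x. \<Phi> t x + c t) t = (\<lambda>x. \<psi> t x + c t)"
      by (rule ext) (simp add: bdry_trace_def \<psi>_def)
    ultimately show "Q.bernoulli \<alpha> (\<kappa> (h t) (bdry_trace h (\<lambda>t x. \<Phi> t x + c t) t)) t 0 + p t 0 = \<sigma> - \<alpha>\<^sup>2 / 8"
      by (simp add: Q.bernoulli_def dQ b_def P.bernoulli_def)
  qed
  ultimately show ?thesis by blast
qed

text \<open>Existence of a potential and its correction by a function of time are separate clauses,
  so that every potential can be normalized, not only a constructed one. In the converse,
  \<open>regular_potential\<close> expresses that the solution is classical up to the
  boundary.\<close>

theorem theorem3p1:
  fixes \<sigma>\<^sub>0 \<alpha>\<^sub>0 :: real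
    and \<kappa> :: "(real^2 \<Rightarrow> real) \<Rightarrow> (real^2 \<Rightarrow> real) \<Rightarrow> real"
  assumes "\<sigma>\<^sub>0 > 0" and "normalization \<kappa>"
  shows "\<exists>\<delta>>0. \<forall>(I :: real set) (h :: real \<Rightarrow> real^2 \<Rightarrow> real) (\<Omega> :: real \<Rightarrow> (real^2) set).
    open I \<and> is_interval I \<and> drop_geometry I h \<Omega> \<and> (\<forall>t\<in>I. W1inf_norm (h t) < \<delta>) \<longrightarrow>
    (\<forall>u p. free_boundary_solution \<sigma>\<^sub>0 \<alpha>\<^sub>0 I h \<Omega> u p \<longrightarrow>
       (\<exists>\<Phi>. velocity_potential \<alpha>\<^sub>0 I \<Omega> u \<Phi>) \<and>
       (\<forall>\<Phi>. velocity_potential \<alpha>\<^sub>0 I \<Omega> u \<Phi> \<longrightarrow>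
          (\<exists>c :: real \<Rightarrow> real.
             velocity_potential \<alpha>\<^sub>0 I \<Omega> u (\<lambda>t x. \<Phi> t x + c t) \<and>
             circle_system_solution \<kappa> \<sigma>\<^sub>0 \<alpha>\<^sub>0 I h (bdry_trace h (\<lambda>t x. \<Phi> t x + c t))))) \<and>
    (\<forall>\<psi> \<Phi>. circle_system_solution \<kappa> \<sigma>\<^sub>0 \<alpha>\<^sub>0 I h \<psi> \<and>
       (\<forall>t\<in>I. is_harmonic_ext (\<Omega> t) (h t) (\<psi> t) (\<Phi> t)) \<and> regular_potential I \<Omega> \<Phi> \<longrightarrow>
       (\<exists>p. free_boundary_solution \<sigma>\<^sub>0 \<alpha>\<^sub>0 I h \<Omega> (rotating_velocity \<alpha>\<^sub>0 \<Omega> \<Phi>) p))"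
proof (intro exI[of _ "1::real"] conjI allI impI)
  show "(1::real) > 0" by simp
next
  fix I h \<Omega> u p
  assume *: "open I \<and> is_interval I \<and> drop_geometry I h \<Omega> \<and> (\<forall>t\<in>I. W1inf_norm (h t) < 1)"
    and fb: "free_boundary_solution \<sigma>\<^sub>0 \<alpha>\<^sub>0 I h \<Omega> u p"
  interpret drop I h \<Omega> using * by unfold_locales auto
  show "\<exists>\<Phi>. velocity_potential \<alpha>\<^sub>0 I \<Omega> u \<Phi>"
    by (rule velocity_potential_exists) (use fb in \<open>auto simp: free_boundary_solution_def\<close>)
next
  fix I h \<Omega> u p \<Phi>
  assume *: "open I \<and> is_interval I \<and> drop_geometry I h \<Omega> \<and> (\<forall>t\<in>I. W1inf_norm (h t) < 1)"
    and fb: "free_boundary_solution \<sigma>\<^sub>0 \<alpha>\<^sub>0 I h \<Omega> u p" and pot: "velocity_potential \<alpha>\<^sub>0 I \<Omega> u \<Phi>"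
  show "\<exists>c. velocity_potential \<alpha>\<^sub>0 I \<Omega> u (\<lambda>t x. \<Phi> t x + c t) \<and>
      circle_system_solution \<kappa> \<sigma>\<^sub>0 \<alpha>\<^sub>0 I h (bdry_trace h (\<lambda>t x. \<Phi> t x + c t))"
    by (rule normalized_potential_exists[OF _ _ _ assms(2) fb pot]) (use * in auto)
next
  fix I h \<Omega> \<psi> \<Phi>
  assume *: "open I \<and> is_interval I \<and> drop_geometry I h \<Omega> \<and> (\<forall>t\<in>I. W1inf_norm (h t) < 1)"
    and **: "circle_system_solution \<kappa> \<sigma>\<^sub>0 \<alpha>\<^sub>0 I h \<psi> \<and>
       (\<forall>t\<in>I. is_harmonic_ext (\<Omega> t) (h t) (\<psi> t) (\<Phi> t)) \<and> regular_potential I \<Omega> \<Phi>"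
  interpret drop I h \<Omega> using * by unfold_locales auto
  obtain W g G where "drop_potential I h \<Omega> \<Phi> W g G"
    by (rule regular_potential_extension[of \<Phi>]) (use ** in \<open>auto simp: is_harmonic_ext_def\<close>)
  then interpret P: drop_potential I h \<Omega> \<Phi> W g G .
  have "Ck_time_circ 1 I \<psi>" using ** by (simp add: circle_system_solution_def)
  then have "continuous_on I (\<lambda>t. \<kappa> (h t) (\<psi> t))"
    using normalization_continuous[OF assms(2)] * by blast
  then show "\<exists>p. free_boundary_solution \<sigma>\<^sub>0 \<alpha>\<^sub>0 I h \<Omega> (rotating_velocity \<alpha>\<^sub>0 \<Omega> \<Phi>) p"
    by (rule P.free_boundary_if_circle_system[rotated 2]) (use ** in \<open>auto simp: is_harmonic_ext_def\<close>)
qed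

end
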